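(* For every integer $k\ge 1$ there is a $k$-samplizer with the following cost. Let $\mathcal{A}^{U_1,\dots,U_k}$ be any quantum query algorithm that makes $Q_j$ queries to $U_j$ for each $1\le j\le k$ (a query being an application of $U_j$, $U_j^\dagger$, or their controlled versions), let $Q=Q_1+\dots+Q_k$, let $\rho_1,\dots,\rho_k$ be $n$-qubit quantum states, and let $\delta>0$. Then the quantum channel $\mathsf{Samplize}_\delta\langle\mathcal{A}^{U_1,\dots,U_k}\rangle[\rho_1,\dots,\rho_k]$ uses $O\!\left(\frac{Q_jQ}{\delta}\log^2\frac{Q}{\delta}\right)$ samples of $\rho_j$ for each $1\le j\le k$. Moreover, if $\mathcal{A}^{U_1,\dots,U_k}$ uses $T$ one- and two-qubit gates (besides the queries), then the samplized channel uses $T+O\!\left(\frac{Q^2 n}{\delta}\log^2\frac{Q}{\delta}\right)$ one- and two-qubit gates.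
   Context: A quantum query algorithm with oracles $U_1,\dots,U_k$ is a circuit $W_T V_T W_{T-1}V_{T-1}\cdots W_1V_1W_0$ where each $V_i$ is a query to (controlled-)$U_j$ or (controlled-)$U_j^\dagger$ for some $j$ and the $W_i$ are fixed unitaries built from one- and two-qubit gates, independent of the oracles. For an $n$-qubit operator $A$, reals $\alpha,\varepsilon\ge 0$ and integer $a\ge 1$, an $(n+a)$-qubit unitary $B$ is an $(\alpha,a,\varepsilon)$-block-encoding of $A$ if $\|\alpha(\langle 0|^{\otimes a}\otimes I)B(|0\rangle^{\otimes a}\otimes I)-A\|\le\varepsilon$ (operator norm). A $k$-samplizer $\mathsf{Samplize}_*\langle *\rangle[*]$ is a converter that, given a precision $\delta>0$, a quantum query algorithm $\mathcal{A}^{U_1,\dots,U_k}$, and $n$-qubit states $\rho_1,\dots,\rho_k$, produces a quantum channel (implemented by one- and two-qubit gates acting on samples of $\rho_1,\dots,\rho_k$ and the input) such that there exist unitaries $U_{\rho_1},\dots,U_{\rho_k}$ which are $(1,m,0)$-block-encodings of $\rho_1/2,\dots,\rho_k/2$ respectively (for some $m\ge1$) with $\|\mathsf{Samplize}_\delta\langle\mathcal{A}^{U_1,\dots,U_k}\rangle[\rho_1,\dots,\rho_k]-\mathcal{A}^{U_{\rho_1},\dots,U_{\rho_k}}\|_\diamond\le\delta$, where $\|\cdot\|_\diamond$ is the diamond norm and $\mathcal{A}^{U_{\rho_1},\dots}$ denotes the unitary channel of the algorithm with these oracles. *)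

theory Defs
  imports Complex_Main
begin

text \<open>A matrix is a function nat => nat => complex; its dimension d is passed
explicitly and only entries with indices < d are meaningful.  A register of N
qubits has dimension 2^N; basis index x, qubit q carries the value bit x q.\<close>

type_synonym cmat = "nat \<Rightarrow> nat \<Rightarrow> complex"

definition mprod :: "nat \<Rightarrow> cmat \<Rightarrow> cmat \<Rightarrow> cmat" where
  "mprod d A B = (\<lambda>i j. \<Sum>l<d. A i l * B l j)"

definition adj :: "cmat \<Rightarrow> cmat" where
  "adj A = (\<lambda>i j. cnj (A j i))"

definition idm :: cmat where
  "idm = (\<lambda>i j. if i = j then 1 else 0)"

definition mtrace :: "nat \<Rightarrow> cmat \<Rightarrow> complex" where
  "mtrace d A = (\<Sum>i<d. A i i)"

definition unitary :: "nat \<Rightarrow> cmat \<Rightarrow> bool" where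
  "unitary d U \<longleftrightarrow> (\<forall>i<d. \<forall>j<d. mprod d U (adj U) i j = idm i j \<and> mprod d (adj U) U i j = idm i j)"

definition psd :: "nat \<Rightarrow> cmat \<Rightarrow> bool" where
  "psd d B \<longleftrightarrow> (\<forall>v :: nat \<Rightarrow> complex.
      Im (\<Sum>i<d. \<Sum>j<d. cnj (v i) * B i j * v j) = 0 \<and>
      0 \<le> Re (\<Sum>i<d. \<Sum>j<d. cnj (v i) * B i j * v j))"

definition density :: "nat \<Rightarrow> cmat \<Rightarrow> bool" where
  "density d \<rho> \<longleftrightarrow> psd d \<rho> \<and> mtrace d \<rho> = 1"

definition vnorm :: "nat \<Rightarrow> (nat \<Rightarrow> complex) \<Rightarrow> real" where
  "vnorm d v = sqrt (\<Sum>i<d. (cmod (v i))\<^sup>2)"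

definition mvec :: "nat \<Rightarrow> cmat \<Rightarrow> (nat \<Rightarrow> complex) \<Rightarrow> (nat \<Rightarrow> complex)" where
  "mvec d A v = (\<lambda>i. \<Sum>j<d. A i j * v j)"

definition opnorm :: "nat \<Rightarrow> cmat \<Rightarrow> real" where
  "opnorm d A = Sup {vnorm d (mvec d A v) | v. vnorm d v = 1}"

text \<open>Trace norm: tr sqrt(A^* A), with the PSD square root (normalised to vanish
outside the index range, so that it is unique).\<close>

definition msqrt :: "nat \<Rightarrow> cmat \<Rightarrow> cmat" where
  "msqrt d M = (THE B. psd d B \<and> (\<forall>i j. i < d \<and> j < d \<longrightarrow> mprod d B B i j = M i j)
                        \<and> (\<forall>i j. \<not> (i < d \<and> j < d) \<longrightarrow> B i j = 0))"

definition trnorm :: "nat \<Rightarrow> cmat \<Rightarrow> real" where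
  "trnorm d A = Re (mtrace d (msqrt d (mprod d (adj A) A)))"

text \<open>Block-encoding: B acts on n+a qubits; the n system qubits are the low
qubits (indices 0..n-1), the a ancilla qubits the high ones.  Hence
(<0|^a (x) I) B (|0>^a (x) I) is the upper-left 2^n x 2^n block of B.\<close>

definition block_encoding :: "nat \<Rightarrow> nat \<Rightarrow> real \<Rightarrow> real \<Rightarrow> cmat \<Rightarrow> cmat \<Rightarrow> bool" where
  "block_encoding n a \<alpha> \<epsilon> B A \<longleftrightarrow> unitary (2 ^ (n + a)) B \<and>
     opnorm (2 ^ n) (\<lambda>i j. of_real \<alpha> * B i j - A i j) \<le> \<epsilon>"

definition tensor :: "nat \<Rightarrow> cmat \<Rightarrow> cmat \<Rightarrow> cmat" where
  "tensor p A B = (\<lambda>x y. A (x mod 2 ^ p) (y mod 2 ^ p) * B (x div 2 ^ p) (y div 2 ^ p))"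

fun tpow :: "nat \<Rightarrow> nat \<Rightarrow> cmat \<Rightarrow> cmat" where
  "tpow p 0 \<rho> = (\<lambda>x y. 1)"
| "tpow p (Suc s) \<rho> = tensor p \<rho> (tpow p s \<rho>)"

definition ptrace :: "nat \<Rightarrow> nat \<Rightarrow> cmat \<Rightarrow> cmat" where
  "ptrace N M Y = (\<lambda>x y. \<Sum>z<2 ^ (M - N). Y (x + 2 ^ N * z) (y + 2 ^ N * z))"

definition uchan :: "nat \<Rightarrow> cmat \<Rightarrow> cmat \<Rightarrow> cmat" where
  "uchan d V X = mprod d (mprod d V X) (adj V)"

text \<open>(Phi (x) id_r)(X) for a linear map Phi on N-qubit operators and X an
operator on N + r qubits (reference on the high qubits).\<close>
definition ext_map :: "nat \<Rightarrow> (cmat \<Rightarrow> cmat) \<Rightarrow> cmat \<Rightarrow> cmat" where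
  "ext_map N \<Phi> X = (\<lambda>x y. \<Phi> (\<lambda>i j. X (i + 2 ^ N * (x div 2 ^ N)) (j + 2 ^ N * (y div 2 ^ N)))
                             (x mod 2 ^ N) (y mod 2 ^ N))"

definition diamond_norm :: "nat \<Rightarrow> (cmat \<Rightarrow> cmat) \<Rightarrow> real" where
  "diamond_norm N \<Phi> = Sup {trnorm (2 ^ (N + r)) (ext_map N \<Phi> X) | r X. trnorm (2 ^ (N + r)) X \<le> 1}"

definition idx :: "nat list \<Rightarrow> nat \<Rightarrow> nat" where
  "idx ws x = (\<Sum>i<length ws. if bit x (ws ! i) then 2 ^ i else 0)"

definition embed :: "nat \<Rightarrow> nat list \<Rightarrow> cmat \<Rightarrow> cmat" where
  "embed M ws G = (\<lambda>x y. if (\<forall>q<M. q \<notin> set ws \<longrightarrow> bit x q = bit y q)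
                           then G (idx ws x) (idx ws y) else 0)"

type_synonym gate = "cmat \<times> nat list"

definition is_gate :: "nat \<Rightarrow> gate \<Rightarrow> bool" where
  "is_gate M g \<longleftrightarrow> (length (snd g) = 1 \<or> length (snd g) = 2) \<and> distinct (snd g) \<and>
      set (snd g) \<subseteq> {..<M} \<and> unitary (2 ^ length (snd g)) (fst g)"

fun circ :: "nat \<Rightarrow> gate list \<Rightarrow> cmat" where
  "circ M [] = idm"
| "circ M (g # gs) = mprod (2 ^ M) (circ M gs) (embed M (snd g) (fst g))"

text \<open>AQuery j dg c ws: query to oracle j (0-indexed), adjoint iff dg, controlled
on qubit q iff c = Some q, acting on target qubits ws.\<close>
datatype step = AGate cmat "nat list" | AQuery nat bool "nat option" "nat list"

record qalg =
  width :: nat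
  owid :: "nat \<Rightarrow> nat"       (* number of qubits oracle j acts on *)
  steps :: "step list"

definition valid_alg :: "nat \<Rightarrow> qalg \<Rightarrow> bool" where
  "valid_alg k A \<longleftrightarrow> (\<forall>s\<in>set (steps A). case s of
       AGate G ws \<Rightarrow> is_gate (width A) (G, ws)
     | AQuery j dg c ws \<Rightarrow> j < k \<and> length ws = owid A j \<and> distinct ws \<and> set ws \<subseteq> {..<width A} \<and>
          (case c of None \<Rightarrow> True | Some q \<Rightarrow> q < width A \<and> q \<notin> set ws))"

definition ctrl :: "cmat \<Rightarrow> cmat" where
  "ctrl U = (\<lambda>a b. if bit a 0 \<noteq> bit b 0 then 0
                   else if bit a 0 then U (a div 2) (b div 2) else idm a b)"

fun step_op :: "nat \<Rightarrow> (nat \<Rightarrow> cmat) \<Rightarrow> step \<Rightarrow> cmat" where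
  "step_op M U (AGate G ws) = embed M ws G"
| "step_op M U (AQuery j dg None ws) = embed M ws (if dg then adj (U j) else U j)"
| "step_op M U (AQuery j dg (Some q) ws) = embed M (q # ws) (ctrl (if dg then adj (U j) else U j))"

fun run_steps :: "nat \<Rightarrow> (nat \<Rightarrow> cmat) \<Rightarrow> step list \<Rightarrow> cmat" where
  "run_steps M U [] = idm"
| "run_steps M U (s # ss) = mprod (2 ^ M) (run_steps M U ss) (step_op M U s)"

definition alg_unitary :: "qalg \<Rightarrow> (nat \<Rightarrow> cmat) \<Rightarrow> cmat" where
  "alg_unitary A U = run_steps (width A) U (steps A)"

definition is_query_to :: "nat \<Rightarrow> step \<Rightarrow> bool" where
  "is_query_to j s = (case s of AQuery j' _ _ _ \<Rightarrow> j' = j | AGate _ _ \<Rightarrow> False)"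

definition query_count :: "qalg \<Rightarrow> nat \<Rightarrow> nat" where
  "query_count A j = length (filter (is_query_to j) (steps A))"

definition gate_count :: "qalg \<Rightarrow> nat" where
  "gate_count A = length (filter (\<lambda>s. case s of AGate _ _ \<Rightarrow> True | _ \<Rightarrow> False) (steps A))"

text \<open>A samplized circuit: s_cnt j samples of rho_j, anc fresh ancillas in |0>,
and a sequence of one-/two-qubit gates.  Wire layout: qubits 0..N-1 input,
then the samples of rho_0, ..., rho_(k-1) (n qubits each), then the ancillas.
Everything except the input register is traced out at the end.\<close>
record scirc =
  s_cnt :: "nat \<Rightarrow> nat"
  anc :: nat
  sgates :: "gate list"

fun sample_state :: "nat \<Rightarrow> (nat \<Rightarrow> nat) \<Rightarrow> (nat \<Rightarrow> cmat) \<Rightarrow> nat list \<Rightarrow> cmat" where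
  "sample_state n s \<rho> [] = (\<lambda>x y. 1)"
| "sample_state n s \<rho> (j # js) = tensor (s j * n) (tpow n (s j) (\<rho> j)) (sample_state n s \<rho> js)"

definition zero_state :: cmat where
  "zero_state = (\<lambda>x y. if x = 0 \<and> y = 0 then 1 else 0)"

definition sc_width :: "nat \<Rightarrow> nat \<Rightarrow> nat \<Rightarrow> scirc \<Rightarrow> nat" where
  "sc_width k N n C = N + (\<Sum>j<k. s_cnt C j) * n + anc C"

definition sc_channel :: "nat \<Rightarrow> nat \<Rightarrow> nat \<Rightarrow> scirc \<Rightarrow> (nat \<Rightarrow> cmat) \<Rightarrow> cmat \<Rightarrow> cmat" where
  "sc_channel k N n C \<rho> X =
     (let M = sc_width k N n C in
      ptrace N M (uchan (2 ^ M) (circ M (sgates C))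
        (tensor N X (tensor ((\<Sum>j<k. s_cnt C j) * n) (sample_state n (s_cnt C) \<rho> [0..<k]) zero_state))))"

text \<open>A k-samplizer: from delta, the algorithm and n (but not the states) it
produces a circuit; on samples of any n-qubit states rho_0..rho_(k-1) the
resulting channel is delta-close in diamond norm to the algorithm run with some
(1, m, 0)-block-encodings of rho_j/2 (m = oracle width minus n).\<close>
definition is_samplizer :: "nat \<Rightarrow> (real \<Rightarrow> qalg \<Rightarrow> nat \<Rightarrow> scirc) \<Rightarrow> bool" where
  "is_samplizer k S \<longleftrightarrow>
    (\<forall>\<delta> A n \<rho>. 0 < \<delta> \<and> valid_alg k A \<and> 1 \<le> n \<and> (\<forall>j<k. n + 1 \<le> owid A j) \<and>
        (\<forall>j<k. density (2 ^ n) (\<rho> j)) \<longrightarrow>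
      (let C = S \<delta> A n; N = width A in
        (\<forall>g\<in>set (sgates C). is_gate (sc_width k N n C) g) \<and>
        (\<exists>U. (\<forall>j<k. block_encoding n (owid A j - n) 1 0 (U j) (\<lambda>x y. \<rho> j x y / 2)) \<and>
             diamond_norm N (\<lambda>X x y. sc_channel k N n C \<rho> X x y
                                     - uchan (2 ^ N) (alg_unitary A U) X x y) \<le> \<delta>)))"

end

theory Submission
  imports Defs "HOL-Complex_Analysis.Complex_Analysis" "Jordan_Normal_Form.Spectral_Radius"
begin

text \<open>Take \<open>U\<^sub>j = \<rho>\<^sub>j/2 - i X sqrt (1 - \<rho>\<^sub>j\<^sup>2/4) = -iX exp (i X arcsin (\<rho>\<^sub>j/2))\<close>, where \<open>X\<close> acts on one
  ancilla qubit of the block-encoding, and expand \<open>arcsin (x/2) = \<Sum>\<^sub>k a\<^sub>k x\<^sup>k\<close> with geometrically decaying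
  \<open>a\<^sub>k\<close>.  All factors \<open>exp (i \<Delta> X \<rho>\<^sup>k)\<close> commute, so \<open>U\<^sub>j\<close> is approximated by a product of such rotations
  with \<open>k < K = O(log (Q/\<delta>))\<close> and \<open>\<Delta> = a\<^sub>k/T\<close>, \<open>T = O(Q/\<delta>)\<close>.  One rotation consumes \<open>k\<close> fresh samples: if
  \<open>W\<close> swaps the system successively with the \<open>k\<close> samples, controlled by the ancilla qubit, then
  \<open>W\<^sup>-\<^sup>1 exp (i \<Delta> X) W\<close> agrees with the rotation up to \<open>O(\<Delta>\<^sup>2)\<close> once the samples are traced out, because
  tracing out a sample turns the swap into multiplication by \<open>\<rho>\<close>.  The errors of the \<open>T\<close> repetitions
  add up to \<open>O(1/T)\<close>.  A control qubit of the query only has to control \<open>exp (i \<Delta> X)\<close>, and for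
  \<open>\<delta> \<ge> 2\<close> the empty circuit suffices.\<close>

section \<open>Spectral theorem\<close>

text \<open>The circuit has to be fixed before the states are known, while the block-encodings may
  depend on them. So the oracle is a fixed function of \<rho> whose expansion coefficients are
  universal. Halving \<rho> is essential: it keeps the argument of the arcsine in [0, 1/2], away
  from the singularities at 1 and -1, so a truncation of logarithmic degree suffices. One query
  needs T times the sum of all k < K samples, that is O(T K^2), which is the origin of the squared
  logarithm.

  The obstacle is composition. After a gadget the system is correlated with the used samples and
  with the reference, and errors must nevertheless stay additive. Hence the comparison is made in
  the Heisenberg picture: a functional on operators is evaluated at V' Z V for the circuit and at G'
  Z G for the ideal operator, for all observables Z that do not touch the used samples. Only the
  product structure of fresh samples enters. Duality of the trace norm, obtained from the spectral
  theorem, then converts the estimates into the diamond norm.\<close>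

definition eqm :: "nat \<Rightarrow> cmat \<Rightarrow> cmat \<Rightarrow> bool" where
  "eqm d A B \<longleftrightarrow> (\<forall>i<d. \<forall>j<d. A i j = B i j)"

definition diag :: "(nat \<Rightarrow> complex) \<Rightarrow> cmat" where
  "diag f = (\<lambda>i j. if i = j then f i else 0)"

definition is_hermitian :: "nat \<Rightarrow> cmat \<Rightarrow> bool" where
  "is_hermitian d A \<longleftrightarrow> (\<forall>i<d. \<forall>j<d. A i j = cnj (A j i))"

lemma eqm_refl [simp]: "eqm d A A" by (simp add: eqm_def)
lemma eqm_sym: "eqm d A B \<Longrightarrow> eqm d B A" by (simp add: eqm_def)
lemma eqm_trans [trans]: "eqm d A B \<Longrightarrow> eqm d B C \<Longrightarrow> eqm d A C" by (simp add: eqm_def)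

lemma eqm_mprod: "eqm d A A' \<Longrightarrow> eqm d B B' \<Longrightarrow> eqm d (mprod d A B) (mprod d A' B')"
  by (simp add: eqm_def mprod_def)

lemma mprod_assoc: "mprod d (mprod d A B) C = mprod d A (mprod d B C)"
proof (intro ext)
  fix i j
  have "mprod d (mprod d A B) C i j = (\<Sum>l<d. \<Sum>m<d. A i m * B m l * C l j)"
    by (simp add: mprod_def sum_distrib_right)
  also have "\<dots> = (\<Sum>m<d. \<Sum>l<d. A i m * B m l * C l j)" by (rule sum.swap)
  also have "\<dots> = mprod d A (mprod d B C) i j"
    by (simp add: mprod_def sum_distrib_left mult.assoc)
  finally show "mprod d (mprod d A B) C i j = mprod d A (mprod d B C) i j" .
qed

lemma adj_mprod: "adj (mprod d A B) = mprod d (adj B) (adj A)"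
  by (intro ext) (simp add: mprod_def adj_def mult.commute)

lemma adj_adj [simp]: "adj (adj A) = A" by (simp add: adj_def)

lemma mprod_diag_right: "j < d \<Longrightarrow> mprod d A (diag f) i j = A i j * f j"
  by (simp add: mprod_def diag_def if_distrib [of "\<lambda>x. _ * x"] cong: if_cong)

lemma mprod_diag_left: "i < d \<Longrightarrow> mprod d (diag f) A i j = f i * A i j"
proof -
  assume "i < d"
  have "mprod d (diag f) A i j = (\<Sum>l<d. if l = i then f i * A i j else 0)"
    unfolding mprod_def diag_def by (intro sum.cong) auto
  with \<open>i < d\<close> show ?thesis by simp
qed

lemma idm_diag: "idm = diag (\<lambda>_. 1)" by (simp add: idm_def diag_def)

text \<open>The product truncates, so entries outside the index range become 0 and the unit laws
  hold only up to \<open>eqm\<close>. Associativity and \<open>adj_mprod\<close>, in contrast, are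
  genuine equations.\<close>

lemma eqm_mprod_idm: "eqm d (mprod d A idm) A" "eqm d (mprod d idm A) A"
  by (simp_all add: eqm_def idm_diag mprod_diag_left mprod_diag_right)

lemma adj_diag: "adj (diag f) = diag (\<lambda>i. cnj (f i))"
  by (intro ext) (simp add: adj_def diag_def)

lemma eqm_diag_diag: "eqm d (mprod d (diag f) (diag g)) (diag (\<lambda>i. f i * g i))"
  by (simp add: eqm_def mprod_diag_left) (simp add: diag_def)

lemma unitary_eqm: "unitary d U \<longleftrightarrow> eqm d (mprod d U (adj U)) idm \<and> eqm d (mprod d (adj U) U) idm"
  by (auto simp: unitary_def eqm_def)

lemma unitary_adj: "unitary d U \<Longrightarrow> unitary d (adj U)"
  by (simp add: unitary_eqm)

lemma eqm_cancel:
  assumes "eqm d (mprod d A B) idm"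
  shows "eqm d (mprod d A (mprod d B C)) C"
proof -
  have "eqm d (mprod d (mprod d A B) C) (mprod d idm C)" using assms by (intro eqm_mprod) auto
  also have "eqm d \<dots> C" by (rule eqm_mprod_idm)
  finally show ?thesis by (simp add: mprod_assoc)
qed

lemma unitary_mprod:
  assumes "unitary d U" "unitary d V"
  shows "unitary d (mprod d U V)"
proof -
  have 1: "eqm d (mprod d U (mprod d V (mprod d (adj V) (adj U)))) (mprod d U (adj U))"
    using assms by (intro eqm_mprod eqm_refl eqm_cancel) (simp add: unitary_eqm)
  have 2: "eqm d (mprod d (adj V) (mprod d (adj U) (mprod d U V))) (mprod d (adj V) V)"
    using assms by (intro eqm_mprod eqm_refl eqm_cancel) (simp add: unitary_eqm)
  show ?thesis
    using 1 2 assms unfolding unitary_eqm by (auto simp: adj_mprod mprod_assoc intro: eqm_trans)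
qed

lemma vnorm_L2: "vnorm d v = L2_set (\<lambda>i. cmod (v i)) {..<d}"
  by (simp add: vnorm_def L2_set_def)

lemma vnorm_nonneg [simp]: "0 \<le> vnorm d v" by (simp add: vnorm_L2)

lemma vnorm_sq: "(vnorm d v)\<^sup>2 = (\<Sum>i<d. (cmod (v i))\<^sup>2)"
  by (simp add: vnorm_def sum_nonneg)

lemma vnorm_sq_complex: "complex_of_real ((vnorm d v)\<^sup>2) = (\<Sum>i<d. cnj (v i) * v i)"
proof -
  have "complex_of_real ((vnorm d v)\<^sup>2) = (\<Sum>i<d. complex_of_real ((cmod (v i))\<^sup>2))"
    by (simp add: vnorm_sq)
  also have "\<dots> = (\<Sum>i<d. cnj (v i) * v i)"
    by (intro sum.cong refl) (metis complex_norm_square mult.commute)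
  finally show ?thesis .
qed

text \<open>Householder reflection exchanging \<open>v\<close> and the last basis vector; the sign condition on
  \<open>v d\<close> keeps the denominator away from 0.\<close>

lemma unitary_last_column:
  assumes nv: "vnorm (Suc d) v = 1" and vd: "v d = complex_of_real t" and t: "t \<le> 0"
  obtains U where "adj U = U" "eqm (Suc d) (mprod (Suc d) U U) idm" "\<And>i. i \<le> d \<Longrightarrow> U i d = v i"
proof -
  define w where "w = (\<lambda>i. v i - (if i = d then 1 else 0))"
  define c where "c = complex_of_real (1 - t)"
  define U :: cmat where "U = (\<lambda>i j. idm i j - w i * cnj (w j) / c)"
  have t1: "c \<noteq> 0" using t unfolding c_def by (simp only: of_real_eq_0_iff)
  \<comment> \<open>This is |w|^2 = 2 - 2t, obtained from |v| = 1. Hence U = I - 2 w w*/|w|^2, the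
    reflection in the hyperplane orthogonal to w.\<close>
  have ww: "(\<Sum>i<Suc d. cnj (w i) * w i) = 2 * c"
  proof -
    have "(\<Sum>i<Suc d. cnj (w i) * w i) = (\<Sum>i<d. cnj (v i) * v i) + (of_real t - 1)^2"
      by (simp add: w_def vd power2_eq_square)
    moreover have "(\<Sum>i<d. cnj (v i) * v i) + of_real t ^ 2 = 1"
      using vnorm_sq_complex [of "Suc d" v] nv by (simp add: vd power2_eq_square)
    ultimately show ?thesis by (simp add: c_def power2_eq_square algebra_simps)
  qed
  have wd: "w d = - c" by (simp add: w_def vd c_def)
  have cc: "cnj c = c" by (simp add: c_def)
  have a: "adj U = U"
    by (intro ext) (simp add: adj_def U_def idm_def c_def)
  have b: "eqm (Suc d) (mprod (Suc d) U U) idm"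
    unfolding eqm_def
  proof (intro allI impI)
    fix i j assume ij: "i < Suc d" "j < Suc d"
    have "mprod (Suc d) U U i j = (\<Sum>l<Suc d. idm i l * idm l j - idm i l * (w l * cnj (w j) / c)
           - (w i * cnj (w l) / c) * idm l j + w i * cnj (w j) / c^2 * (cnj (w l) * w l))"
      unfolding mprod_def U_def by (intro sum.cong refl) (use t1 in \<open>simp add: field_simps power2_eq_square\<close>)
    also have "\<dots> = mprod (Suc d) idm idm i j - mprod (Suc d) idm (\<lambda>l j. w l * cnj (w j) / c) i j
         - mprod (Suc d) (\<lambda>i l. w i * cnj (w l) / c) idm i j
         + w i * cnj (w j) / c^2 * (\<Sum>l<Suc d. cnj (w l) * w l)"
      by (simp only: mprod_def sum.distrib sum_subtractf sum_distrib_left)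
    also have "\<dots> = idm i j - w i * cnj (w j) / c - w i * cnj (w j) / c
         + w i * cnj (w j) / c^2 * (2 * c)"
      using ij eqm_mprod_idm [of "Suc d"] unfolding ww eqm_def by simp
    also have "\<dots> = idm i j" using t1 by (simp add: field_simps power2_eq_square)
    finally show "mprod (Suc d) U U i j = idm i j" .
  qed
  have c: "U i d = v i" if "i \<le> d" for i
  proof -
    have "U i d = idm i d + w i" using t1 unfolding U_def wd by (simp add: cc)
    then show ?thesis by (simp add: w_def idm_def)
  qed
  show ?thesis by (rule that [OF a b c])
qed

text \<open>An eigenvector comes from the nonempty spectrum of a complex matrix. It is normalised
  and multiplied by a phase that makes the last coordinate real and nonpositive, as the Householder
  reflection requires.\<close>

lemma eigenvector_exists:
  fixes A :: cmat
  obtains v \<mu> t where "vnorm (Suc d) v = 1" "v d = complex_of_real t" "t \<le> 0"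
    "\<And>i. i \<le> d \<Longrightarrow> (\<Sum>j<Suc d. A i j * v j) = \<mu> * v i"
proof -
  define M where "M = Matrix.mat (Suc d) (Suc d) (\<lambda>(i,j). A i j)"
  have M: "M \<in> carrier_mat (Suc d) (Suc d)" by (simp add: M_def)
  from spectrum_non_empty [OF M] obtain \<mu> where "eigenvalue M \<mu>" by (auto simp: Spectral_Radius.spectrum_def)
  then obtain u where u: "u \<in> carrier_vec (Suc d)" "u \<noteq> 0\<^sub>v (Suc d)" "M *\<^sub>v u = \<mu> \<cdot>\<^sub>v u"
    using M unfolding eigenvalue_def eigenvector_def by auto
  define x where "x = (\<lambda>i. vec_index u i)"
  have ex: "(\<Sum>j<Suc d. A i j * x j) = \<mu> * x i" if "i \<le> d" for i
  proof -
    have "vec_index (M *\<^sub>v u) i = (\<Sum>j<Suc d. A i j * x j)"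
      using that u(1) by (simp add: M_def scalar_prod_def x_def atLeast0LessThan)
    then show ?thesis using u that by (simp add: x_def)
  qed
  have nz: "vnorm (Suc d) x \<noteq> 0"
  proof
    assume "vnorm (Suc d) x = 0"
    then have "\<forall>i<Suc d. x i = 0" by (simp add: vnorm_L2 L2_set_eq_0_iff)
    then have "u = 0\<^sub>v (Suc d)" using u(1) by (intro eq_vecI) (auto simp: x_def)
    with u(2) show False by simp
  qed
  define r where "r = vnorm (Suc d) x"
  have r: "r > 0" using nz by (simp add: r_def order.strict_iff_order)
  obtain ph where ph: "cmod ph = 1" "ph * x d = - of_real (cmod (x d))"
  proof (cases "x d = 0")
    case True then show ?thesis using that [of 1] by simp
  next
    case False
    show ?thesis
    proof (rule that [of "- cnj (x d) / of_real (cmod (x d))"])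
      show "cmod (- cnj (x d) / complex_of_real (cmod (x d))) = 1" using False by (simp add: norm_divide)
      have "cnj (x d) * x d = of_real (cmod (x d)) * of_real (cmod (x d))"
        by (metis complex_norm_square mult.commute of_real_power power2_eq_square)
      then show "- cnj (x d) / complex_of_real (cmod (x d)) * x d = - complex_of_real (cmod (x d))"
        using False by (simp add: field_simps)
    qed
  qed
  define v where "v = (\<lambda>i. ph / of_real r * x i)"
  show ?thesis
  proof (rule that)
    have "(vnorm (Suc d) v)\<^sup>2 = (\<Sum>i<Suc d. (1/r)\<^sup>2 * (cmod (x i))\<^sup>2)"
      unfolding vnorm_sq using r ph(1) by (simp add: v_def norm_mult norm_divide power_mult_distrib power_divide)
    also have "\<dots> = (1/r)\<^sup>2 * r\<^sup>2" unfolding r_def vnorm_sq sum_distrib_left [symmetric] by simp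
    also have "\<dots> = 1" using r by (simp add: field_simps)
    finally show "vnorm (Suc d) v = 1" by (metis vnorm_nonneg power2_eq_1_iff neg_0_le_iff_le not_one_le_zero)
    have "v d = (ph * x d) / of_real r" by (simp add: v_def)
    then show "v d = complex_of_real (- cmod (x d) / r)" unfolding ph(2) by simp
    show "- cmod (x d) / r \<le> 0" using r by simp
    fix i assume "i \<le> d"
    have "(\<Sum>j<Suc d. A i j * v j) = ph / of_real r * (\<Sum>j<Suc d. A i j * x j)"
      unfolding sum_distrib_left v_def by (intro sum.cong refl) (simp add: algebra_simps)
    then show "(\<Sum>j<Suc d. A i j * v j) = \<mu> * v i" using ex [OF \<open>i \<le> d\<close>] by (simp add: v_def)
  qed
qed

text \<open>Induction on the dimension by deflation. Conjugation with the Householder reflection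
  sends an eigenvector to the last basis vector; the conjugated matrix is Hermitian with last column
  \<mu> e_d, hence block diagonal, and the induction hypothesis diagonalises the leading
  block.\<close>

theorem hermitian_spectral:
  assumes "is_hermitian d A"
  shows "\<exists>B l. unitary d B \<and> eqm d A (mprod d (mprod d B (diag (\<lambda>i. complex_of_real (l i)))) (adj B))"
  using assms
proof (induction d arbitrary: A)
  case 0
  then show ?case by (simp add: unitary_def eqm_def)
next
  case (Suc d)
  let ?D = "Suc d"
  have hA: "eqm ?D (adj A) A" using Suc.prems unfolding is_hermitian_def eqm_def adj_def by metis
  obtain v \<mu> t where v: "vnorm ?D v = 1" "v d = complex_of_real t" "t \<le> 0"
    "\<And>i. i \<le> d \<Longrightarrow> (\<Sum>j<?D. A i j * v j) = \<mu> * v i" using eigenvector_exists [of d A] by metis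
  obtain U where U: "adj U = U" "eqm ?D (mprod ?D U U) idm" "\<And>i. i \<le> d \<Longrightarrow> U i d = v i"
    using unitary_last_column [OF v(1-3)] by metis
  have uU: "unitary ?D U" using U by (simp add: unitary_eqm)
  define A1 where "A1 = mprod ?D U (mprod ?D A U)"
  have "eqm ?D (adj A1) A1"
    unfolding A1_def adj_mprod U(1) mprod_assoc by (intro eqm_mprod eqm_refl hA)
  then have hA1: "A1 i j = cnj (A1 j i)" if "i < ?D" "j < ?D" for i j
    using that unfolding eqm_def adj_def by metis
  have AUd: "mprod ?D A U i d = \<mu> * v i" if "i \<le> d" for i
    using v(4) [OF that] U(3) by (simp add: mprod_def)
  have col: "A1 i d = \<mu> * idm i d" if "i \<le> d" for i
  proof -
    have "A1 i d = (\<Sum>j<?D. U i j * (\<mu> * U j d))"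
      unfolding A1_def using AUd U(3) by (simp add: mprod_def [of _ U "mprod _ _ _"])
    also have "\<dots> = \<mu> * mprod ?D U U i d" by (simp add: mprod_def sum_distrib_left algebra_simps)
    also have "\<dots> = \<mu> * idm i d" using U(2) that by (simp add: eqm_def)
    finally show ?thesis .
  qed
  \<comment> \<open>\<mu> is the last diagonal entry of the Hermitian matrix \<open>A1\<close>,
    hence real.\<close>
  have mu: "\<mu> = complex_of_real (Re \<mu>)"
    using arg_cong [OF hA1 [of d d], of Im] col [of d] by (simp add: idm_def complex_eq_iff)
  have "is_hermitian d A1" unfolding is_hermitian_def using hA1 less_SucI by blast
  from Suc.IH [OF this] obtain B l where B: "unitary d B"
    "eqm d A1 (mprod d (mprod d B (diag (\<lambda>i. complex_of_real (l i)))) (adj B))" by blast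
  define B2 :: cmat where "B2 = (\<lambda>i j. if i < d \<and> j < d then B i j else idm i j)"
  define l2 where "l2 = (\<lambda>i. if i < d then l i else Re \<mu>)"
  have uB2: "unitary ?D B2"
    unfolding unitary_def
  proof (intro allI impI)
    fix i j assume ij: "i < ?D" "j < ?D"
    have s1: "(\<Sum>l<d. B2 i l * cnj (B2 j l)) = (if i < d \<and> j < d then \<Sum>l<d. B i l * cnj (B j l) else 0)"
      by (auto simp: B2_def idm_def intro!: sum.neutral)
    have s2: "(\<Sum>l<d. cnj (B2 l i) * B2 l j) = (if i < d \<and> j < d then \<Sum>l<d. cnj (B l i) * B l j else 0)"
      by (auto simp: B2_def idm_def intro!: sum.neutral)
    have u: "(\<Sum>l<d. B i l * cnj (B j l)) = idm i j" "(\<Sum>l<d. cnj (B l i) * B l j) = idm i j" if "i < d" "j < d"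
      using B(1) that by (simp_all add: unitary_def mprod_def adj_def)
    show "mprod ?D B2 (adj B2) i j = idm i j \<and> mprod ?D (adj B2) B2 i j = idm i j"
      using ij u by (cases "i < d"; cases "j < d") (auto simp: mprod_def adj_def s1 s2, auto simp: B2_def idm_def)
  qed
  have e1: "eqm ?D A1 (mprod ?D (mprod ?D B2 (diag (\<lambda>i. complex_of_real (l2 i)))) (adj B2))"
    unfolding eqm_def
  proof (intro allI impI)
    fix i j assume ij: "i < ?D" "j < ?D"
    have R: "mprod ?D (mprod ?D B2 (diag (\<lambda>i. complex_of_real (l2 i)))) (adj B2) i j
       = (\<Sum>m<d. B2 i m * of_real (l m) * cnj (B2 j m)) + B2 i d * \<mu> * cnj (B2 j d)"
      using mu by (simp add: mprod_def [of _ "mprod _ _ _"] mprod_diag_right l2_def adj_def)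
    show "A1 i j = mprod ?D (mprod ?D B2 (diag (\<lambda>i. complex_of_real (l2 i)))) (adj B2) i j"
    proof (cases "i < d \<and> j < d")
      case True
      then have "A1 i j = (\<Sum>m<d. B i m * of_real (l m) * cnj (B j m))"
        using B(2) by (simp add: eqm_def mprod_def [of _ "mprod _ _ _"] mprod_diag_right adj_def)
      then show ?thesis unfolding R using True by (simp add: B2_def idm_def)
    next
      case False
      have z: "(\<Sum>m<d. B2 i m * of_real (l m) * cnj (B2 j m)) = 0"
        using False ij by (intro sum.neutral) (auto simp: B2_def idm_def)
      have "A1 i j = \<mu> * idm i d * idm j d"
      proof (cases "j = d")
        case True then show ?thesis using col [of i] ij by (simp add: idm_def)
      next
        case False2: False
        with False ij have "i = d" by auto
        then show ?thesis unfolding hA1 [OF ij] using col [of j] ij False2 by (simp add: idm_def)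
      qed
      then show ?thesis unfolding R z using False ij by (auto simp: B2_def idm_def)
    qed
  qed
  have "eqm ?D A (mprod ?D U (mprod ?D A1 U))"
  proof -
    have "eqm ?D (mprod ?D U (mprod ?D U (mprod ?D (mprod ?D A U) U))) (mprod ?D (mprod ?D A U) U)"
      by (rule eqm_cancel [OF U(2)])
    also have "eqm ?D (mprod ?D (mprod ?D A U) U) (mprod ?D A idm)"
      unfolding mprod_assoc by (intro eqm_mprod eqm_refl U(2))
    also have "eqm ?D \<dots> A" by (rule eqm_mprod_idm)
    finally show ?thesis unfolding A1_def mprod_assoc by (rule eqm_sym)
  qed
  also have "eqm ?D (mprod ?D U (mprod ?D A1 U))
     (mprod ?D U (mprod ?D (mprod ?D (mprod ?D B2 (diag (\<lambda>i. complex_of_real (l2 i)))) (adj B2)) U))"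
    by (intro eqm_mprod eqm_refl e1)
  finally have "eqm ?D A (mprod ?D (mprod ?D (mprod ?D U B2) (diag (\<lambda>i. complex_of_real (l2 i)))) (adj (mprod ?D U B2)))"
    unfolding adj_mprod U(1) mprod_assoc .
  then show ?case using unitary_mprod [OF uU uB2] by blast
qed

section \<open>Trace norm\<close>

definition ip :: "nat \<Rightarrow> (nat \<Rightarrow> complex) \<Rightarrow> (nat \<Rightarrow> complex) \<Rightarrow> complex" where
  "ip d u v = (\<Sum>i<d. cnj (u i) * v i)"

text \<open>A bound on the operator norm that avoids the supremum in \<open>opnorm\<close>, so it
  passes to products and adjoints without boundedness side conditions.\<close>

definition mat_bound :: "nat \<Rightarrow> cmat \<Rightarrow> real \<Rightarrow> bool" where
  "mat_bound d A c \<longleftrightarrow> (\<forall>v. vnorm d (mvec d A v) \<le> c * vnorm d v)"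

text \<open>Functional calculus in the eigenbasis B. The function is given on the indices of the
  eigenvectors, so g(\<rho>) is \<open>fun_calc d B (\<lambda>m. g (l m))\<close> when \<rho> has
  eigenvalues \<open>l\<close>.\<close>

definition fun_calc :: "nat \<Rightarrow> cmat \<Rightarrow> (nat \<Rightarrow> complex) \<Rightarrow> cmat" where
  "fun_calc d B f = mprod d (mprod d B (diag f)) (adj B)"

lemma ip_self: "ip d v v = complex_of_real ((vnorm d v)\<^sup>2)"
  unfolding ip_def vnorm_sq_complex ..

lemma ip_cauchy: "cmod (ip d u v) \<le> vnorm d u * vnorm d v"
proof -
  have "cmod (ip d u v) \<le> (\<Sum>i<d. cmod (cnj (u i) * v i))" unfolding ip_def by (rule norm_sum)
  also have "\<dots> = (\<Sum>i<d. \<bar>cmod (u i)\<bar> * \<bar>cmod (v i)\<bar>)" by (simp add: norm_mult)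
  also have "\<dots> \<le> vnorm d u * vnorm d v" unfolding vnorm_L2 by (rule L2_set_mult_ineq)
  finally show ?thesis .
qed

lemma ip_mvec_adj: "ip d u (mvec d A v) = ip d (mvec d (adj A) u) v"
proof -
  have "ip d u (mvec d A v) = (\<Sum>i<d. \<Sum>j<d. cnj (u i) * A i j * v j)"
    by (simp add: ip_def mvec_def sum_distrib_left mult.assoc)
  also have "\<dots> = (\<Sum>j<d. \<Sum>i<d. cnj (u i) * A i j * v j)" by (rule sum.swap)
  also have "\<dots> = ip d (mvec d (adj A) u) v"
    by (simp add: ip_def mvec_def adj_def sum_distrib_left sum_distrib_right mult_ac)
  finally show ?thesis .
qed

lemma mvec_mprod: "mvec d (mprod d A B) v = mvec d A (mvec d B v)"
proof
  fix i
  have "mvec d (mprod d A B) v i = (\<Sum>j<d. \<Sum>l<d. A i l * B l j * v j)"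
    by (simp add: mvec_def mprod_def sum_distrib_right)
  also have "\<dots> = (\<Sum>l<d. \<Sum>j<d. A i l * B l j * v j)" by (rule sum.swap)
  also have "\<dots> = mvec d A (mvec d B v) i" by (simp add: mvec_def sum_distrib_left mult.assoc)
  finally show "mvec d (mprod d A B) v i = mvec d A (mvec d B v) i" .
qed

lemma ip_cong: "(\<And>i. i < d \<Longrightarrow> u i = u' i) \<Longrightarrow> (\<And>i. i < d \<Longrightarrow> v i = v' i) \<Longrightarrow> ip d u v = ip d u' v'"
  by (simp add: ip_def)

lemma mvec_eqm: "eqm d A B \<Longrightarrow> i < d \<Longrightarrow> mvec d A v i = mvec d B v i"
  by (simp add: eqm_def mvec_def)

lemma mvec_idm: "i < d \<Longrightarrow> mvec d idm v i = v i"
  by (simp add: mvec_def idm_def if_distrib [of "\<lambda>x. x * _"] cong: if_cong)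

lemma mvec_diag: "i < d \<Longrightarrow> mvec d (diag f) v i = f i * v i"
  by (simp add: mvec_def diag_def if_distrib [of "\<lambda>x. x * _"] cong: if_cong)

lemma unitary_vnorm:
  assumes "unitary d U"
  shows "vnorm d (mvec d U v) = vnorm d v"
proof -
  have "ip d (mvec d U v) (mvec d U v) = ip d v (mvec d (mprod d (adj U) U) v)"
    unfolding mvec_mprod by (simp add: ip_mvec_adj)
  also have "\<dots> = ip d v v"
    using assms by (intro ip_cong refl) (simp add: mvec_eqm [of d _ idm] unitary_eqm mvec_idm)
  finally have "(vnorm d (mvec d U v))\<^sup>2 = (vnorm d v)\<^sup>2"
    unfolding ip_self by (simp only: of_real_eq_iff)
  then show ?thesis by (simp add: power2_eq_iff_nonneg)
qed

lemma mat_bound_unitary: "unitary d U \<Longrightarrow> mat_bound d U 1"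
  by (simp add: mat_bound_def unitary_vnorm)

lemma mat_bound_mprod: "mat_bound d A a \<Longrightarrow> mat_bound d B b \<Longrightarrow> 0 \<le> a \<Longrightarrow> mat_bound d (mprod d A B) (a * b)"
  unfolding mat_bound_def mvec_mprod by (metis (no_types, opaque_lifting) mult.assoc mult_left_mono order_trans)

text \<open>Cauchy-Schwarz gives |A* v|^2 = <v, A A* v> \<le> |v| c |A* v|; one factor |A* v|
  cancels.\<close>

lemma mat_bound_adj:
  assumes "mat_bound d A c"
  shows "mat_bound d (adj A) c"
  unfolding mat_bound_def
proof
  fix v
  let ?x = "vnorm d (mvec d (adj A) v)"
  have "complex_of_real (?x\<^sup>2) = ip d v (mvec d A (mvec d (adj A) v))"
    unfolding ip_mvec_adj ip_self ..
  then have "?x\<^sup>2 \<le> vnorm d v * vnorm d (mvec d A (mvec d (adj A) v))"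
    using ip_cauchy [of d v "mvec d A (mvec d (adj A) v)"]
    by (metis norm_of_real abs_of_nonneg zero_le_power2)
  also have "\<dots> \<le> vnorm d v * (c * ?x)"
    using assms unfolding mat_bound_def by (intro mult_left_mono) auto
  finally have "?x * ?x \<le> (c * vnorm d v) * ?x" by (simp add: power2_eq_square mult_ac)
  then have "?x = 0 \<or> ?x \<le> c * vnorm d v"
    using vnorm_nonneg [of d "mvec d (adj A) v"] by (metis mult_right_le_imp_le order_le_less)
  moreover have "0 \<le> c * vnorm d v"
    using assms vnorm_nonneg order_trans unfolding mat_bound_def by blast
  ultimately show "?x \<le> c * vnorm d v" by auto
qed

lemma mat_bound_diag:
  assumes "\<And>i. i < d \<Longrightarrow> cmod (f i) \<le> c" "0 \<le> c"
  shows "mat_bound d (diag f) c"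
  unfolding mat_bound_def
proof
  fix v
  have "(vnorm d (mvec d (diag f) v))\<^sup>2 = (\<Sum>i<d. (cmod (f i))\<^sup>2 * (cmod (v i))\<^sup>2)"
    by (simp add: vnorm_sq mvec_diag norm_mult power_mult_distrib)
  also have "\<dots> \<le> (\<Sum>i<d. c\<^sup>2 * (cmod (v i))\<^sup>2)"
    using assms by (intro sum_mono mult_right_mono power_mono) auto
  also have "\<dots> = (c * vnorm d v)\<^sup>2" by (simp add: power_mult_distrib vnorm_sq sum_distrib_left)
  finally show "vnorm d (mvec d (diag f) v) \<le> c * vnorm d v"
    by (rule power2_le_imp_le) (use assms in auto)
qed

lemma fun_calc_entry: "fun_calc d B f i j = (\<Sum>m<d. B i m * f m * cnj (B j m))"
  by (simp add: fun_calc_def mprod_def [of _ "mprod _ _ _"] mprod_diag_right adj_def)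

lemma adj_fun_calc: "adj (fun_calc d B f) = fun_calc d B (\<lambda>i. cnj (f i))"
  by (simp add: fun_calc_def adj_mprod adj_diag mprod_assoc)

lemma fun_calc_mult:
  assumes "unitary d B"
  shows "eqm d (mprod d (fun_calc d B f) (fun_calc d B g)) (fun_calc d B (\<lambda>m. f m * g m))"
proof -
  have "eqm d (mprod d (adj B) (mprod d B (mprod d (diag g) (adj B)))) (mprod d (diag g) (adj B))"
    using assms by (intro eqm_cancel) (simp add: unitary_eqm)
  then have "eqm d (mprod d B (mprod d (diag f) (mprod d (adj B) (mprod d B (mprod d (diag g) (adj B))))))
      (mprod d B (mprod d (diag f) (mprod d (diag g) (adj B))))"
    by (intro eqm_mprod [OF eqm_refl])
  also have "eqm d \<dots> (mprod d B (mprod d (diag (\<lambda>m. f m * g m)) (adj B)))"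
    unfolding mprod_assoc [symmetric, of d "diag f"] by (intro eqm_mprod eqm_refl eqm_diag_diag)
  finally show ?thesis by (simp add: fun_calc_def mprod_assoc)
qed

lemma fun_calc_one:
  assumes "unitary d B"
  shows "eqm d (fun_calc d B (\<lambda>_. 1)) idm"
proof -
  have "eqm d (mprod d (mprod d B idm) (adj B)) (mprod d B (adj B))"
    by (intro eqm_mprod eqm_refl eqm_mprod_idm)
  also have "eqm d \<dots> idm" using assms by (simp add: unitary_eqm)
  finally show ?thesis by (simp add: fun_calc_def idm_diag)
qed

lemma mat_bound_fun_calc:
  assumes "unitary d B" "\<And>i. i < d \<Longrightarrow> cmod (f i) \<le> c" "0 \<le> c"
  shows "mat_bound d (fun_calc d B f) c"
proof -
  have "mat_bound d (mprod d (mprod d B (diag f)) (adj B)) (1 * c * 1)"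
    using assms by (intro mat_bound_mprod mat_bound_unitary unitary_adj mat_bound_diag) auto
  then show ?thesis by (simp add: fun_calc_def)
qed

lemma mtrace_fun_calc:
  assumes "unitary d B"
  shows "mtrace d (fun_calc d B f) = (\<Sum>m<d. f m)"
proof -
  have "mtrace d (fun_calc d B f) = (\<Sum>m<d. \<Sum>i<d. B i m * f m * cnj (B i m))"
    unfolding mtrace_def fun_calc_entry by (rule sum.swap)
  also have "\<dots> = (\<Sum>m<d. f m * mprod d (adj B) B m m)"
    by (simp add: mprod_def adj_def sum_distrib_left mult_ac)
  also have "\<dots> = (\<Sum>m<d. f m)" using assms by (simp add: unitary_def idm_def)
  finally show ?thesis .
qed

lemma unitary_col:
  assumes "unitary d B" "m < d" "m' < d"
  shows "ip d (\<lambda>i. B i m) (\<lambda>i. B i m') = idm m m'"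
  using assms by (simp add: ip_def unitary_def mprod_def adj_def)

lemma mvec_fun_calc_col:
  assumes "unitary d B" "m < d"
  shows "mvec d (fun_calc d B f) (\<lambda>i. B i m) i = f m * B i m"
proof -
  have "mvec d (fun_calc d B f) (\<lambda>i. B i m) i = (\<Sum>j<d. \<Sum>l<d. B i l * f l * (cnj (B j l) * B j m))"
    by (simp add: mvec_def fun_calc_entry sum_distrib_right mult.assoc)
  also have "\<dots> = (\<Sum>l<d. \<Sum>j<d. B i l * f l * (cnj (B j l) * B j m))" by (rule sum.swap)
  also have "\<dots> = (\<Sum>l<d. B i l * f l * idm l m)"
    by (intro sum.cong refl) (simp add: sum_distrib_left [symmetric] ip_def [symmetric] unitary_col assms)
  also have "\<dots> = f m * B i m"
    using assms(2) by (simp add: idm_def if_distrib [of "\<lambda>x. _ * x"] cong: if_cong)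
  finally show ?thesis .
qed

lemma psd_ip: "psd d B \<longleftrightarrow> (\<forall>v. Im (ip d v (mvec d B v)) = 0 \<and> 0 \<le> Re (ip d v (mvec d B v)))"
proof -
  have "(\<Sum>i<d. \<Sum>j<d. cnj (v i) * B i j * v j) = ip d v (mvec d B v)" for v
    by (simp add: ip_def mvec_def sum_distrib_left mult.assoc)
  then show ?thesis by (simp add: psd_def)
qed

text \<open>Polarisation: the quadratic form is real at e_i + a e_j. The choice a = 1 makes the
  imaginary parts of the two mirrored entries opposite, and a = \<i> makes the real parts
  equal.\<close>

lemma psd_is_hermitian:
  assumes "psd d B"
  shows "is_hermitian d B"
  unfolding is_hermitian_def
proof (intro allI impI)
  fix i j assume ij: "i < d" "j < d"
  define q where "q = (\<lambda>v. \<Sum>i<d. \<Sum>j<d. cnj (v i) * B i j * v j)"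
  have q: "Im (q v) = 0" for v using assms by (simp add: psd_def q_def)
  have one: "q (\<lambda>l. if l = i then a else 0) = cnj a * B i i * a" if "i < d" for i a
  proof -
    have "q (\<lambda>l. if l = i then a else 0)
        = (\<Sum>l<d. cnj (if l = i then a else 0) * (\<Sum>m<d. B l m * (if m = i then a else 0)))"
      unfolding q_def by (simp add: sum_distrib_left mult.assoc)
    also have "\<dots> = (\<Sum>l<d. if l = i then cnj a * (B l i * a) else 0)"
      using that by (intro sum.cong refl) (simp add: if_distrib [of "\<lambda>x. _ * x"] cong: if_cong)
    finally have "q (\<lambda>l. if l = i then a else 0) = (\<Sum>l<d. if l = i then cnj a * (B l i * a) else 0)" .
    then show ?thesis using that by simp
  qed
  show "B i j = cnj (B j i)"
  proof (cases "i = j")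
    case True
    then show ?thesis using q [of "\<lambda>l. if l = i then 1 else 0"] one [OF ij(1), of 1]
      by (simp add: complex_eq_iff)
  next
    case False
    have two: "q (\<lambda>l. if l = i then 1 else if l = j then a else 0)
        = B i i + B i j * a + cnj a * B j i + cnj a * B j j * a" for a
    proof -
      let ?v = "\<lambda>l. if l = i then 1 else if l = j then a else 0"
      have in1: "(\<Sum>m<d. X m * ?v m) = X i + X j * a" for X :: "nat \<Rightarrow> complex"
      proof -
        have "(\<Sum>m<d. X m * ?v m) = (\<Sum>m\<in>{i,j}. X m * ?v m)"
          using ij by (intro sum.mono_neutral_right) auto
        then show ?thesis using False by simp
      qed
      have in2: "(\<Sum>m<d. cnj (?v m) * X m) = X i + cnj a * X j" for X :: "nat \<Rightarrow> complex"
      proof -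
        have "(\<Sum>m<d. cnj (?v m) * X m) = (\<Sum>m\<in>{i,j}. cnj (?v m) * X m)"
          using ij by (intro sum.mono_neutral_right) auto
        then show ?thesis using False by simp
      qed
      have "q ?v = (\<Sum>l<d. cnj (?v l) * (\<Sum>m<d. B l m * ?v m))"
        unfolding q_def by (simp add: sum_distrib_left mult.assoc)
      also have "\<dots> = B i i + B i j * a + cnj a * (B j i + B j j * a)"
        unfolding in1 in2 by simp
      finally show ?thesis by (simp add: algebra_simps)
    qed
    have ii: "Im (B i i) = 0" "Im (B j j) = 0"
      using q [of "\<lambda>l. if l = i then 1 else 0"] one [OF ij(1), of 1]
            q [of "\<lambda>l. if l = j then 1 else 0"] one [OF ij(2), of 1] by simp_all
    have "Im (B i j) + Im (B j i) = 0"
      using q [of "\<lambda>l. if l = i then 1 else if l = j then 1 else 0"] ii unfolding two by simp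
    moreover have "Re (B i j) - Re (B j i) = 0"
      using q [of "\<lambda>l. if l = i then 1 else if l = j then \<i> else 0"] ii unfolding two by simp
    ultimately show ?thesis by (simp add: complex_eq_iff)
  qed
qed

lemma psd_spectral:
  assumes "psd d A"
  obtains B l where "unitary d B" "\<And>m. m < d \<Longrightarrow> 0 \<le> l m" "eqm d A (fun_calc d B (\<lambda>m. complex_of_real (l m)))"
proof -
  obtain B l where B: "unitary d B" "eqm d A (fun_calc d B (\<lambda>m. complex_of_real (l m)))"
    using hermitian_spectral [OF psd_is_hermitian [OF assms]] unfolding fun_calc_def by blast
  have "0 \<le> l m" if m: "m < d" for m
  proof -
    let ?v = "\<lambda>i. B i m"
    have "ip d ?v (mvec d A ?v) = ip d ?v (\<lambda>i. complex_of_real (l m) * ?v i)"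
      by (intro ip_cong refl) (simp add: mvec_eqm [OF B(2)] mvec_fun_calc_col [OF B(1) m])
    also have "\<dots> = complex_of_real (l m) * ip d ?v ?v"
      by (simp add: ip_def sum_distrib_left mult_ac)
    also have "\<dots> = complex_of_real (l m)" by (simp add: unitary_col [OF B(1) m m] idm_def)
    finally have "ip d ?v (mvec d A ?v) = complex_of_real (l m)" .
    then show ?thesis using assms unfolding psd_ip by (metis Re_complex_of_real)
  qed
  with B that show ?thesis by blast
qed

lemma psd_fun_calc:
  assumes "\<And>m. m < d \<Longrightarrow> 0 \<le> l m"
  shows "psd d (fun_calc d B (\<lambda>m. complex_of_real (l m)))"
proof -
  have "ip d v (mvec d (fun_calc d B (\<lambda>m. complex_of_real (l m))) v)
      = complex_of_real (\<Sum>m<d. l m * (cmod (mvec d (adj B) v m))\<^sup>2)" for v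
  proof -
    let ?w = "mvec d (adj B) v"
    have "ip d v (mvec d (fun_calc d B (\<lambda>m. complex_of_real (l m))) v) = ip d ?w (mvec d (diag (\<lambda>m. complex_of_real (l m))) ?w)"
      unfolding fun_calc_def mprod_assoc mvec_mprod by (rule ip_mvec_adj)
    also have "\<dots> = (\<Sum>m<d. complex_of_real (l m) * (cnj (?w m) * ?w m))"
      by (simp add: ip_def mvec_diag mult_ac)
    also have "\<dots> = (\<Sum>m<d. complex_of_real (l m * (cmod (?w m))\<^sup>2))"
      by (intro sum.cong refl) (metis complex_norm_square mult.commute of_real_mult)
    finally show ?thesis by simp
  qed
  then show ?thesis unfolding psd_ip using assms by (auto intro!: sum_nonneg)
qed

text \<open>Let v be a unit eigenvector of R = P - Q for an eigenvalue r that is not 0. Then 0 = <v,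
  (P^2 - Q^2) v> = <v, P R v> + <v, R Q v> = r (<v, P v> + <v, Q v>). Both forms are nonnegative, so
  both vanish, although their difference is r.\<close>

lemma psd_sqrt_unique:
  assumes P: "psd d P" and Q: "psd d Q" and PQ: "eqm d (mprod d P P) (mprod d Q Q)"
  shows "eqm d P Q"
proof -
  define R where "R = (\<lambda>i j. P i j - Q i j)"
  have hP: "is_hermitian d P" and hQ: "is_hermitian d Q" using P Q by (auto intro: psd_is_hermitian)
  have "is_hermitian d R" unfolding is_hermitian_def R_def
  proof (intro allI impI)
    fix i j assume "i < d" "j < d"
    then have "P i j = cnj (P j i)" "Q i j = cnj (Q j i)" using hP hQ unfolding is_hermitian_def by blast+
    then show "P i j - Q i j = cnj (P j i - Q j i)" by simp
  qed
  then obtain B r where B: "unitary d B" "eqm d R (fun_calc d B (\<lambda>m. complex_of_real (r m)))"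
    using hermitian_spectral unfolding fun_calc_def by blast
  have r0: "r m = 0" if m: "m < d" for m
  proof (rule ccontr)
    assume rm: "r m \<noteq> 0"
    define v where "v = (\<lambda>i. B i m)"
    have vv: "ip d v v = 1" using unitary_col [OF B(1) m m] by (simp add: v_def idm_def)
    have Rv: "mvec d R v i = complex_of_real (r m) * v i" if "i < d" for i
      using mvec_eqm [OF B(2) that] mvec_fun_calc_col [OF B(1) m] by (simp add: v_def)
    have PR: "mvec d P u i = mvec d Q u i + mvec d R u i" for u i
      by (simp add: mvec_def R_def algebra_simps sum_subtractf)
    define p q where "p = ip d v (mvec d P v)" and "q = ip d v (mvec d Q v)"
    have pq: "p - q = complex_of_real (r m)"
    proof -
      have "p = q + ip d v (mvec d R v)"
        unfolding p_def q_def PR by (simp add: ip_def algebra_simps sum.distrib)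
      also have "ip d v (mvec d R v) = ip d v (\<lambda>i. complex_of_real (r m) * v i)"
        by (intro ip_cong refl Rv)
      also have "\<dots> = complex_of_real (r m) * ip d v v" by (simp add: ip_def sum_distrib_left mult_ac)
      finally show ?thesis using vv by simp
    qed
    have hR: "ip d u (mvec d R w) = ip d (mvec d R u) w" for u w
    proof -
      have "ip d u (mvec d R w) = ip d (mvec d (adj R) u) w" by (rule ip_mvec_adj)
      also have "\<dots> = ip d (mvec d R u) w"
        using \<open>is_hermitian d R\<close> by (intro ip_cong refl mvec_eqm) (metis eqm_def adj_def is_hermitian_def)
      finally show ?thesis .
    qed
    have "ip d v (mvec d P (mvec d P v)) = ip d v (mvec d Q (mvec d Q v))"
      using mvec_eqm [OF PQ] unfolding mvec_mprod by (intro ip_cong refl)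
    moreover have "ip d v (mvec d P (mvec d P v)) = ip d v (mvec d P (mvec d Q v)) + ip d v (mvec d P (mvec d R v))"
      unfolding PR [of v] by (simp add: ip_def mvec_def algebra_simps sum.distrib)
    moreover have "ip d v (mvec d P (mvec d Q v)) = ip d v (mvec d Q (mvec d Q v)) + ip d v (mvec d R (mvec d Q v))"
      unfolding PR [of "mvec d Q v"] by (simp add: ip_def algebra_simps sum.distrib)
    ultimately have z: "ip d v (mvec d P (mvec d R v)) + ip d v (mvec d R (mvec d Q v)) = 0" by (simp add: add.commute)
    have "mvec d P (mvec d R v) i = complex_of_real (r m) * mvec d P v i" for i
      unfolding mvec_def [of d P] by (simp add: Rv sum_distrib_left mult_ac)
    then have z1: "ip d v (mvec d P (mvec d R v)) = complex_of_real (r m) * p"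
      by (simp add: p_def ip_def sum_distrib_left mult_ac)
    have "ip d v (mvec d R (mvec d Q v)) = ip d (\<lambda>i. complex_of_real (r m) * v i) (mvec d Q v)"
      unfolding hR by (intro ip_cong Rv refl)
    also have "\<dots> = complex_of_real (r m) * q" by (simp add: q_def ip_def sum_distrib_left mult_ac)
    finally have "complex_of_real (r m) * (p + q) = 0" using z z1 by (simp add: algebra_simps)
    then have "p + q = 0" using rm by simp
    moreover have "0 \<le> Re p" "0 \<le> Re q" using P Q unfolding psd_ip p_def q_def by auto
    ultimately have "Re p = 0" "Re q = 0" by (auto simp: complex_eq_iff)
    then show False using pq rm by (auto simp: complex_eq_iff)
  qed
  have "R i j = 0" if "i < d" "j < d" for i j
    using B(2) that r0 by (simp add: eqm_def fun_calc_entry)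
  then show ?thesis by (simp add: eqm_def R_def)
qed

text \<open>Needed to evaluate the definite description in \<open>msqrt\<close>: uniqueness below d
  is \<open>psd_sqrt_unique\<close>, and outside the range it is the normalisation to 0, for which
  the candidate is cut off to \<open>S\<close>.\<close>

lemma msqrt_fun_calc:
  assumes B: "unitary d B" and l: "\<And>m. m < d \<Longrightarrow> 0 \<le> l m"
    and M: "eqm d M (fun_calc d B (\<lambda>m. complex_of_real (l m)))"
  shows "eqm d (msqrt d M) (fun_calc d B (\<lambda>m. complex_of_real (sqrt (l m))))"
proof -
  define F where "F = fun_calc d B (\<lambda>m. complex_of_real (sqrt (l m)))"
  define S :: cmat where "S = (\<lambda>i j. if i < d \<and> j < d then F i j else 0)"
  have SF: "eqm d S F" by (simp add: S_def eqm_def)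
  have "fun_calc d B (\<lambda>m. complex_of_real (sqrt (l m)) * complex_of_real (sqrt (l m)))
      = fun_calc d B (\<lambda>m. complex_of_real (l m))"
  proof (intro ext)
    fix i j
    have "complex_of_real (sqrt (l m)) * complex_of_real (sqrt (l m)) = complex_of_real (l m)" if "m < d" for m
      using l [OF that] by (metis of_real_mult real_sqrt_mult_self abs_of_nonneg)
    then show "fun_calc d B (\<lambda>m. complex_of_real (sqrt (l m)) * complex_of_real (sqrt (l m))) i j
      = fun_calc d B (\<lambda>m. complex_of_real (l m)) i j" by (simp add: fun_calc_entry)
  qed
  then have "eqm d (mprod d F F) (fun_calc d B (\<lambda>m. complex_of_real (l m)))"
    using fun_calc_mult [OF B, of "\<lambda>m. complex_of_real (sqrt (l m))" "\<lambda>m. complex_of_real (sqrt (l m))"]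
    by (simp add: F_def)
  then have SS: "eqm d (mprod d S S) M"
    using eqm_mprod [OF SF SF] eqm_sym [OF M] by (meson eqm_trans)
  have pF: "psd d F" unfolding F_def using l by (intro psd_fun_calc) auto
  have pS: "psd d S"
  proof -
    have "ip d v (mvec d S v) = ip d v (mvec d F v)" for v
      by (intro ip_cong refl mvec_eqm SF)
    then show ?thesis using pF by (simp add: psd_ip)
  qed
  have "msqrt d M = S"
    unfolding msqrt_def
  proof (rule the_equality)
    show "psd d S \<and> (\<forall>i j. i < d \<and> j < d \<longrightarrow> mprod d S S i j = M i j) \<and> (\<forall>i j. \<not> (i < d \<and> j < d) \<longrightarrow> S i j = 0)"
      using pS SS by (auto simp: eqm_def S_def)
  next
    fix T assume T: "psd d T \<and> (\<forall>i j. i < d \<and> j < d \<longrightarrow> mprod d T T i j = M i j) \<and> (\<forall>i j. \<not> (i < d \<and> j < d) \<longrightarrow> T i j = 0)"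
    then have "eqm d (mprod d T T) (mprod d S S)" using SS by (auto simp: eqm_def)
    then have "eqm d T S" using T pS psd_sqrt_unique by blast
    then show "T = S" using T by (intro ext) (metis S_def eqm_def)
  qed
  then show ?thesis using SF by (simp add: F_def)
qed

lemma psd_adj_self: "psd d (mprod d (adj A) A)"
proof -
  have "ip d v (mvec d (mprod d (adj A) A) v) = complex_of_real ((vnorm d (mvec d A v))\<^sup>2)" for v
    unfolding mvec_mprod ip_mvec_adj adj_adj ip_self ..
  then show ?thesis by (simp add: psd_ip)
qed

text \<open>B collects the right singular vectors and \<open>l\<close> the squared singular values;
  the columns of A B are the left singular vectors scaled by the singular values.\<close>

definition is_svd :: "nat \<Rightarrow> cmat \<Rightarrow> cmat \<Rightarrow> (nat \<Rightarrow> real) \<Rightarrow> bool" where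
  "is_svd d A B l \<longleftrightarrow> unitary d B \<and> (\<forall>m<d. 0 \<le> l m) \<and> trnorm d A = (\<Sum>m<d. sqrt (l m)) \<and>
     (\<forall>m<d. \<forall>m'<d. ip d (\<lambda>i. mprod d A B i m) (\<lambda>i. mprod d A B i m')
          = (if m = m' then complex_of_real (l m) else 0)) \<and>
     (\<forall>i<d. \<forall>j<d. A i j = (\<Sum>m<d. mprod d A B i m * cnj (B j m)))"

lemma svd_exists: "\<exists>B l. is_svd d A B l"
proof -
  obtain B l where B: "unitary d B" and l: "\<And>m. m < d \<Longrightarrow> 0 \<le> l m"
    and M: "eqm d (mprod d (adj A) A) (fun_calc d B (\<lambda>m. complex_of_real (l m)))"
    using psd_spectral [OF psd_adj_self] by metis
  have "is_svd d A B l"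
    unfolding is_svd_def
  proof (intro conjI allI impI B l)
    have "mtrace d (msqrt d (mprod d (adj A) A)) = mtrace d (fun_calc d B (\<lambda>m. complex_of_real (sqrt (l m))))"
      using msqrt_fun_calc [OF B l M] by (simp add: mtrace_def eqm_def)
    then show "trnorm d A = (\<Sum>m<d. sqrt (l m))" by (simp add: trnorm_def mtrace_fun_calc [OF B])
    fix m m' assume m: "m < d" "m' < d"
    have cA: "mprod d A B i m = mvec d A (\<lambda>i. B i m) i" for i m by (simp add: mprod_def mvec_def)
    have "ip d (\<lambda>i. mprod d A B i m) (\<lambda>i. mprod d A B i m')
       = ip d (\<lambda>i. B i m) (mvec d (mprod d (adj A) A) (\<lambda>i. B i m'))"
      unfolding cA mvec_mprod by (simp add: ip_mvec_adj)
    also have "\<dots> = ip d (\<lambda>i. B i m) (\<lambda>i. complex_of_real (l m') * B i m')"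
      by (intro ip_cong refl) (simp add: mvec_eqm [OF M] mvec_fun_calc_col [OF B m(2)])
    also have "\<dots> = complex_of_real (l m') * ip d (\<lambda>i. B i m) (\<lambda>i. B i m')"
      by (simp add: ip_def sum_distrib_left mult_ac)
    finally show "ip d (\<lambda>i. mprod d A B i m) (\<lambda>i. mprod d A B i m') = (if m = m' then complex_of_real (l m) else 0)"
      by (simp add: unitary_col [OF B m] idm_def)
  next
    fix i j assume ij: "i < d" "j < d"
    have "eqm d (mprod d A (mprod d B (adj B))) (mprod d A idm)"
      using B by (intro eqm_mprod) (simp_all add: unitary_eqm)
    also have "eqm d \<dots> A" by (rule eqm_mprod_idm)
    finally show "A i j = (\<Sum>m<d. mprod d A B i m * cnj (B j m))"
      using ij unfolding mprod_assoc [symmetric] by (simp add: eqm_def mprod_def [of _ "mprod _ _ _"] adj_def)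
  qed
  then show ?thesis by blast
qed

text \<open>The singular value decomposition as a sum of rank-one terms whose norms add up exactly
  to the trace norm. In this form the bound on the channel input enters the estimate of the
  functional.\<close>

lemma trnorm_decomposition:
  obtains q b where "\<And>i j. i < d \<Longrightarrow> j < d \<Longrightarrow> X i j = (\<Sum>m<d. q m i * cnj (b m j))"
    "(\<Sum>m<d. vnorm d (q m) * vnorm d (b m)) = trnorm d X"
proof -
  obtain B l where svd: "is_svd d X B l" using svd_exists by blast
  then have B: "unitary d B" "\<And>m. m < d \<Longrightarrow> 0 \<le> l m" "trnorm d X = (\<Sum>m<d. sqrt (l m))"
    "\<And>m m'. m < d \<Longrightarrow> m' < d \<Longrightarrow>
       ip d (\<lambda>i. mprod d X B i m) (\<lambda>i. mprod d X B i m') = (if m = m' then complex_of_real (l m) else 0)"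
    by (simp_all add: is_svd_def)
  have dec: "X i j = (\<Sum>m<d. mprod d X B i m * cnj (B j m))" if "i < d" "j < d" for i j
    using svd that unfolding is_svd_def by blast
  have "vnorm d (\<lambda>i. mprod d X B i m) = sqrt (l m)" if "m < d" for m
  proof -
    have "(vnorm d (\<lambda>i. mprod d X B i m))\<^sup>2 = l m"
      using B(4) [OF that that] unfolding ip_self by (simp only: of_real_eq_iff if_True refl)
    then show ?thesis by (metis real_sqrt_abs abs_of_nonneg vnorm_nonneg)
  qed
  moreover have "vnorm d (\<lambda>i. B i m) = 1" if "m < d" for m
  proof -
    have "complex_of_real ((vnorm d (\<lambda>i. B i m))\<^sup>2) = 1"
      using unitary_col [OF B(1) that that] unfolding ip_self by (simp add: idm_def)
    then have "(vnorm d (\<lambda>i. B i m))\<^sup>2 = 1" by (metis of_real_eq_1_iff)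
    then show ?thesis by (metis real_sqrt_abs abs_of_nonneg vnorm_nonneg real_sqrt_one)
  qed
  ultimately show ?thesis
    using that [of "\<lambda>m i. mprod d X B i m" "\<lambda>m i. B i m"] B(3) dec by simp
qed

text \<open>Duality of trace norm and operator norm. The contraction that attains the trace norm is
  the adjoint polar factor W = B diag(1/s) (A B)*, with s the singular values: W A = B diag(s) B*
  has the trace norm as its trace.\<close>

lemma trnorm_le:
  assumes "\<And>W. mat_bound d W 1 \<Longrightarrow> cmod (mtrace d (mprod d W A)) \<le> c"
  shows "trnorm d A \<le> c"
proof -
  obtain B l where svd: "is_svd d A B l" using svd_exists by blast
  then have B: "unitary d B" "\<And>m. m < d \<Longrightarrow> 0 \<le> l m" "trnorm d A = (\<Sum>m<d. sqrt (l m))"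
    "\<And>m m'. m < d \<Longrightarrow> m' < d \<Longrightarrow>
       ip d (\<lambda>i. mprod d A B i m) (\<lambda>i. mprod d A B i m') = (if m = m' then complex_of_real (l m) else 0)"
    by (simp_all add: is_svd_def)
  have dec: "A i j = (\<Sum>m<d. mprod d A B i m * cnj (B j m))" if "i < d" "j < d" for i j
    using svd that unfolding is_svd_def by blast
  define C where "C = mprod d A B"
  \<comment> \<open>Division by 0 gives 0, so \<open>W\<close> ignores the directions of singular
    value 0 and is a partial isometry.\<close>
  define s where "s = (\<lambda>m. complex_of_real (1 / sqrt (l m)))"
  define W where "W = mprod d (mprod d B (diag s)) (adj C)"
  have CC: "eqm d (mprod d (adj C) C) (diag (\<lambda>m. complex_of_real (l m)))"
    unfolding eqm_def
  proof (intro allI impI)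
    fix m m' assume "m < d" "m' < d"
    then have "ip d (\<lambda>i. C i m) (\<lambda>i. C i m') = (if m = m' then complex_of_real (l m) else 0)"
      unfolding C_def by (rule B(4))
    then show "mprod d (adj C) C m m' = diag (\<lambda>m. complex_of_real (l m)) m m'"
      by (simp add: mprod_def adj_def ip_def diag_def)
  qed
  have "mat_bound d (adj W) 1"
    unfolding mat_bound_def
  proof
    fix v
    let ?w = "mvec d (mprod d (diag s) (adj B)) v"
    have aW: "adj W = mprod d C (mprod d (diag s) (adj B))"
      by (simp add: W_def adj_mprod adj_diag s_def)
    have "ip d (mvec d (adj W) v) (mvec d (adj W) v) = ip d (mvec d C ?w) (mvec d C ?w)"
      unfolding aW mvec_mprod ..
    also have "\<dots> = ip d ?w (mvec d (mprod d (adj C) C) ?w)"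
      unfolding mvec_mprod by (simp add: ip_mvec_adj)
    also have "\<dots> = ip d ?w (\<lambda>m. complex_of_real (l m) * ?w m)"
      by (intro ip_cong refl) (simp add: mvec_eqm [OF CC] mvec_diag)
    also have "\<dots> = (\<Sum>m<d. complex_of_real (if l m = 0 then 0 else (cmod (mvec d (adj B) v m))\<^sup>2))"
      unfolding ip_def
    proof (intro sum.cong refl)
      fix m assume "m \<in> {..<d}"
      then have m: "m < d" by simp
      have w: "?w m = s m * mvec d (adj B) v m" unfolding mvec_mprod using m by (simp add: mvec_diag)
      have "cnj (?w m) * (complex_of_real (l m) * ?w m)
          = complex_of_real (l m * (1 / sqrt (l m)) * (1 / sqrt (l m))) * (mvec d (adj B) v m * cnj (mvec d (adj B) v m))"
        unfolding w unfolding s_def by (simp only: complex_cnj_mult complex_cnj_complex_of_real of_real_mult mult_ac)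
      also have "l m * (1 / sqrt (l m)) * (1 / sqrt (l m)) = (if l m = 0 then 0 else 1)"
        using B(2) [OF m] by simp
      finally show "cnj (?w m) * (complex_of_real (l m) * ?w m)
          = complex_of_real (if l m = 0 then 0 else (cmod (mvec d (adj B) v m))\<^sup>2)"
        by (simp add: complex_norm_square [symmetric])
    qed
    finally have "(vnorm d (mvec d (adj W) v))\<^sup>2 = (\<Sum>m<d. if l m = 0 then 0 else (cmod (mvec d (adj B) v m))\<^sup>2)"
      unfolding ip_self of_real_sum [symmetric] by (simp only: of_real_eq_iff)
    also have "\<dots> \<le> (vnorm d (mvec d (adj B) v))\<^sup>2" unfolding vnorm_sq by (intro sum_mono) auto
    also have "\<dots> = (vnorm d v)\<^sup>2" by (simp add: unitary_vnorm unitary_adj B(1))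
    finally have "vnorm d (mvec d (adj W) v) \<le> vnorm d v" by (rule power2_le_imp_le) simp
    then show "vnorm d (mvec d (adj W) v) \<le> 1 * vnorm d v" by simp
  qed
  from mat_bound_adj [OF this] have "mat_bound d W 1" by simp
  from assms [OF this] have c: "cmod (mtrace d (mprod d W A)) \<le> c" .
  have AC: "eqm d A (mprod d C (adj B))"
    unfolding eqm_def
  proof (intro allI impI)
    fix i j assume ij: "i < d" "j < d"
    have "mprod d C (adj B) i j = (\<Sum>m<d. C i m * cnj (B j m))" unfolding mprod_def [of d C] adj_def ..
    then show "A i j = mprod d C (adj B) i j" using dec [OF ij] by (simp only: C_def)
  qed
  have "eqm d (mprod d W A) (mprod d W (mprod d C (adj B)))" by (intro eqm_mprod eqm_refl AC)
  also have "mprod d W (mprod d C (adj B)) = mprod d B (mprod d (diag s) (mprod d (mprod d (adj C) C) (adj B)))"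
    by (simp add: W_def mprod_assoc)
  also have "eqm d \<dots> (mprod d B (mprod d (diag s) (mprod d (diag (\<lambda>m. complex_of_real (l m))) (adj B))))"
    by (intro eqm_mprod eqm_refl CC)
  also have "eqm d \<dots> (mprod d B (mprod d (diag (\<lambda>m. s m * complex_of_real (l m))) (adj B)))"
    unfolding mprod_assoc [symmetric, of d "diag s"] by (intro eqm_mprod eqm_refl eqm_diag_diag)
  also have "\<dots> = fun_calc d B (\<lambda>m. s m * complex_of_real (l m))" by (simp add: fun_calc_def mprod_assoc)
  finally have "mtrace d (mprod d W A) = mtrace d (fun_calc d B (\<lambda>m. s m * complex_of_real (l m)))"
    by (simp add: mtrace_def eqm_def)
  also have "\<dots> = (\<Sum>m<d. complex_of_real (1 / sqrt (l m) * l m))"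
    unfolding mtrace_fun_calc [OF B(1)] s_def by simp
  also have "\<dots> = complex_of_real (trnorm d A)"
    unfolding B(3) of_real_sum using B(2) by (intro sum.cong refl) (simp add: real_div_sqrt field_simps)
  finally have "cmod (complex_of_real (trnorm d A)) \<le> c" using c by simp
  then show ?thesis by simp
qed

lemma density_spectral:
  assumes "Defs.density d \<rho>"
  obtains B l where "unitary d B" "\<And>m. m < d \<Longrightarrow> 0 \<le> l m" "\<And>m. m < d \<Longrightarrow> l m \<le> 1" "(\<Sum>m<d. l m) = 1"
    "eqm d \<rho> (fun_calc d B (\<lambda>m. complex_of_real (l m)))"
proof -
  obtain B l where B: "unitary d B" "\<And>m. m < d \<Longrightarrow> 0 \<le> l m" "eqm d \<rho> (fun_calc d B (\<lambda>m. complex_of_real (l m)))"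
    using psd_spectral [of d \<rho>] assms unfolding Defs.density_def by metis
  have "mtrace d \<rho> = mtrace d (fun_calc d B (\<lambda>m. complex_of_real (l m)))" using B(3) by (simp add: mtrace_def eqm_def)
  also have "\<dots> = complex_of_real (\<Sum>m<d. l m)" by (simp add: mtrace_fun_calc [OF B(1)])
  finally have s: "(\<Sum>m<d. l m) = 1" using assms unfolding Defs.density_def by (metis of_real_eq_1_iff)
  have "l m \<le> 1" if "m < d" for m
  proof -
    have "l m \<le> (\<Sum>m<d. l m)" using B(2) that by (intro member_le_sum) auto
    with s show ?thesis by simp
  qed
  with B s that show ?thesis by blast
qed

section \<open>Linear operators on qubit registers\<close>

text \<open>Operators act on all amplitude functions on the naturals, without a dimension. One
  operator then serves registers of every width, and composition makes the type a ring with a true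
  unit, open to ordinary ring simplification.\<close>

typedef lop = "{f :: (nat \<Rightarrow> complex) \<Rightarrow> nat \<Rightarrow> complex.
    (\<forall>u v. f (\<lambda>x. u x + v x) = (\<lambda>x. f u x + f v x)) \<and> (\<forall>c u. f (\<lambda>x. c * u x) = (\<lambda>x. c * f u x))}"
  morphisms ap Abs_lop
  by (rule exI [of _ "\<lambda>g. g"]) simp

setup_lifting type_definition_lop

lemma ap_add: "ap A (\<lambda>x. u x + v x) = (\<lambda>x. ap A u x + ap A v x)"
  using ap [of A] by simp

lemma ap_scale: "ap A (\<lambda>x. c * u x) = (\<lambda>x. c * ap A u x)"
  using ap [of A] by simp

lemma ap_zero_arg: "ap A (\<lambda>x. 0) = (\<lambda>x. 0)"
  using ap_scale [of A 0 "\<lambda>_. 0"] by simp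

lemma ap_sum_arg: "ap A (\<lambda>x. \<Sum>i\<in>I. u i x) = (\<lambda>x. \<Sum>i\<in>I. ap A (u i) x)"
  by (induction I rule: infinite_finite_induct) (simp_all add: ap_zero_arg ap_add)

instantiation lop :: ring_1
begin

lift_definition zero_lop :: lop is "\<lambda>g x. 0" by simp
lift_definition one_lop :: lop is "\<lambda>g. g" by simp
lift_definition plus_lop :: "lop \<Rightarrow> lop \<Rightarrow> lop" is "\<lambda>A B g x. A g x + B g x"
  by (simp add: fun_eq_iff algebra_simps)
lift_definition minus_lop :: "lop \<Rightarrow> lop \<Rightarrow> lop" is "\<lambda>A B g x. A g x - B g x"
  by (simp add: fun_eq_iff algebra_simps)
lift_definition uminus_lop :: "lop \<Rightarrow> lop" is "\<lambda>A g x. - A g x"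
  by simp
lift_definition times_lop :: "lop \<Rightarrow> lop \<Rightarrow> lop" is "\<lambda>A B g. A (B g)"
  by simp

instance
proof
  show "(0::lop) \<noteq> 1" by transfer (simp add: fun_eq_iff, rule exI [of _ "\<lambda>_. 1"], simp)
qed (transfer, simp add: fun_eq_iff algebra_simps)+

end

lemma ap_plus [simp]: "ap (A + B) g x = ap A g x + ap B g x" by transfer simp
lemma ap_minus [simp]: "ap (A - B) g x = ap A g x - ap B g x" by transfer simp
lemma ap_uminus [simp]: "ap (- A) g x = - ap A g x" by transfer simp
lemma ap_times [simp]: "ap (A * B) g = ap A (ap B g)" by transfer simp
lemma ap_one [simp]: "ap 1 g = g" by transfer simp
lemma ap_zero [simp]: "ap 0 g x = 0" by transfer simp
lemma ap_sum: "ap (\<Sum>i\<in>I. A i) g x = (\<Sum>i\<in>I. ap (A i) g x)"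
  by (induction I rule: infinite_finite_induct) simp_all

lemma lop_eqI: "(\<And>g x. ap A g x = ap B g x) \<Longrightarrow> A = B"
  by (metis ap_inject ext)

lift_definition scalar :: "complex \<Rightarrow> lop" is "\<lambda>c g x. c * g x"
  by (simp add: fun_eq_iff algebra_simps)

lemma ap_scalar [simp]: "ap (scalar c) g x = c * g x" by transfer simp

lemma scalar_comm: "A * scalar c = scalar c * A"
proof (rule lop_eqI)
  fix g x
  have "ap (scalar c) g = (\<lambda>x. c * g x)" by auto
  then show "ap (A * scalar c) g x = ap (scalar c * A) g x" by (simp add: ap_scale)
qed

lemma scalar_left_comm: "A * (scalar c * B) = scalar c * (A * B)"
  by (metis mult.assoc scalar_comm)

lemma scalar_mult: "scalar a * scalar b = scalar (a * b)" by (rule lop_eqI) (simp add: mult.assoc)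
lemma scalar_mult_left: "scalar a * (scalar b * A) = scalar (a * b) * A" by (metis mult.assoc scalar_mult)
lemma scalar_add: "scalar a + scalar b = scalar (a + b)" by (rule lop_eqI) (simp add: algebra_simps)
lemma scalar_diff: "scalar a - scalar b = scalar (a - b)" by (rule lop_eqI) (simp add: algebra_simps)
lemma scalar_uminus: "- scalar a = scalar (- a)" by (rule lop_eqI) simp
lemma scalar_1 [simp]: "scalar 1 = 1" by (rule lop_eqI) simp
lemma scalar_0 [simp]: "scalar 0 = 0" by (rule lop_eqI) simp

section \<open>Reading and writing the wires of a basis index\<close>

definition setb :: "nat \<Rightarrow> bool \<Rightarrow> nat \<Rightarrow> nat" where
  "setb w b x = (if b then set_bit w x else unset_bit w x)"

text \<open>The counterpart of \<open>idx\<close>: overwrites the wires \<open>ws\<close> of the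
  basis index x by the binary digits of v. The pair replaces a tensor factorisation into the wires
  \<open>ws\<close> and the others.\<close>

fun put :: "nat list \<Rightarrow> nat \<Rightarrow> nat \<Rightarrow> nat" where
  "put [] v x = x"
| "put (w # ws) v x = setb w (bit v 0) (put ws (v div 2) x)"

lemma bit_setb: "bit (setb w b x) q = (if q = w then b else bit x q)"
  by (auto simp: setb_def bit_simps)

lemma setb_same [simp]: "bit x w = b \<Longrightarrow> setb w b x = x"
  by (rule bit_eqI) (auto simp: bit_setb)

lemma setb_setb [simp]: "setb w b (setb w c x) = setb w b x"
  by (rule bit_eqI) (auto simp: bit_setb)

lemma setb_comm: "w \<noteq> w' \<Longrightarrow> setb w b (setb w' c x) = setb w' c (setb w b x)"
  by (rule bit_eqI) (auto simp: bit_setb)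

lemma less_2p_bits: "(x::nat) < 2 ^ M \<longleftrightarrow> (\<forall>q\<ge>M. \<not> bit x q)"
proof -
  have "x < 2 ^ M \<longleftrightarrow> take_bit M x = x" by (simp add: take_bit_nat_eq_self_iff)
  also have "\<dots> \<longleftrightarrow> (\<forall>q\<ge>M. \<not> bit x q)"
  proof
    assume "take_bit M x = x"
    then show "\<forall>q\<ge>M. \<not> bit x q" by (metis bit_take_bit_iff not_less)
  next
    assume a: "\<forall>q\<ge>M. \<not> bit x q"
    show "take_bit M x = x"
    proof (rule bit_eqI)
      fix q show "bit (take_bit M x) q = bit x q"
        using a by (cases "q < M") (simp_all add: bit_take_bit_iff)
    qed
  qed
  finally show ?thesis .
qed

lemma setb_less: "w < M \<Longrightarrow> x < 2 ^ M \<Longrightarrow> setb w b x < 2 ^ M"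
  by (auto simp: less_2p_bits bit_setb)

lemma idx_Nil [simp]: "idx [] x = 0" by (simp add: idx_def)

lemma idx_Cons [simp]: "idx (w # ws) x = of_bool (bit x w) + 2 * idx ws x"
  by (simp add: idx_def sum.lessThan_Suc_shift sum_distrib_left del: sum.lessThan_Suc)
     (intro sum.cong, auto)

lemma idx_append: "idx (ws @ ws') x = idx ws x + 2 ^ length ws * idx ws' x"
  by (induction ws) (auto simp: algebra_simps)

lemma idx_less [simp]: "idx ws x < 2 ^ length ws"
  by (induction ws) (auto simp: of_bool_def)

lemma idx_cong: "(\<And>q. q \<in> set ws \<Longrightarrow> bit x q = bit y q) \<Longrightarrow> idx ws x = idx ws y"
  by (induction ws) auto

lemma bit_put_notin: "q \<notin> set ws \<Longrightarrow> bit (put ws v x) q = bit x q"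
  by (induction ws arbitrary: v) (auto simp: bit_setb)

lemma bit_put_in: "q \<in> set ws \<Longrightarrow> bit (put ws v x) q = bit (put ws v y) q"
  by (induction ws arbitrary: v) (auto simp: bit_setb)

lemma idx_setb: "w \<notin> set ws \<Longrightarrow> idx ws (setb w b x) = idx ws x"
  by (rule idx_cong) (auto simp: bit_setb)

lemma idx_put_disjoint: "set ws \<inter> set ws' = {} \<Longrightarrow> idx ws (put ws' v x) = idx ws x"
  by (rule idx_cong) (auto intro!: bit_put_notin)

lemma idx_put_mod: "distinct ws \<Longrightarrow> idx ws (put ws v x) = v mod 2 ^ length ws"
proof (induction ws arbitrary: v)
  case (Cons w ws)
  then have "idx (w # ws) (put (w # ws) v x) = of_bool (odd v) + 2 * (v div 2 mod 2 ^ length ws)"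
    by (simp add: bit_setb idx_setb bit_0)
  also have "\<dots> = v mod 2 ^ length (w # ws)"
    by (simp add: mod_mult2_eq mod2_eq_if of_bool_def)
  finally show ?case .
qed simp

lemma idx_put [simp]: "distinct ws \<Longrightarrow> v < 2 ^ length ws \<Longrightarrow> idx ws (put ws v x) = v"
  by (simp add: idx_put_mod)

lemma put_idx [simp]: "put ws (idx ws x) x = x"
  by (induction ws) (auto simp: bit_0)

lemma put_put [simp]: "put ws u (put ws v x) = put ws u x"
proof (rule bit_eqI)
  fix q show "bit (put ws u (put ws v x)) q = bit (put ws u x) q"
    by (cases "q \<in> set ws") (simp_all add: bit_put_notin bit_put_in [of q ws u "put ws v x" x])
qed

lemma put_comm:
  assumes "set ws \<inter> set ws' = {}"
  shows "put ws u (put ws' v x) = put ws' v (put ws u x)"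
proof (rule bit_eqI)
  fix q show "bit (put ws u (put ws' v x)) q = bit (put ws' v (put ws u x)) q"
  proof (cases "q \<in> set ws")
    case True
    with assms have "q \<notin> set ws'" by blast
    then show ?thesis using bit_put_in [OF True, of u "put ws' v x" x] by (simp add: bit_put_notin)
  next
    case False
    then show ?thesis
      using bit_put_in [of q ws' v "put ws u x" x]
      by (cases "q \<in> set ws'") (simp_all add: bit_put_notin)
  qed
qed

lemma setb_put: "w \<notin> set ws \<Longrightarrow> setb w b (put ws v x) = put ws v (setb w b x)"
  by (induction ws arbitrary: v) (auto simp: setb_comm)

lemma put_append: "put (ws @ ws') v x = put ws v (put ws' (v div 2 ^ length ws) x)"
  by (induction ws arbitrary: v) (auto simp: div_mult2_eq)

lemma put_mod: "put ws (v mod 2 ^ length ws) x = put ws v x"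
proof (induction ws arbitrary: v)
  case (Cons w ws)
  have "v mod (2 * 2 ^ length ws) div 2 = v div 2 mod 2 ^ length ws"
    by (simp add: mod_mult2_eq)
  moreover have "bit (v mod (2 * 2 ^ length ws)) 0 = bit v 0"
    by (simp add: bit_0 mod_mult2_eq)
  ultimately show ?case by (simp add: Cons.IH)
qed simp

lemma put_less: "set ws \<subseteq> {..<M} \<Longrightarrow> x < 2 ^ M \<Longrightarrow> put ws v x < 2 ^ M"
  by (induction ws arbitrary: v) (auto simp: setb_less)

lemma sum_mult_split: "(\<Sum>v<p * q. f v) = (\<Sum>i<p. \<Sum>j<q. f (i + p * j))"
  for f :: "nat \<Rightarrow> 'a :: comm_monoid_add"
proof -
  have "(\<Sum>i<p. \<Sum>j<q. f (i + p * j)) = (\<Sum>z\<in>{..<p} \<times> {..<q}. f (fst z + p * snd z))"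
    by (simp add: sum.cartesian_product split_def)
  also have "\<dots> = (\<Sum>v<p * q. f v)"
  proof (rule sum.reindex_bij_witness [of _ "\<lambda>v. (v mod p, v div p)" "\<lambda>z. fst z + p * snd z"])
    fix z assume "z \<in> {..<p} \<times> {..<q}"
    then obtain i j where z: "z = (i, j)" "i < p" "j < q" by auto
    have "i + p * j < p + p * j" using z by simp
    also have "\<dots> = p * Suc j" by simp
    also have "\<dots> \<le> p * q" using z by (intro mult_le_mono) auto
    finally show "fst z + p * snd z \<in> {..<p * q}" using z by simp
  next
    fix v assume "v \<in> {..<p * q}"
    then show "(v mod p, v div p) \<in> {..<p} \<times> {..<q}"
      by (cases "p = 0") (auto simp: less_mult_imp_div_less mult.commute)
  qed auto
  finally show ?thesis by simp
qed

lemma sum_pow2_add: "(\<Sum>v<2 ^ (a + b). f v) = (\<Sum>i<2 ^ a. \<Sum>j<2 ^ b. f (i + 2 ^ a * j))"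
  for f :: "nat \<Rightarrow> 'a :: comm_monoid_add"
  by (simp add: power_add sum_mult_split)

lemma sum_pow2_Suc: "(\<Sum>v<2 ^ Suc m. f v) = (\<Sum>v<2 ^ m. f (2 * v) + f (Suc (2 * v)))"
  for f :: "nat \<Rightarrow> 'a :: comm_monoid_add"
  using sum_mult_split [of f 2 "2 ^ m"] by (simp add: sum.distrib numeral_2_eq_2)

lemma sum_setb:
  fixes f :: "nat \<Rightarrow> 'a :: comm_ring_1"
  assumes "w < M"
  shows "(\<Sum>x<2 ^ M. f (setb w False x) + f (setb w True x)) = 2 * (\<Sum>x<2 ^ M. f x)"
proof -
  have "f (setb w False x) + f (setb w True x) = f x + f (setb w (\<not> bit x w) x)" for x
    by (cases "bit x w") (auto simp: add.commute)
  then have "(\<Sum>x<2 ^ M. f (setb w False x) + f (setb w True x))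
      = (\<Sum>x<2 ^ M. f x) + (\<Sum>x<2 ^ M. f (setb w (\<not> bit x w) x))" by (simp add: sum.distrib)
  also have "(\<Sum>x<2 ^ M. f (setb w (\<not> bit x w) x)) = (\<Sum>x<2 ^ M. f x)"
    by (rule sum.reindex_bij_witness [of _ "\<lambda>x. setb w (\<not> bit x w) x" "\<lambda>x. setb w (\<not> bit x w) x"])
       (auto simp: setb_less assms bit_setb)
  finally show ?thesis by simp
qed

text \<open>Among the pairs (x, v) every index is hit \<open>2 ^ length ws\<close> times. Keeping
  this factor avoids an enumeration of the complementary wires.\<close>

lemma sum_put:
  fixes f :: "nat \<Rightarrow> 'a :: comm_ring_1"
  assumes "set ws \<subseteq> {..<M}"
  shows "(\<Sum>x<2 ^ M. \<Sum>v<2 ^ length ws. f (put ws v x)) = 2 ^ length ws * (\<Sum>x<2 ^ M. f x)"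
  using assms
proof (induction ws arbitrary: f)
  case (Cons w ws)
  have "(\<Sum>x<2 ^ M. \<Sum>v<2 ^ length (w # ws). f (put (w # ws) v x))
     = (\<Sum>x<2 ^ M. \<Sum>v<2 ^ length ws. f (setb w False (put ws v x)) + f (setb w True (put ws v x)))"
    unfolding length_Cons sum_pow2_Suc by (simp add: bit_0)
  also have "\<dots> = 2 ^ length ws * (\<Sum>x<2 ^ M. f (setb w False x) + f (setb w True x))"
    using Cons.prems by (intro Cons.IH) auto
  also have "\<dots> = 2 ^ length (w # ws) * (\<Sum>x<2 ^ M. f x)"
    using Cons.prems by (subst sum_setb) auto
  finally show ?case .
qed simp

text \<open>Fubini for the wires \<open>ws\<close> against a weight that does not look at them,
  again multiplied out by the overcount.\<close>

lemma sum_idx_factor: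
  fixes w :: "nat \<Rightarrow> 'a :: comm_ring_1"
  assumes "distinct ws" "set ws \<subseteq> {..<M}" "\<And>v x. w (put ws v x) = w x"
  shows "2 ^ length ws * (\<Sum>x<2 ^ M. h (idx ws x) * w x) = (\<Sum>v<2 ^ length ws. h v) * (\<Sum>x<2 ^ M. w x)"
proof -
  have "2 ^ length ws * (\<Sum>x<2 ^ M. h (idx ws x) * w x)
      = (\<Sum>x<2 ^ M. \<Sum>v<2 ^ length ws. h (idx ws (put ws v x)) * w (put ws v x))"
    using sum_put [OF assms(2), of "\<lambda>x. h (idx ws x) * w x"] by simp
  also have "\<dots> = (\<Sum>x<2 ^ M. \<Sum>v<2 ^ length ws. h v * w x)"
    using assms by (intro sum.cong refl) auto
  also have "\<dots> = (\<Sum>v<2 ^ length ws. h v) * (\<Sum>x<2 ^ M. w x)"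
    by (simp add: sum_distrib_right [symmetric] sum_distrib_left [symmetric])
  finally show ?thesis .
qed

text \<open>The dimension-free counterpart of \<open>embed\<close>: the row index is read off the
  wires, the column index is written back to them.\<close>

lift_definition emb :: "nat list \<Rightarrow> cmat \<Rightarrow> lop" is
  "\<lambda>ws G g x. \<Sum>v<2 ^ length ws. G (idx ws x) v * g (put ws v x)"
  by (simp add: fun_eq_iff sum.distrib sum_distrib_left algebra_simps)

lemma ap_emb: "ap (emb ws G) g x = (\<Sum>v<2 ^ length ws. G (idx ws x) v * g (put ws v x))"
  by transfer simp

lemma emb_eqm: "eqm (2 ^ length ws) A B \<Longrightarrow> emb ws A = emb ws B"
  by (rule lop_eqI) (simp add: ap_emb eqm_def)

lemma emb_mult: "distinct ws \<Longrightarrow> emb ws A * emb ws B = emb ws (mprod (2 ^ length ws) A B)"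
proof (rule lop_eqI)
  fix g x assume d: "distinct ws"
  have "ap (emb ws A * emb ws B) g x
      = (\<Sum>v<2 ^ length ws. \<Sum>u<2 ^ length ws. A (idx ws x) v * B v u * g (put ws u x))"
    using d by (simp add: ap_emb sum_distrib_left mult.assoc)
  also have "\<dots> = (\<Sum>u<2 ^ length ws. \<Sum>v<2 ^ length ws. A (idx ws x) v * B v u * g (put ws u x))"
    by (rule sum.swap)
  also have "\<dots> = ap (emb ws (mprod (2 ^ length ws) A B)) g x"
    by (simp add: ap_emb mprod_def sum_distrib_right)
  finally show "ap (emb ws A * emb ws B) g x = ap (emb ws (mprod (2 ^ length ws) A B)) g x" .
qed

lemma emb_diag: "ap (emb ws (diag h)) g x = h (idx ws x) * g x"
proof -
  have "ap (emb ws (diag h)) g x = (\<Sum>v<2 ^ length ws. if v = idx ws x then h (idx ws x) * g x else 0)"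
    unfolding ap_emb diag_def by (intro sum.cong refl) auto
  then show ?thesis by simp
qed

lemma emb_idm: "emb ws idm = 1"
  by (rule lop_eqI) (simp add: idm_diag emb_diag)

lemma emb_add: "emb ws (\<lambda>i j. A i j + B i j) = emb ws A + emb ws B"
  by (rule lop_eqI) (simp add: ap_emb sum.distrib algebra_simps)

lemma emb_minus: "emb ws (\<lambda>i j. A i j - B i j) = emb ws A - emb ws B"
  by (rule lop_eqI) (simp add: ap_emb sum_subtractf algebra_simps)

lemma emb_scale: "emb ws (\<lambda>i j. c * A i j) = scalar c * emb ws A"
  by (rule lop_eqI) (simp add: ap_emb sum_distrib_left mult.assoc)

lemma emb_sum: "emb ws (\<lambda>i j. \<Sum>k\<in>K. A k i j) = (\<Sum>k\<in>K. emb ws (A k))"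
proof (rule lop_eqI)
  fix g x
  have "ap (emb ws (\<lambda>i j. \<Sum>k\<in>K. A k i j)) g x = (\<Sum>v<2 ^ length ws. \<Sum>k\<in>K. A k (idx ws x) v * g (put ws v x))"
    by (simp add: ap_emb sum_distrib_right)
  also have "\<dots> = (\<Sum>k\<in>K. \<Sum>v<2 ^ length ws. A k (idx ws x) v * g (put ws v x))" by (rule sum.swap)
  finally show "ap (emb ws (\<lambda>i j. \<Sum>k\<in>K. A k i j)) g x = ap (\<Sum>k\<in>K. emb ws (A k)) g x"
    by (simp add: ap_sum ap_emb)
qed

lemma emb_comm:
  assumes "set ws \<inter> set ws' = {}"
  shows "emb ws A * emb ws' B = emb ws' B * emb ws A"
proof (rule lop_eqI)
  fix g x
  have d2: "set ws' \<inter> set ws = {}" using assms by blast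
  have "ap (emb ws A * emb ws' B) g x
      = (\<Sum>v<2 ^ length ws. \<Sum>u<2 ^ length ws'. A (idx ws x) v * (B (idx ws' x) u * g (put ws' u (put ws v x))))"
    by (simp add: ap_emb sum_distrib_left idx_put_disjoint d2)
  also have "\<dots> = (\<Sum>u<2 ^ length ws'. \<Sum>v<2 ^ length ws. A (idx ws x) v * (B (idx ws' x) u * g (put ws' u (put ws v x))))"
    by (rule sum.swap)
  also have "\<dots> = ap (emb ws' B * emb ws A) g x"
    by (simp add: ap_emb sum_distrib_left idx_put_disjoint assms put_comm [OF assms] mult_ac)
  finally show "ap (emb ws A * emb ws' B) g x = ap (emb ws' B * emb ws A) g x" .
qed

lemma emb_append:
  assumes "distinct (ws @ ws')"
  shows "emb (ws @ ws') (tensor (length ws) A B) = emb ws A * emb ws' B"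
proof (rule lop_eqI)
  fix g x
  let ?l = "length ws" and ?l' = "length ws'"
  have d: "set ws \<inter> set ws' = {}" "set ws' \<inter> set ws = {}" using assms by auto
  have "ap (emb (ws @ ws') (tensor ?l A B)) g x
    = (\<Sum>v<2 ^ ?l. \<Sum>u<2 ^ ?l'. A (idx ws x) v * B (idx ws' x) u * g (put ws v (put ws' u x)))"
    unfolding ap_emb length_append sum_pow2_add
  proof (intro sum.cong refl)
    fix v u :: nat assume "v \<in> {..<2 ^ ?l}" "u \<in> {..<2 ^ ?l'}"
    then have v: "v < 2 ^ ?l" by simp
    have "put ws (v + 2 ^ ?l * u) y = put ws v y" for y
      using put_mod [of ws "v + 2 ^ ?l * u" y] v by simp
    then show "tensor ?l A B (idx (ws @ ws') x) (v + 2 ^ ?l * u) * g (put (ws @ ws') (v + 2 ^ ?l * u) x)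
      = A (idx ws x) v * B (idx ws' x) u * g (put ws v (put ws' u x))"
      using v by (simp add: tensor_def idx_append put_append)
  qed
  also have "\<dots> = ap (emb ws A * emb ws' B) g x"
    by (simp add: ap_emb idx_put_disjoint d put_comm [OF d(1)] sum_distrib_left mult.assoc)
  finally show "ap (emb (ws @ ws') (tensor ?l A B)) g x = ap (emb ws A * emb ws' B) g x" .
qed

text \<open>Testing on the indicator of \<open>idx ws y = j\<close> recovers column j. This
  transfers identities of operators back to matrices, in particular unitarity.\<close>

lemma emb_inj:
  assumes "distinct ws" "emb ws A = emb ws B"
  shows "eqm (2 ^ length ws) A B"
  unfolding eqm_def
proof (intro allI impI)
  fix i j :: nat assume ij: "i < 2 ^ length ws" "j < 2 ^ length ws"
  define g where "g = (\<lambda>y. if idx ws y = j then 1 else 0 :: complex)"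
  have "ap (emb ws C) g (put ws i 0) = C i j" for C
  proof -
    have "ap (emb ws C) g (put ws i 0) = (\<Sum>v<2 ^ length ws. if v = j then C i j else 0)"
      unfolding ap_emb g_def using assms(1) ij by (intro sum.cong refl) auto
    then show ?thesis using ij by simp
  qed
  then show "A i j = B i j" using assms(2) by metis
qed

lift_definition proj1 :: "nat \<Rightarrow> lop" is "\<lambda>q g x. if bit x q then g x else 0"
  by (auto simp: fun_eq_iff)

lemma ap_proj1 [simp]: "ap (proj1 q) g x = (if bit x q then g x else 0)" by transfer simp

lemma proj1_idem: "proj1 q * proj1 q = proj1 q" by (rule lop_eqI) simp

lemma proj1_emb_comm: "q \<notin> set ws \<Longrightarrow> proj1 q * emb ws A = emb ws A * proj1 q"
  by (rule lop_eqI) (simp add: ap_emb bit_put_notin)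

text \<open>Turns the index-level \<open>ctrl\<close> into a ring expression in which the control is
  a single projection.\<close>

lemma emb_ctrl:
  assumes "q \<notin> set ws"
  shows "emb (q # ws) (ctrl A) = 1 + proj1 q * (emb ws A - 1)"
proof (rule lop_eqI)
  fix g x
  have "ap (emb (q # ws) (ctrl A)) g x = (\<Sum>v<2 ^ length ws.
      ctrl A (of_bool (bit x q) + 2 * idx ws x) (2 * v) * g (setb q False (put ws v x)) +
      ctrl A (of_bool (bit x q) + 2 * idx ws x) (Suc (2 * v)) * g (setb q True (put ws v x)))"
    unfolding ap_emb length_Cons sum_pow2_Suc by (simp add: bit_0)
  also have "\<dots> = ap (1 + proj1 q * (emb ws A - 1)) g x"
  proof (cases "bit x q")
    case True
    have "setb q True (put ws v x) = put ws v x" for v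
      using True assms by (simp add: bit_put_notin)
    then show ?thesis using True by (simp add: ctrl_def bit_0 ap_emb)
  next
    case False
    have "setb q False (put ws v x) = put ws v x" for v
      using False assms by (simp add: bit_put_notin)
    then have "(\<Sum>v<2 ^ length ws.
      ctrl A (of_bool (bit x q) + 2 * idx ws x) (2 * v) * g (setb q False (put ws v x)) +
      ctrl A (of_bool (bit x q) + 2 * idx ws x) (Suc (2 * v)) * g (setb q True (put ws v x)))
      = (\<Sum>v<2 ^ length ws. if v = idx ws x then g x else 0)"
      using False by (intro sum.cong refl) (auto simp: ctrl_def bit_0 idm_def)
    then show ?thesis using False by simp
  qed
  finally show "ap (emb (q # ws) (ctrl A)) g x = ap (1 + proj1 q * (emb ws A - 1)) g x" .
qed

text \<open>Applied to functions vanishing below D, the inequality also says that the first D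
  amplitudes of the result depend only on the first D amplitudes of the argument.\<close>

definition op_bound :: "nat \<Rightarrow> lop \<Rightarrow> real \<Rightarrow> bool" where
  "op_bound D A c \<longleftrightarrow> 0 \<le> c \<and> (\<forall>g. vnorm D (ap A g) \<le> c * vnorm D g)"

lemma op_bound_mono: "op_bound D A c \<Longrightarrow> c \<le> c' \<Longrightarrow> op_bound D A c'"
  unfolding op_bound_def by (meson mult_right_mono order_trans vnorm_nonneg)

lemma op_bound_one: "op_bound D 1 1" by (simp add: op_bound_def)

lemma op_bound_mult:
  assumes "op_bound D A a" "op_bound D B b"
  shows "op_bound D (A * B) (a * b)"
  unfolding op_bound_def
proof (intro conjI allI)
  show "0 \<le> a * b" using assms by (simp add: op_bound_def)
  fix g
  have "vnorm D (ap A (ap B g)) \<le> a * vnorm D (ap B g)" using assms by (simp add: op_bound_def)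
  also have "\<dots> \<le> a * (b * vnorm D g)" using assms by (intro mult_left_mono) (auto simp: op_bound_def)
  finally show "vnorm D (ap (A * B) g) \<le> a * b * vnorm D g" by (simp add: mult.assoc)
qed

lemma op_bound_add:
  assumes "op_bound D A a" "op_bound D B b"
  shows "op_bound D (A + B) (a + b)"
  unfolding op_bound_def
proof (intro conjI allI)
  show "0 \<le> a + b" using assms by (simp add: op_bound_def)
  fix g
  have "vnorm D (ap (A + B) g) \<le> L2_set (\<lambda>i. cmod (ap A g i) + cmod (ap B g i)) {..<D}"
    unfolding vnorm_L2 by (intro L2_set_mono) (auto intro: norm_triangle_ineq)
  also have "\<dots> \<le> vnorm D (ap A g) + vnorm D (ap B g)"
    unfolding vnorm_L2 by (rule L2_set_triangle_ineq)
  also have "\<dots> \<le> a * vnorm D g + b * vnorm D g"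
    using assms by (intro add_mono) (auto simp: op_bound_def)
  finally show "vnorm D (ap (A + B) g) \<le> (a + b) * vnorm D g" by (simp add: algebra_simps)
qed

lemma vnorm_scale: "vnorm D (\<lambda>x. c * g x) = cmod c * vnorm D g"
  by (simp add: vnorm_L2 norm_mult L2_set_right_distrib)

lemma op_bound_scalar: "op_bound D (scalar c) (cmod c)"
proof -
  have "ap (scalar c) g = (\<lambda>x. c * g x)" for g by auto
  then show ?thesis by (simp add: op_bound_def vnorm_scale)
qed

lemma op_bound_uminus: "op_bound D A a \<Longrightarrow> op_bound D (- A) a"
  using op_bound_mult [OF op_bound_scalar [of D "-1"], of A a] by (simp add: scalar_uminus [symmetric])

lemma op_bound_diff: "op_bound D A a \<Longrightarrow> op_bound D B b \<Longrightarrow> op_bound D (A - B) (a + b)"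
  using op_bound_add [of D A a "- B" b] op_bound_uminus by simp

lemma op_bound_proj1: "op_bound D (proj1 q) 1"
  unfolding op_bound_def vnorm_L2 by (auto intro!: L2_set_mono)

text \<open>With the bits outside \<open>ws\<close> fixed, the operator is the matrix A acting on a
  vector of length \<open>2 ^ length ws\<close>. The squared bounds are summed over all such fibres
  by \<open>sum_put\<close>.\<close>

lemma op_bound_emb:
  assumes A: "mat_bound (2 ^ length ws) A c" and c: "0 \<le> c" and ws: "distinct ws" "set ws \<subseteq> {..<M}"
  shows "op_bound (2 ^ M) (emb ws A) c"
  unfolding op_bound_def
proof (intro conjI allI c)
  fix g
  let ?m = "2 ^ length ws :: nat" and ?r = "2 ^ length ws :: real"
  have col: "(\<Sum>u<?m. (cmod (ap (emb ws A) g (put ws u x)))\<^sup>2) \<le> c\<^sup>2 * (\<Sum>v<?m. (cmod (g (put ws v x)))\<^sup>2)" for x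
  proof -
    let ?v = "\<lambda>v. g (put ws v x)"
    have "(\<Sum>u<?m. (cmod (ap (emb ws A) g (put ws u x)))\<^sup>2) = (vnorm ?m (mvec ?m A ?v))\<^sup>2"
      unfolding vnorm_sq using ws by (intro sum.cong refl) (simp add: ap_emb mvec_def)
    also have "\<dots> \<le> (c * vnorm ?m ?v)\<^sup>2" using A unfolding mat_bound_def by (intro power_mono) auto
    also have "\<dots> = c\<^sup>2 * (\<Sum>v<?m. (cmod (g (put ws v x)))\<^sup>2)" by (simp add: power_mult_distrib vnorm_sq)
    finally show ?thesis .
  qed
  have "?r * (vnorm (2 ^ M) (ap (emb ws A) g))\<^sup>2 = (\<Sum>x<2 ^ M. \<Sum>u<?m. (cmod (ap (emb ws A) g (put ws u x)))\<^sup>2)"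
    unfolding vnorm_sq using sum_put [OF ws(2), of "\<lambda>x. (cmod (ap (emb ws A) g x))\<^sup>2"] by simp
  also have "\<dots> \<le> (\<Sum>x<2 ^ M. c\<^sup>2 * (\<Sum>v<?m. (cmod (g (put ws v x)))\<^sup>2))" by (intro sum_mono col)
  also have "\<dots> = ?r * (c\<^sup>2 * (\<Sum>x<2 ^ M. (cmod (g x))\<^sup>2))"
    unfolding sum_distrib_left [symmetric] using sum_put [OF ws(2), of "\<lambda>x. (cmod (g x))\<^sup>2"] by simp
  also have "\<dots> = ?r * (c * vnorm (2 ^ M) g)\<^sup>2" by (simp add: power_mult_distrib vnorm_sq)
  finally have "(vnorm (2 ^ M) (ap (emb ws A) g))\<^sup>2 \<le> (c * vnorm (2 ^ M) g)\<^sup>2" by simp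
  then show "vnorm (2 ^ M) (ap (emb ws A) g) \<le> c * vnorm (2 ^ M) g"
    by (rule power2_le_imp_le) (simp add: c)
qed

section \<open>Swaps with sample states\<close>

text \<open>Expresses that Z acts trivially on the wires \<open>ws\<close>. As a commutant the
  property is closed under the ring operations, and no notion of support is required.\<close>

definition commutes :: "nat list \<Rightarrow> lop \<Rightarrow> bool" where
  "commutes ws Z \<longleftrightarrow> (\<forall>G. emb ws G * Z = Z * emb ws G)"

lemma cmD: "commutes ws Z \<Longrightarrow> emb ws G * Z = Z * emb ws G" by (simp add: commutes_def)

lemma commutes_one: "commutes ws 1" by (simp add: commutes_def)
lemma commutes_scalar: "commutes ws (scalar c)" by (simp add: commutes_def scalar_comm)
lemma commutes_add: "commutes ws A \<Longrightarrow> commutes ws B \<Longrightarrow> commutes ws (A + B)" by (simp add: commutes_def algebra_simps)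
lemma commutes_minus: "commutes ws A \<Longrightarrow> commutes ws B \<Longrightarrow> commutes ws (A - B)" by (simp add: commutes_def algebra_simps)
lemma commutes_mult: "commutes ws A \<Longrightarrow> commutes ws B \<Longrightarrow> commutes ws (A * B)"
  unfolding commutes_def by (metis mult.assoc)
lemma commutes_sum: "(\<And>i. i \<in> I \<Longrightarrow> commutes ws (A i)) \<Longrightarrow> commutes ws (\<Sum>i\<in>I. A i)"
  by (induction I rule: infinite_finite_induct) (auto intro: commutes_add simp: commutes_def [of _ 0])
lemma commutes_emb: "set ws \<inter> set ws' = {} \<Longrightarrow> commutes ws (emb ws' A)"
  unfolding commutes_def using emb_comm by blast
lemma commutes_proj1: "q \<notin> set ws \<Longrightarrow> commutes ws (proj1 q)"
  by (simp add: commutes_def proj1_emb_comm)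

lift_definition perm_op :: "(nat \<Rightarrow> nat) \<Rightarrow> lop" is "\<lambda>f g x. g (f x)" by simp

lemma ap_perm_op [simp]: "ap (perm_op f) g x = g (f x)" by transfer simp

lemma perm_op_mult: "perm_op f * perm_op h = perm_op (\<lambda>x. h (f x))" by (rule lop_eqI) simp
lemma perm_op_id: "perm_op (\<lambda>x. x) = 1" by (rule lop_eqI) simp

definition flipop :: "nat \<Rightarrow> lop" where
  "flipop c = perm_op (\<lambda>x. setb c (\<not> bit x c) x)"

lemma ap_flipop: "ap (flipop c) g x = g (setb c (\<not> bit x c) x)" by (simp add: flipop_def)

lemma flipop_flipop: "flipop c * flipop c = 1"
  by (rule lop_eqI) (simp add: ap_flipop bit_setb)

lemma flipop_proj1: "flipop c * proj1 c = (1 - proj1 c) * flipop c"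
  by (rule lop_eqI) (simp add: ap_flipop bit_setb)

lemma proj1_proj1_comm: "proj1 q * proj1 c = proj1 c * proj1 q"
  by (rule lop_eqI) simp

text \<open>On indices below 2 this is p I + q X, which covers NOT, its square roots and the
  rotations exp(i t X).\<close>

definition flip_mat :: "complex \<Rightarrow> complex \<Rightarrow> cmat" where
  "flip_mat p q = (\<lambda>i j. if i = j then p else q)"

lemma emb_flip_mat: "emb [c] (flip_mat p q) = scalar p + scalar q * flipop c"
proof (rule lop_eqI)
  fix g x
  show "ap (emb [c] (flip_mat p q)) g x = ap (scalar p + scalar q * flipop c) g x"
    by (cases "bit x c") (simp_all add: ap_emb flip_mat_def ap_flipop lessThan_nat_numeral bit_0 numeral_2_eq_2)
qed

lemma flipop_emb: "flipop c = emb [c] (flip_mat 0 1)" by (simp add: emb_flip_mat)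

definition sw :: "nat \<Rightarrow> nat \<Rightarrow> nat \<Rightarrow> nat" where
  "sw a b x = setb b (bit x a) (setb a (bit x b) x)"

fun swap_blocks :: "nat list \<Rightarrow> nat list \<Rightarrow> nat \<Rightarrow> nat" where
  "swap_blocks (s # ss) (b # bs) x = swap_blocks ss bs (sw s b x)"
| "swap_blocks _ _ x = x"

lemma swap_blocks_put:
  assumes "length ss = length bs" "distinct (ss @ bs)"
  shows "swap_blocks ss bs x = put bs (idx ss x) (put ss (idx bs x) x)"
  using assms
proof (induction ss bs arbitrary: x rule: list_induct2)
  case (Cons s ss b bs)
  then have ne: "s \<noteq> b" "s \<notin> set ss" "s \<notin> set bs" "b \<notin> set ss" "b \<notin> set bs" by auto
  have i: "idx ss (sw s b x) = idx ss x" "idx bs (sw s b x) = idx bs x"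
    using ne by (simp_all add: sw_def idx_setb)
  have "swap_blocks (s # ss) (b # bs) x = put bs (idx ss x) (put ss (idx bs x) (sw s b x))"
    using Cons by (simp add: i)
  also have "\<dots> = setb b (bit x s) (put bs (idx ss x) (setb s (bit x b) (put ss (idx bs x) x)))"
    using ne by (simp add: sw_def setb_put)
  finally show ?case by (simp add: bit_0)
qed simp

definition block_swap :: "nat list \<Rightarrow> nat list \<Rightarrow> lop" where
  "block_swap ss bs = perm_op (swap_blocks ss bs)"

definition mat_unit :: "nat \<Rightarrow> nat \<Rightarrow> cmat" where
  "mat_unit u v = (\<lambda>i j. if i = u \<and> j = v then 1 else 0)"

lemma ap_emb_mat_unit:
  assumes "v < 2 ^ length ws"
  shows "ap (emb ws (mat_unit u v)) g x = (if idx ws x = u then g (put ws v x) else 0)"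
proof -
  have "ap (emb ws (mat_unit u v)) g x
      = (\<Sum>j<2 ^ length ws. if j = v then (if idx ws x = u then g (put ws v x) else 0) else 0)"
    unfolding ap_emb mat_unit_def by (intro sum.cong refl) auto
  then show ?thesis using assms by simp
qed

text \<open>The swap as the sum of |u><v| on one block times |v><u| on the other. This product form
  allows a sample to be traced out term by term.\<close>

lemma block_swap_sum:
  assumes "length ss = n" "length bs = n" "distinct (ss @ bs)"
  shows "block_swap ss bs = (\<Sum>u<2 ^ n. \<Sum>v<2 ^ n. emb ss (mat_unit u v) * emb bs (mat_unit v u))"
proof (rule lop_eqI)
  fix g x
  have d: "set ss \<inter> set bs = {}" "set bs \<inter> set ss = {}" using assms by auto
  have "ap (\<Sum>u<2 ^ n. \<Sum>v<2 ^ n. emb ss (mat_unit u v) * emb bs (mat_unit v u)) g x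
     = (\<Sum>u<2 ^ n. \<Sum>v<2 ^ n. if u = idx ss x then (if v = idx bs x then g (put bs u (put ss v x)) else 0) else 0)"
    unfolding ap_sum
    by (intro sum.cong refl) (auto simp: ap_emb_mat_unit assms idx_put_disjoint d)
  also have "\<dots> = (\<Sum>u<2 ^ n. if u = idx ss x then g (put bs u (put ss (idx bs x) x)) else 0)"
    using idx_less [of bs x] assms(2) by (intro sum.cong refl) auto
  also have "\<dots> = g (put bs (idx ss x) (put ss (idx bs x) x))"
    using idx_less [of ss x] assms(1) by simp
  also have "\<dots> = ap (block_swap ss bs) g x"
    using assms by (simp add: block_swap_def swap_blocks_put)
  finally show "ap (block_swap ss bs) g x = ap (\<Sum>u<2 ^ n. \<Sum>v<2 ^ n. emb ss (mat_unit u v) * emb bs (mat_unit v u)) g x" by simp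
qed

lemma block_swap_block_swap:
  assumes "length ss = length bs" "distinct (ss @ bs)"
  shows "block_swap ss bs * block_swap ss bs = 1"
proof -
  have d: "set ss \<inter> set bs = {}" "set bs \<inter> set ss = {}" "distinct ss" "distinct bs" using assms by auto
  have l: "idx bs x < 2 ^ length ss" "idx ss x < 2 ^ length bs" for x
    using idx_less [of bs x] idx_less [of ss x] assms(1) by simp_all
  have "swap_blocks ss bs (swap_blocks ss bs x) = x" for x
    using assms d by (simp add: swap_blocks_put idx_put_disjoint l put_comm [OF d(1)])
  then show ?thesis by (simp add: block_swap_def perm_op_mult perm_op_id)
qed

lemma commutes_block_swap:
  assumes "length ss = length bs" "distinct (ss @ bs)" "set ws \<inter> set ss = {}" "set ws \<inter> set bs = {}"
  shows "commutes ws (block_swap ss bs)"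
  unfolding block_swap_sum [OF assms(1) refl assms(2)] using assms by (intro commutes_sum commutes_mult commutes_emb)

lemma proj1_block_swap_comm:
  assumes "length ss = length bs" "distinct (ss @ bs)" "q \<notin> set ss" "q \<notin> set bs"
  shows "proj1 q * block_swap ss bs = block_swap ss bs * proj1 q"
proof -
  have "bit (swap_blocks ss bs x) q = bit x q" for x
    using assms by (simp add: swap_blocks_put bit_put_notin)
  then show ?thesis by (intro lop_eqI) (simp add: block_swap_def)
qed

section \<open>Controlled operators\<close>

definition controlled :: "lop \<Rightarrow> lop \<Rightarrow> lop" where
  "controlled Q A = 1 + Q * (A - 1)"

lemma controlled_one [simp]: "controlled Q 1 = 1" by (simp add: controlled_def)
lemma controlled_1 [simp]: "controlled 1 A = A" by (simp add: controlled_def)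

lemma controlled_mult:
  assumes "Q * Q = Q" "Q * A = A * Q"
  shows "controlled Q A * controlled Q B = controlled Q (A * B)"
proof -
  have 1: "A * (Q * Y) = Q * (A * Y)" for Y by (metis assms(2) mult.assoc)
  have 2: "Q * (Q * Y) = Q * Y" for Y by (metis assms(1) mult.assoc)
  show ?thesis by (simp add: controlled_def algebra_simps assms(1) assms(2) [symmetric] 1 2)
qed

lemma controlled_comm:
  assumes "Y * Q = Q * Y" "Y * A = A * Y"
  shows "Y * controlled Q A = controlled Q A * Y"
proof -
  have 1: "Y * (Q * Z) = Q * (Y * Z)" for Z by (metis assms(1) mult.assoc)
  have 2: "Y * (Q * (A - 1)) = Q * (A - 1) * Y"
    unfolding 1 by (simp add: algebra_simps assms(2))
  show ?thesis by (simp add: controlled_def distrib_left distrib_right 2)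
qed

text \<open>An absent control becomes the projection 1, so controlled and uncontrolled queries need
  no separate treatment.\<close>

definition ctrl_proj :: "nat option \<Rightarrow> lop" where
  "ctrl_proj co = (case co of None \<Rightarrow> 1 | Some q \<Rightarrow> proj1 q)"

lemma ctrl_proj_idem: "ctrl_proj co * ctrl_proj co = ctrl_proj co"
  by (cases co) (simp_all add: ctrl_proj_def proj1_idem)

lemma op_bound_ctrl_proj: "op_bound D (ctrl_proj co) 1"
  by (cases co) (simp_all add: ctrl_proj_def op_bound_one op_bound_proj1)

lemma ctrl_proj_emb_comm: "(\<And>q. co = Some q \<Longrightarrow> q \<notin> set ws) \<Longrightarrow> ctrl_proj co * emb ws A = emb ws A * ctrl_proj co"
  by (cases co) (simp_all add: ctrl_proj_def proj1_emb_comm)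

lemma commutes_controlled: "commutes ws Q \<Longrightarrow> commutes ws A \<Longrightarrow> commutes ws (controlled Q A)"
  unfolding controlled_def by (intro commutes_add commutes_mult commutes_minus commutes_one)

text \<open>\<open>\<phi>\<close> plays the role of \<open>A \<mapsto> tr (A (\<xi> \<otimes> \<omega>))\<close>, where \<open>\<omega>\<close> is the product of the sample
  states \<open>\<tau> b\<close>, each living on its own block \<open>block b\<close> of \<open>n\<close> wires.  The product structure enters only
  through \<open>phi_prod\<close>.\<close>

locale sampling =
  fixes \<phi> :: "lop \<Rightarrow> complex" and Mw N n BL :: nat and block :: "nat \<Rightarrow> nat list" and \<tau> :: "nat \<Rightarrow> cmat"
  assumes phi_add: "\<phi> (A + B) = \<phi> A + \<phi> B"
    and phi_scalar: "\<phi> (scalar c * A) = c * \<phi> A"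
    and phi_bound: "op_bound (2 ^ Mw) A r \<Longrightarrow> cmod (\<phi> A) \<le> r"
    and phi_prod: "b < BL \<Longrightarrow> commutes (block b) Z \<Longrightarrow>
          \<phi> (Z * emb (block b) G) = (\<Sum>i<2 ^ n. \<Sum>j<2 ^ n. G i j * \<tau> b j i) * \<phi> Z"
    and bw_wires: "b < BL \<Longrightarrow> distinct (block b) \<and> length (block b) = n \<and> set (block b) \<inter> {..<N} = {} \<and> set (block b) \<subseteq> {..<Mw}"
    and bw_disjoint: "b < BL \<Longrightarrow> b' < BL \<Longrightarrow> b \<noteq> b' \<Longrightarrow> set (block b) \<inter> set (block b') = {}"
    and N_le: "N \<le> Mw"
begin

abbreviation op_bounded :: "lop \<Rightarrow> real \<Rightarrow> bool" where "op_bounded \<equiv> op_bound (2 ^ Mw)"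

text \<open>Z leaves the sample blocks \<open>bs\<close> untouched, so these may still be traced out
  independently of Z by \<open>phi_prod\<close>.\<close>

definition free :: "nat set \<Rightarrow> lop \<Rightarrow> bool" where
  "free bs Z \<longleftrightarrow> (\<forall>b\<in>bs. commutes (block b) Z)"

lemma free_mult: "free bs A \<Longrightarrow> free bs B \<Longrightarrow> free bs (A * B)"
  by (simp add: free_def commutes_mult)

lemma free_one: "free bs 1" by (simp add: free_def commutes_one)

lemma free_mono: "free bs A \<Longrightarrow> bs' \<subseteq> bs \<Longrightarrow> free bs' A"
  by (auto simp: free_def)

lemma free_emb: "set ws \<subseteq> {..<N} \<Longrightarrow> bs \<subseteq> {..<BL} \<Longrightarrow> free bs (emb ws A)"
  unfolding free_def
proof
  fix b assume "set ws \<subseteq> {..<N}" "bs \<subseteq> {..<BL}" "b \<in> bs"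
  then show "commutes (block b) (emb ws A)" using bw_wires [of b] by (intro commutes_emb) auto
qed

lemma phi_zero: "\<phi> 0 = 0" using phi_scalar [of 0 0] by simp

lemma phi_uminus: "\<phi> (- A) = - \<phi> A" using phi_scalar [of "-1" A] by (simp add: scalar_uminus [symmetric])

lemma phi_diff: "\<phi> (A - B) = \<phi> A - \<phi> B" using phi_add [of A "- B"] by (simp add: phi_uminus)

lemma phi_sum: "\<phi> (\<Sum>i\<in>I. A i) = (\<Sum>i\<in>I. \<phi> (A i))"
  by (induction I rule: infinite_finite_induct) (simp_all add: phi_zero phi_add)

lemma phi_scalar_mid: "\<phi> (A * (scalar c * B)) = c * \<phi> (A * B)"
  by (simp add: scalar_left_comm phi_scalar)

text \<open>The identity tr_2 (SWAP (1 \<otimes> \<tau>)) = \<tau> inside a context. Since L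
  commutes with the block, the factor |v><u| can be moved to the end, where it contributes the
  number \<tau>_uv; the remaining sum of \<tau>_uv |u><v| is \<tau> on the system.\<close>

lemma phi_swap:
  assumes b: "b < BL" and Z: "commutes (block b) Z" and L: "commutes (block b) L"
    and sys: "length sys = n" "distinct sys" "set sys \<subseteq> {..<N}"
  shows "\<phi> (Z * block_swap sys (block b) * L) = \<phi> (Z * emb sys (\<tau> b) * L)"
proof -
  have block: "distinct (sys @ block b)" "length (block b) = n" "set (block b) \<inter> set sys = {}"
    using bw_wires [OF b] sys by auto
  have e: "\<phi> (Z * (emb sys (mat_unit u v) * emb (block b) (mat_unit v u)) * L) = \<phi> (Z * (scalar (\<tau> b u v) * emb sys (mat_unit u v)) * L)"
    if "u < 2 ^ n" "v < 2 ^ n" for u v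
  proof -
    have "Z * (emb sys (mat_unit u v) * emb (block b) (mat_unit v u)) * L = (Z * emb sys (mat_unit u v) * L) * emb (block b) (mat_unit v u)"
      by (simp add: mult.assoc cmD [OF L])
    moreover have "commutes (block b) (Z * emb sys (mat_unit u v) * L)"
      by (intro commutes_mult commutes_emb Z L block)
    ultimately have "\<phi> (Z * (emb sys (mat_unit u v) * emb (block b) (mat_unit v u)) * L)
        = (\<Sum>i<2 ^ n. \<Sum>j<2 ^ n. mat_unit v u i j * \<tau> b j i) * \<phi> (Z * emb sys (mat_unit u v) * L)"
      using phi_prod [OF b] by simp
    also have "(\<Sum>i<2 ^ n. \<Sum>j<2 ^ n. mat_unit v u i j * \<tau> b j i) = (\<Sum>i<2 ^ n. \<Sum>j<2 ^ n. if j = u then (if i = v then \<tau> b u v else 0) else 0)"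
      by (intro sum.cong refl) (auto simp: mat_unit_def)
    also have "\<dots> = \<tau> b u v" using that by simp
    finally show ?thesis by (simp add: mult.assoc scalar_left_comm phi_scalar phi_scalar_mid)
  qed
  have "emb sys (\<tau> b) = emb sys (\<lambda>i j. \<Sum>u<2 ^ n. \<Sum>v<2 ^ n. \<tau> b u v * mat_unit u v i j)"
  proof (rule emb_eqm, unfold eqm_def, intro allI impI)
    fix i j :: nat assume ij: "i < 2 ^ length sys" "j < 2 ^ length sys"
    have "(\<Sum>u<2 ^ n. \<Sum>v<2 ^ n. \<tau> b u v * mat_unit u v i j)
        = (\<Sum>u<2 ^ n. \<Sum>v<2 ^ n. if v = j then (if u = i then \<tau> b i j else 0) else 0)"
      by (intro sum.cong refl) (auto simp: mat_unit_def)
    also have "\<dots> = \<tau> b i j" using ij sys by simp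
    finally show "\<tau> b i j = (\<Sum>u<2 ^ n. \<Sum>v<2 ^ n. \<tau> b u v * mat_unit u v i j)" by simp
  qed
  also have "\<dots> = (\<Sum>u<2 ^ n. \<Sum>v<2 ^ n. scalar (\<tau> b u v) * emb sys (mat_unit u v))"
    by (simp add: emb_sum emb_scale)
  finally have tau: "emb sys (\<tau> b) = (\<Sum>u<2 ^ n. \<Sum>v<2 ^ n. scalar (\<tau> b u v) * emb sys (mat_unit u v))" .
  show ?thesis
    unfolding block_swap_sum [OF sys(1) block(2) block(1)] tau
    by (simp add: sum_distrib_left sum_distrib_right phi_sum e)
qed

fun chain :: "nat list \<Rightarrow> nat list \<Rightarrow> lop" where
  "chain sys [] = 1"
| "chain sys (b # bs) = block_swap sys (block b) * chain sys bs"

lemma chain_append: "chain sys (bs @ bs') = chain sys bs * chain sys bs'"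
  by (induction bs) (simp_all add: mult.assoc)

context
  fixes sys :: "nat list"
  assumes sys: "length sys = n" "distinct sys" "set sys \<subseteq> {..<N}"
begin

lemma block_swap_side:
  assumes "b < BL"
  shows "length sys = length (block b)" "distinct (sys @ block b)"
  using bw_wires [OF assms] sys by auto

lemma chain_inv: "set bs \<subseteq> {..<BL} \<Longrightarrow> chain sys (rev bs) * chain sys bs = 1"
proof (induction bs)
  case (Cons b bs)
  then have 1: "block_swap sys (block b) * block_swap sys (block b) = 1" by (intro block_swap_block_swap block_swap_side) auto
  have "chain sys (rev (b # bs)) * chain sys (b # bs)
     = chain sys (rev bs) * ((block_swap sys (block b) * block_swap sys (block b)) * chain sys bs)"
    by (simp add: chain_append mult.assoc)
  also have "\<dots> = 1" using Cons by (simp add: 1)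
  finally show ?case .
qed simp

lemma chain_inv': "set bs \<subseteq> {..<BL} \<Longrightarrow> chain sys bs * chain sys (rev bs) = 1"
  using chain_inv [of "rev bs"] by simp

lemma chain_commutes:
  "set bs \<subseteq> {..<BL} \<Longrightarrow> set ws \<inter> set sys = {} \<Longrightarrow> (\<And>b. b \<in> set bs \<Longrightarrow> set ws \<inter> set (block b) = {}) \<Longrightarrow> commutes ws (chain sys bs)"
proof (induction bs)
  case (Cons b bs)
  then show ?case using block_swap_side [of b] by (auto intro!: commutes_mult commutes_block_swap)
qed (simp add: commutes_one)

lemma chain_proj1_comm:
  "set bs \<subseteq> {..<BL} \<Longrightarrow> q < N \<Longrightarrow> q \<notin> set sys \<Longrightarrow> proj1 q * chain sys bs = chain sys bs * proj1 q"
proof (induction bs)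
  case (Cons b bs)
  then have 1: "proj1 q * block_swap sys (block b) = block_swap sys (block b) * proj1 q"
    using block_swap_side [of b] bw_wires [of b] by (intro proj1_block_swap_comm) auto
  have "proj1 q * chain sys (b # bs) = (proj1 q * block_swap sys (block b)) * chain sys bs" by (simp add: mult.assoc)
  also have "\<dots> = block_swap sys (block b) * (proj1 q * chain sys bs)" by (simp add: 1 mult.assoc)
  also have "\<dots> = chain sys (b # bs) * proj1 q" using Cons by (simp add: mult.assoc)
  finally show ?case .
qed simp

text \<open>Swaps are replaced by \<rho> from left to right. Distinctness keeps each sample fresh:
  the later swaps commute with its block. The factors already replaced act on the system only and
  are absorbed into Z, which is therefore generalised.\<close>

lemma phi_chain:
  assumes "set bs \<subseteq> {..<BL}" "distinct bs" "\<And>b. b \<in> set bs \<Longrightarrow> \<tau> b = \<rho>" "free (set bs) Z" "free (set bs) L"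
  shows "\<phi> (Z * chain sys bs * L) = \<phi> (Z * emb sys \<rho> ^ length bs * L)"
  using assms
proof (induction bs arbitrary: Z)
  case (Cons b bs)
  have b: "b < BL" using Cons.prems by auto
  have "commutes (block b) (chain sys bs)"
  proof (rule chain_commutes)
    show "set (block b) \<inter> set sys = {}" using bw_wires [OF b] sys by auto
    fix b' assume "b' \<in> set bs"
    then show "set (block b) \<inter> set (block b') = {}"
      using Cons.prems b by (intro bw_disjoint) auto
  qed (use Cons.prems in auto)
  then have "commutes (block b) (chain sys bs * L)" using Cons.prems by (intro commutes_mult) (auto simp: free_def)
  then have "\<phi> (Z * block_swap sys (block b) * (chain sys bs * L)) = \<phi> (Z * emb sys (\<tau> b) * (chain sys bs * L))"
    using Cons.prems by (intro phi_swap b sys) (auto simp: free_def)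
  also have "\<tau> b = \<rho>" using Cons.prems by simp
  also have "\<phi> (Z * emb sys \<rho> * (chain sys bs * L)) = \<phi> ((Z * emb sys \<rho>) * chain sys bs * L)"
    by (simp add: mult.assoc)
  also have "\<dots> = \<phi> ((Z * emb sys \<rho>) * emb sys \<rho> ^ length bs * L)"
    using Cons.prems sys by (intro Cons.IH free_mult free_emb) (auto simp: free_def)
  finally show ?case by (simp add: mult.assoc)
qed simp

end

text \<open>V and G are the circuit and the ideal operator, V' and G' play the role of their
  inverses. The observable Z has to avoid only the blocks \<open>bs\<close> consumed by V, so it may
  contain the rest of a circuit conjugated around it; R and L leave room for ideal operators that
  have already replaced other parts.\<close>

definition apx :: "nat set \<Rightarrow> lop \<Rightarrow> lop \<Rightarrow> lop \<Rightarrow> lop \<Rightarrow> real \<Rightarrow> bool" where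
  "apx bs V V' G G' e \<longleftrightarrow>
     op_bounded V 1 \<and> op_bounded V' 1 \<and> op_bounded G 1 \<and> op_bounded G' 1 \<and>
     free ({..<BL} - bs) V \<and> free ({..<BL} - bs) V' \<and> free {..<BL} G \<and> free {..<BL} G' \<and>
     (\<forall>Z R L. free bs Z \<and> op_bounded Z 1 \<and> free {..<BL} R \<and> op_bounded R 1 \<and> free {..<BL} L \<and> op_bounded L 1 \<longrightarrow>
        cmod (\<phi> (R * (V' * Z * V) * L) - \<phi> (R * (G' * Z * G) * L)) \<le> e)"

lemma op_bounded_mult1: "op_bounded A 1 \<Longrightarrow> op_bounded B 1 \<Longrightarrow> op_bounded (A * B) 1"
  using op_bound_mult [of _ A 1 B 1] by simp

lemma apx_exact:
  assumes "op_bounded G 1" "op_bounded G' 1" "free {..<BL} G" "free {..<BL} G'"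
  shows "apx {} G G' G G' 0"
  using assms by (simp add: apx_def)

text \<open>A hybrid argument. The first circuit is replaced with observable V2' Z V2, admissible
  because the second circuit avoids \<open>bs1\<close>. Then the second circuit is replaced, with
  the ideal G1' and G1 moved into the context R, L. The errors add by the triangle
  inequality.\<close>

lemma apx_mult:
  assumes 1: "apx bs1 V1 V1' G1 G1' e1" and 2: "apx bs2 V2 V2' G2 G2' e2"
    and d: "bs1 \<inter> bs2 = {}" "bs1 \<subseteq> {..<BL}" "bs2 \<subseteq> {..<BL}"
  shows "apx (bs1 \<union> bs2) (V2 * V1) (V1' * V2') (G2 * G1) (G1' * G2') (e1 + e2)"
proof -
  have nbs: "op_bounded V1 1" "op_bounded V1' 1" "op_bounded G1 1" "op_bounded G1' 1" "op_bounded V2 1" "op_bounded V2' 1" "op_bounded G2 1" "op_bounded G2' 1"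
    using 1 2 by (auto simp: apx_def)
  have fG: "free {..<BL} G1" "free {..<BL} G1'" "free {..<BL} G2" "free {..<BL} G2'"
    using 1 2 by (auto simp: apx_def)
  have f1: "free ({..<BL} - bs1) V1" "free ({..<BL} - bs1) V1'" using 1 by (auto simp: apx_def)
  have f2: "free ({..<BL} - bs2) V2" "free ({..<BL} - bs2) V2'" using 2 by (auto simp: apx_def)
  have fV: "free ({..<BL} - (bs1 \<union> bs2)) (V2 * V1)" "free ({..<BL} - (bs1 \<union> bs2)) (V1' * V2')"
    using f1 f2 by (auto intro!: free_mult elim!: free_mono)
  have "cmod (\<phi> (R * ((V1' * V2') * Z * (V2 * V1)) * L) - \<phi> (R * ((G1' * G2') * Z * (G2 * G1)) * L)) \<le> e1 + e2"
    if h: "free (bs1 \<union> bs2) Z" "op_bounded Z 1" "free {..<BL} R" "op_bounded R 1" "free {..<BL} L" "op_bounded L 1" for Z R L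
  proof -
    let ?Z = "V2' * Z * V2"
    have "free bs1 V2" "free bs1 V2'" using f2 d by (auto elim!: free_mono)
    then have "free bs1 ?Z" using h by (intro free_mult) (auto elim: free_mono)
    moreover have "op_bounded ?Z 1" using h nbs by (intro op_bounded_mult1)
    ultimately have a: "cmod (\<phi> (R * (V1' * ?Z * V1) * L) - \<phi> (R * (G1' * ?Z * G1) * L)) \<le> e1"
      using 1 h by (simp add: apx_def)
    have b: "cmod (\<phi> ((R * G1') * (V2' * Z * V2) * (G1 * L)) - \<phi> ((R * G1') * (G2' * Z * G2) * (G1 * L))) \<le> e2"
    proof -
      have "free bs2 Z" using h by (auto elim: free_mono)
      moreover have "free {..<BL} (R * G1')" "free {..<BL} (G1 * L)" "op_bounded (R * G1') 1" "op_bounded (G1 * L) 1"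
        using h nbs fG by (auto intro!: free_mult op_bounded_mult1)
      ultimately show ?thesis using 2 h by (simp add: apx_def)
    qed
    have e: "R * ((V1' * V2') * Z * (V2 * V1)) * L = R * (V1' * ?Z * V1) * L"
      "R * (G1' * ?Z * G1) * L = (R * G1') * (V2' * Z * V2) * (G1 * L)"
      "R * ((G1' * G2') * Z * (G2 * G1)) * L = (R * G1') * (G2' * Z * G2) * (G1 * L)"
      by (simp_all add: mult.assoc)
    show ?thesis
      using norm_triangle_ineq [of "\<phi> (R * (V1' * ?Z * V1) * L) - \<phi> (R * (G1' * ?Z * G1) * L)"
          "\<phi> ((R * G1') * (V2' * Z * V2) * (G1 * L)) - \<phi> ((R * G1') * (G2' * Z * G2) * (G1 * L))"] a b
      unfolding e by simp
  qed
  then show ?thesis unfolding apx_def using nbs fG fV by (auto intro!: op_bounded_mult1 free_mult)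
qed

text \<open>G' Z G - H' Z H splits into (G' - H') Z G and H' Z (G - H), each of norm at most
  \<eta>.\<close>

lemma apx_perturb:
  assumes a: "apx bs V V' G G' e" and H: "op_bounded H 1" "op_bounded H' 1" "free {..<BL} H" "free {..<BL} H'"
    and d: "op_bounded (G - H) \<eta>" "op_bounded (G' - H') \<eta>"
  shows "apx bs V V' H H' (e + 2 * \<eta>)"
proof -
  have "cmod (\<phi> (R * (V' * Z * V) * L) - \<phi> (R * (H' * Z * H) * L)) \<le> e + 2 * \<eta>"
    if h: "free bs Z" "op_bounded Z 1" "free {..<BL} R" "op_bounded R 1" "free {..<BL} L" "op_bounded L 1" for Z R L
  proof -
    have 1: "cmod (\<phi> (R * (V' * Z * V) * L) - \<phi> (R * (G' * Z * G) * L)) \<le> e" using a h by (simp add: apx_def)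
    have "G' * Z * G - H' * Z * H = (G' - H') * Z * G + H' * Z * (G - H)" by (simp add: algebra_simps)
    then have eq: "R * (G' * Z * G) * L - R * (H' * Z * H) * L = R * ((G' - H') * Z * G + H' * Z * (G - H)) * L"
      by (metis (no_types, lifting) left_diff_distrib right_diff_distrib)
    have "op_bounded (R * ((G' - H') * Z * G + H' * Z * (G - H)) * L) (1 * (\<eta> * 1 * 1 + 1 * 1 * \<eta>) * 1)"
      using a by (intro op_bound_mult op_bound_add d H h) (simp add: apx_def)
    then have "cmod (\<phi> (R * (G' * Z * G) * L) - \<phi> (R * (H' * Z * H) * L)) \<le> 2 * \<eta>"
      unfolding phi_diff [symmetric] eq using phi_bound by fastforce
    with 1 show ?thesis
      using norm_triangle_ineq [of "\<phi> (R * (V' * Z * V) * L) - \<phi> (R * (G' * Z * G) * L)"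
          "\<phi> (R * (G' * Z * G) * L) - \<phi> (R * (H' * Z * H) * L)"] by simp
  qed
  then show ?thesis using a H unfolding apx_def by auto
qed

text \<open>V' Z V = Z + Z A - A Z + r with r of norm at most x^2 + 2 x^2 + x^2 = 4 x^2, and
  likewise for G with B. The first-order terms have equal values under \<phi>, so only the two
  remainders survive. The quadratic error is what makes many small rotations cheaper than a large
  one.\<close>

lemma apx_first_order:
  assumes V: "V = 1 + A + e" "V' = 1 - A + e'" and G: "G = 1 + B + f" "G' = 1 - B + f'"
    and nbs: "op_bounded V 1" "op_bounded V' 1" "op_bounded G 1" "op_bounded G' 1"
    and fr: "free ({..<BL} - bs) V" "free ({..<BL} - bs) V'" "free {..<BL} G" "free {..<BL} G'" "bs \<subseteq> {..<BL}"
    and AB: "op_bounded A x" "op_bounded B x" "op_bounded e (x\<^sup>2)" "op_bounded e' (x\<^sup>2)" "op_bounded f (x\<^sup>2)" "op_bounded f' (x\<^sup>2)" "x \<le> 1"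
    and first: "\<And>Z L. free bs Z \<Longrightarrow> free bs L \<Longrightarrow> \<phi> (Z * A * L) = \<phi> (Z * B * L)"
  shows "apx bs V V' G G' (8 * x\<^sup>2)"
proof -
  have "cmod (\<phi> (R * (V' * Z * V) * L) - \<phi> (R * (G' * Z * G) * L)) \<le> 8 * x\<^sup>2"
    if h: "free bs Z" "op_bounded Z 1" "free {..<BL} R" "op_bounded R 1" "free {..<BL} L" "op_bounded L 1" for Z R L
  proof -
    have fRL: "free bs R" "free bs L" using h fr by (auto elim: free_mono)
    define r where "r = e' * Z * V + (1 - A) * Z * e - A * Z * A"
    define s where "s = f' * Z * G + (1 - B) * Z * f - B * Z * B"
    have x0: "0 \<le> x" using AB(1) by (simp add: op_bound_def)
    have n1A: "op_bounded (1 - A) 2" "op_bounded (1 - B) 2" using op_bound_diff [OF op_bound_one AB(1)] op_bound_diff [OF op_bound_one AB(2)] AB(7)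
      by (auto intro: op_bound_mono)
    have "op_bounded r (x\<^sup>2 * 1 * 1 + 2 * 1 * x\<^sup>2 + x * 1 * x)"
      unfolding r_def by (intro op_bound_add op_bound_diff op_bound_mult AB n1A nbs h)
    moreover have "op_bounded s (x\<^sup>2 * 1 * 1 + 2 * 1 * x\<^sup>2 + x * 1 * x)"
      unfolding s_def by (intro op_bound_add op_bound_diff op_bound_mult AB n1A nbs h)
    ultimately have "op_bounded (R * (r - s) * L) (1 * ((x\<^sup>2 * 1 * 1 + 2 * 1 * x\<^sup>2 + x * 1 * x) + (x\<^sup>2 * 1 * 1 + 2 * 1 * x\<^sup>2 + x * 1 * x)) * 1)"
      by (intro op_bound_mult op_bound_diff h)
    then have rs: "cmod (\<phi> (R * (r - s) * L)) \<le> 8 * x\<^sup>2"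
      using phi_bound by (fastforce simp: power2_eq_square)
    have v: "V' * Z * V = Z + Z * A - A * Z + r"
      unfolding r_def V by (simp add: algebra_simps)
    have g: "G' * Z * G = Z + Z * B - B * Z + s"
      unfolding s_def G by (simp add: algebra_simps)
    have "\<phi> (R * (V' * Z * V) * L) - \<phi> (R * (G' * Z * G) * L)
       = (\<phi> (R * Z * A * L) - \<phi> (R * Z * B * L)) - (\<phi> (R * A * (Z * L)) - \<phi> (R * B * (Z * L))) + \<phi> (R * (r - s) * L)"
      unfolding v g by (simp add: phi_diff phi_add distrib_left distrib_right left_diff_distrib right_diff_distrib mult.assoc)
    also have "\<phi> (R * Z * A * L) = \<phi> (R * Z * B * L)" by (intro first free_mult h fRL)
    also have "\<phi> (R * A * (Z * L)) = \<phi> (R * B * (Z * L))" by (intro first free_mult h fRL)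
    finally show ?thesis using rs by simp
  qed
  then show ?thesis using nbs fr by (simp add: apx_def)
qed

end

section \<open>Gates\<close>

lemma unitary_of_emb:
  assumes "distinct ws" "emb ws A * emb ws (adj A) = 1" "emb ws (adj A) * emb ws A = 1"
  shows "unitary (2 ^ length ws) A"
proof -
  have "emb ws (mprod (2 ^ length ws) A (adj A)) = emb ws idm" "emb ws (mprod (2 ^ length ws) (adj A) A) = emb ws idm"
    using assms by (simp_all add: emb_mult [symmetric] emb_idm)
  then show ?thesis unfolding unitary_eqm using emb_inj [OF assms(1)] by blast
qed

lemma emb_unitary:
  assumes "distinct ws" "unitary (2 ^ length ws) A"
  shows "emb ws A * emb ws (adj A) = 1" "emb ws (adj A) * emb ws A = 1"
proof -
  have "emb ws (mprod (2 ^ length ws) A (adj A)) = emb ws idm" "emb ws (mprod (2 ^ length ws) (adj A) A) = emb ws idm"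
    using assms(2) by (auto intro!: emb_eqm simp: unitary_eqm)
  then show "emb ws A * emb ws (adj A) = 1" "emb ws (adj A) * emb ws A = 1"
    using assms(1) by (simp_all add: emb_mult emb_idm)
qed

lemma adj_ctrl: "adj (ctrl A) = ctrl (adj A)"
  by (intro ext) (auto simp: adj_def ctrl_def idm_def)

text \<open>Proved on operators over the wires 0, ..., m, where a controlled product is immediate,
  and pulled back by \<open>unitary_of_emb\<close>.\<close>

lemma unitary_ctrl:
  assumes "unitary (2 ^ m) A"
  shows "unitary (2 ^ Suc m) (ctrl A)"
proof -
  let ?ws = "map Suc [0..<m]"
  have d: "distinct (0 # ?ws)" "0 \<notin> set ?ws" "distinct ?ws" by (auto simp: distinct_map)
  have u: "emb ?ws A * emb ?ws (adj A) = 1" "emb ?ws (adj A) * emb ?ws A = 1"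
    using emb_unitary [of ?ws A] assms d by simp_all
  have c: "proj1 0 * emb ?ws C = emb ?ws C * proj1 0" for C by (rule proj1_emb_comm [OF d(2)])
  have "unitary (2 ^ length (0 # ?ws)) (ctrl A)"
  proof (rule unitary_of_emb [OF d(1)])
    show "emb (0 # ?ws) (ctrl A) * emb (0 # ?ws) (adj (ctrl A)) = 1"
      unfolding adj_ctrl emb_ctrl [OF d(2)] controlled_def [symmetric] using u by (simp add: controlled_mult proj1_idem c)
    show "emb (0 # ?ws) (adj (ctrl A)) * emb (0 # ?ws) (ctrl A) = 1"
      unfolding adj_ctrl emb_ctrl [OF d(2)] controlled_def [symmetric] using u by (simp add: controlled_mult proj1_idem c)
  qed
  then show ?thesis by simp
qed

lemma op_bound_controlled_emb:
  assumes "unitary (2 ^ length ws) A" "distinct ws" "set ws \<subseteq> {..<M}"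
    "\<And>q. co = Some q \<Longrightarrow> q \<notin> set ws \<and> q < M"
  shows "op_bound (2 ^ M) (controlled (ctrl_proj co) (emb ws A)) 1"
proof (cases co)
  case None
  then show ?thesis using assms by (simp add: ctrl_proj_def op_bound_emb mat_bound_unitary)
next
  case (Some q)
  have "mat_bound (2 ^ length (q # ws)) (ctrl A) 1" using assms(1) by (simp only: length_Cons unitary_ctrl mat_bound_unitary)
  then have "op_bound (2 ^ M) (emb (q # ws) (ctrl A)) 1" using assms Some by (intro op_bound_emb) auto
  then show ?thesis using Some assms by (simp add: ctrl_proj_def emb_ctrl controlled_def)
qed

section \<open>Circuits as operators and the gates used by the compiler\<close>

fun circ_lop :: "gate list \<Rightarrow> lop" where
  "circ_lop [] = 1"
| "circ_lop (g # gs) = circ_lop gs * emb (snd g) (fst g)"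

text \<open>The operator ring carries no adjoint, so the reversed circuit of adjoint gates is a
  function of its own.\<close>

fun circ_lop_adj :: "gate list \<Rightarrow> lop" where
  "circ_lop_adj [] = 1"
| "circ_lop_adj (g # gs) = emb (snd g) (adj (fst g)) * circ_lop_adj gs"

lemma circ_lop_append: "circ_lop (gs @ hs) = circ_lop hs * circ_lop gs"
  by (induction gs) (simp_all add: mult.assoc)

lemma circ_lop_adj_append: "circ_lop_adj (gs @ hs) = circ_lop_adj gs * circ_lop_adj hs"
  by (induction gs) (simp_all add: mult.assoc)

definition wf_gates :: "nat \<Rightarrow> gate list \<Rightarrow> bool" where
  "wf_gates M gs \<longleftrightarrow> (\<forall>g\<in>set gs. is_gate M g)"

lemma wf_gates_simps [simp]: "wf_gates M []" "wf_gates M (g # gs) \<longleftrightarrow> is_gate M g \<and> wf_gates M gs"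
  "wf_gates M (gs @ hs) \<longleftrightarrow> wf_gates M gs \<and> wf_gates M hs"
  by (auto simp: wf_gates_def)

lemma op_bound_gate:
  assumes "is_gate M g"
  shows "op_bound (2 ^ M) (emb (snd g) (fst g)) 1" "op_bound (2 ^ M) (emb (snd g) (adj (fst g))) 1"
  using assms by (auto simp: is_gate_def intro!: op_bound_emb mat_bound_unitary unitary_adj)

lemma op_bound_circ_lop: "wf_gates M gs \<Longrightarrow> op_bound (2 ^ M) (circ_lop gs) 1"
proof (induction gs)
  case (Cons g gs)
  then show ?case using op_bound_mult [of "2 ^ M" "circ_lop gs" 1 _ 1] op_bound_gate by simp
qed (simp add: op_bound_one)

lemma op_bound_circ_lop_adj: "wf_gates M gs \<Longrightarrow> op_bound (2 ^ M) (circ_lop_adj gs) 1"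
proof (induction gs)
  case (Cons g gs)
  then show ?case using op_bound_mult [of "2 ^ M" _ 1 "circ_lop_adj gs" 1] op_bound_gate by simp
qed (simp add: op_bound_one)

lemma circ_lop_circ_lop_adj: "wf_gates M gs \<Longrightarrow> circ_lop gs * circ_lop_adj gs = 1"
proof (induction gs)
  case (Cons g gs)
  then have "emb (snd g) (fst g) * emb (snd g) (adj (fst g)) = 1"
    by (intro emb_unitary) (auto simp: is_gate_def)
  then have "circ_lop (g # gs) * circ_lop_adj (g # gs) = circ_lop gs * circ_lop_adj gs"
    by (simp add: mult.assoc) (metis mult.assoc mult_1)
  then show ?case using Cons by simp
qed simp

text \<open>A left inverse of an element with a right inverse equals it. Adjoint circuits are
  identified this way instead of gate by gate.\<close>

lemma circ_lop_adj_eq: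
  assumes "wf_gates M gs" "V' * circ_lop gs = 1"
  shows "circ_lop_adj gs = V'"
  by (metis circ_lop_circ_lop_adj [OF assms(1)] assms(2) mult.assoc mult_1 mult_1_right)

text \<open>Every gate that the compiler adds to the gates of the algorithm has this form.\<close>

definition ctrl_gate :: "nat option \<Rightarrow> nat \<Rightarrow> complex \<Rightarrow> complex \<Rightarrow> gate" where
  "ctrl_gate co t p q = (case co of None \<Rightarrow> (flip_mat p q, [t]) | Some a \<Rightarrow> (ctrl (flip_mat p q), [a, t]))"

lemma emb_ctrl_gate:
  assumes "\<And>a. co = Some a \<Longrightarrow> a \<noteq> t"
  shows "emb (snd (ctrl_gate co t p q)) (fst (ctrl_gate co t p q)) = controlled (ctrl_proj co) (scalar p + scalar q * flipop t)"
  using assms by (cases co) (simp_all add: ctrl_gate_def ctrl_proj_def emb_flip_mat emb_ctrl controlled_def)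

lemma unitary_flip_mat:
  assumes "p * cnj p + q * cnj q = 1" "p * cnj q + q * cnj p = 0"
  shows "unitary 2 (flip_mat p q)"
  using assms
  by (auto simp: unitary_def mprod_def adj_def flip_mat_def idm_def numeral_2_eq_2 less_Suc_eq algebra_simps)

lemma is_gate_ctrl_gate:
  assumes "p * cnj p + q * cnj q = 1" "p * cnj q + q * cnj p = 0" "t < M"
    "\<And>a. co = Some a \<Longrightarrow> a \<noteq> t \<and> a < M"
  shows "is_gate M (ctrl_gate co t p q)"
  using assms unitary_flip_mat [OF assms(1,2)] unitary_ctrl [of 1 "flip_mat p q"]
  by (cases co) (auto simp: is_gate_def ctrl_gate_def numeral_2_eq_2)

text \<open>(1 + i)/2 and (1 - i)/2: the matrix \<open>half_plus\<close> I +
  \<open>half_minus\<close> X squares to X, and exchanging the two coefficients gives its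
  adjoint.\<close>

definition half_plus :: complex where "half_plus = Complex (1/2) (1/2)"
definition half_minus :: complex where "half_minus = Complex (1/2) (-1/2)"

text \<open>A Toffoli gate from controlled square roots of NOT (Barenco et al.), conjugated by a CNOT
  into a controlled swap.\<close>

definition fredkin :: "nat \<Rightarrow> nat \<Rightarrow> nat \<Rightarrow> gate list" where
  "fredkin c a b = [ctrl_gate (Some b) a 0 1, ctrl_gate (Some a) b half_plus half_minus, ctrl_gate (Some c) a 0 1, ctrl_gate (Some a) b half_minus half_plus,
     ctrl_gate (Some c) a 0 1, ctrl_gate (Some c) b half_plus half_minus, ctrl_gate (Some b) a 0 1]"

lemma wf_gates_fredkin:
  assumes "distinct [a, b, c]" "a < M" "b < M" "c < M"
  shows "wf_gates M (fredkin c a b)"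
  unfolding fredkin_def using assms
  by (auto intro!: is_gate_ctrl_gate simp: half_plus_def half_minus_def complex_eq_iff)

lemma ap_ctrl_gate:
  assumes "a \<noteq> t"
  shows "ap (emb (snd (ctrl_gate (Some a) t p q)) (fst (ctrl_gate (Some a) t p q))) g x
     = (if bit x a then p * g x + q * g (setb t (\<not> bit x t) x) else g x)"
  using emb_ctrl_gate [of "Some a" t p q] assms by (simp add: ctrl_proj_def controlled_def ap_flipop)

text \<open>Let a denote the bit after the first CNOT and V the square root of NOT. The powers of V
  applied to b are a, -(a xor c) and c, with sum 2ac, so b is flipped exactly when a and c are both
  set. The outer CNOTs turn this Toffoli gate into the controlled swap.\<close>

lemma circ_lop_fredkin:
  assumes "distinct [a, b, c]"
  shows "circ_lop (fredkin c a b) = controlled (proj1 c) (perm_op (sw a b))"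
proof (rule lop_eqI)
  fix g x
  have ne: "a \<noteq> b" "b \<noteq> a" "c \<noteq> a" "c \<noteq> b" "a \<noteq> c" "b \<noteq> c" using assms by auto
  have h: "half_plus * half_minus = 1/2" "half_minus * half_plus = 1/2" "half_plus * half_plus + half_minus * half_minus = 0" "half_minus * half_minus + half_plus * half_plus = 0" "half_plus + half_minus = 1"
    by (simp_all add: half_plus_def half_minus_def complex_eq_iff)
  have h': "half_plus * (half_plus * z) + half_minus * (half_minus * z) = 0" "half_minus * (half_minus * z) + half_plus * (half_plus * z) = 0"
    "half_plus * (half_minus * z) = z / 2" "half_minus * (half_plus * z) = z / 2" for z
    using h by (simp_all add: mult.assoc [symmetric] distrib_right [symmetric])
  have s: "setb b u (setb a v y) = setb a v (setb b u y)" for u v y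
    using ne by (simp add: setb_comm)
  have ss: "setb b u (setb a v (setb b w y)) = setb a v (setb b u y)" for u v w y
    using ne by (simp add: s)
  show "ap (circ_lop (fredkin c a b)) g x = ap (controlled (proj1 c) (perm_op (sw a b))) g x"
    by (cases "bit x a"; cases "bit x b"; cases "bit x c")
       (simp_all add: fredkin_def ap_ctrl_gate ne bit_setb controlled_def sw_def s ss h h' algebra_simps)
qed

fun fredkins :: "nat \<Rightarrow> nat list \<Rightarrow> nat list \<Rightarrow> gate list" where
  "fredkins c (s # ss) (b # bs) = fredkins c ss bs @ fredkin c s b"
| "fredkins c _ _ = []"

lemma length_fredkins: "length ss = length bs \<Longrightarrow> length (fredkins c ss bs) = 7 * length ss"
  by (induction ss bs rule: list_induct2) (simp_all add: fredkin_def)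

lemma wf_gates_fredkins:
  "length ss = length bs \<Longrightarrow> distinct (ss @ bs) \<Longrightarrow> set (ss @ bs) \<subseteq> {..<M} \<Longrightarrow> c \<notin> set (ss @ bs) \<Longrightarrow> c < M
    \<Longrightarrow> wf_gates M (fredkins c ss bs)"
  by (induction ss bs rule: list_induct2) (auto intro!: wf_gates_fredkin)

lemma circ_lop_fredkins:
  "length ss = length bs \<Longrightarrow> distinct (ss @ bs) \<Longrightarrow> c \<notin> set (ss @ bs)
    \<Longrightarrow> circ_lop (fredkins c ss bs) = controlled (proj1 c) (block_swap ss bs)"
proof (induction ss bs rule: list_induct2)
  case Nil
  have "swap_blocks [] [] = (\<lambda>x. x)" by auto
  then show ?case by (simp add: block_swap_def perm_op_id)
next
  case (Cons s ss b bs)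
  have 1: "proj1 c * perm_op (sw s b) = perm_op (sw s b) * proj1 c"
    using Cons.prems by (intro lop_eqI) (auto simp: sw_def bit_setb)
  have "circ_lop (fredkins c (s # ss) (b # bs)) = controlled (proj1 c) (perm_op (sw s b)) * controlled (proj1 c) (block_swap ss bs)"
    using Cons by (simp add: circ_lop_append circ_lop_fredkin)
  also have "\<dots> = controlled (proj1 c) (perm_op (sw s b) * block_swap ss bs)" by (rule controlled_mult [OF proj1_idem 1])
  also have "perm_op (sw s b) * block_swap ss bs = block_swap (s # ss) (b # bs)"
    by (rule lop_eqI) (simp add: block_swap_def)
  finally show ?case .
qed

text \<open>Later gates multiply from the left; appending the swap of the head at the end makes the
  operator a product in list order, matching \<open>chain\<close>.\<close>

fun swap_gates :: "nat \<Rightarrow> nat list \<Rightarrow> nat list list \<Rightarrow> gate list" where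
  "swap_gates c ss [] = []"
| "swap_gates c ss (b # bs) = swap_gates c ss bs @ fredkins c ss b"

lemma length_swap_gates: "\<forall>b\<in>set bs. length b = length ss \<Longrightarrow> length (swap_gates c ss bs) = 7 * length ss * length bs"
  by (induction bs) (simp_all add: length_fredkins)

text \<open>With \<open>W\<close> the controlled swaps with the blocks \<open>bs\<close>, the gates implement
  \<open>W\<^sup>-\<^sup>1 exp (i \<Delta> X\<^sub>c) W\<close>, where only the middle factor carries the control \<open>co\<close>.\<close>

definition gadget :: "nat option \<Rightarrow> nat \<Rightarrow> nat list \<Rightarrow> nat list list \<Rightarrow> real \<Rightarrow> gate list" where
  "gadget co c ss bs \<Delta> = swap_gates c ss bs @ [ctrl_gate co c (of_real (cos \<Delta>)) (\<i> * of_real (sin \<Delta>))] @ swap_gates c ss (rev bs)"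

lemma length_gadget:
  "\<forall>b\<in>set bs. length b = length ss \<Longrightarrow> length (gadget co c ss bs \<Delta>) = 14 * length ss * length bs + 1"
  by (simp add: gadget_def length_swap_gates)

lemma is_gate_rotation:
  assumes "c < M" "\<And>a. co = Some a \<Longrightarrow> a \<noteq> c \<and> a < M"
  shows "is_gate M (ctrl_gate co c (of_real (cos \<Delta>)) (\<i> * of_real (sin \<Delta>)))"
proof (rule is_gate_ctrl_gate [OF _ _ assms])
  have "complex_of_real (cos \<Delta> * cos \<Delta> + sin \<Delta> * sin \<Delta>) = 1"
    by (metis sin_cos_squared_add3 add.commute of_real_1)
  then show "complex_of_real (cos \<Delta>) * cnj (complex_of_real (cos \<Delta>)) + \<i> * complex_of_real (sin \<Delta>) * cnj (\<i> * complex_of_real (sin \<Delta>)) = 1"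
    by (simp add: complex_eq_iff)
qed (simp add: complex_eq_iff)

section \<open>Ideal rotations generated by functions of \<rho>\<close>

lemma fun_calc_add: "fun_calc d B (\<lambda>m. f m + g m) = (\<lambda>i j. fun_calc d B f i j + fun_calc d B g i j)"
  by (intro ext) (simp add: fun_calc_entry algebra_simps sum.distrib)

lemma fun_calc_diff: "fun_calc d B (\<lambda>m. f m - g m) = (\<lambda>i j. fun_calc d B f i j - fun_calc d B g i j)"
  by (intro ext) (simp add: fun_calc_entry algebra_simps sum_subtractf)

lemma fun_calc_scale: "fun_calc d B (\<lambda>m. c * f m) = (\<lambda>i j. c * fun_calc d B f i j)"
  by (intro ext) (simp add: fun_calc_entry sum_distrib_left mult_ac)

text \<open>\<open>rot B sys c \<theta> = exp (i X\<^sub>c \<theta>(\<rho>))\<close> for the operator \<open>\<rho>\<close> on the wires \<open>sys\<close> with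
  eigenbasis \<open>B\<close>, \<open>\<theta>\<close> being given on the indices of the eigenvalues.\<close>

definition rot_mat :: "nat \<Rightarrow> cmat \<Rightarrow> (nat \<Rightarrow> real) \<Rightarrow> cmat" where
  "rot_mat n B \<theta> = (\<lambda>i j. tensor n (fun_calc (2 ^ n) B (\<lambda>m. of_real (cos (\<theta> m)))) idm i j
     + \<i> * tensor n (fun_calc (2 ^ n) B (\<lambda>m. of_real (sin (\<theta> m)))) (flip_mat 0 1) i j)"

definition rot :: "cmat \<Rightarrow> nat list \<Rightarrow> nat \<Rightarrow> (nat \<Rightarrow> real) \<Rightarrow> lop" where
  "rot B sys c \<theta> = emb sys (fun_calc (2 ^ length sys) B (\<lambda>m. of_real (cos (\<theta> m))))
     + scalar \<i> * (emb sys (fun_calc (2 ^ length sys) B (\<lambda>m. of_real (sin (\<theta> m)))) * flipop c)"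

lemma emb_rot_mat: "distinct (sys @ [c]) \<Longrightarrow> emb (sys @ [c]) (rot_mat (length sys) B \<theta>) = rot B sys c \<theta>"
  unfolding rot_mat_def emb_add emb_scale by (simp only: emb_append emb_idm flipop_emb rot_def mult_1_right)

context
  fixes B :: cmat and sys :: "nat list" and c :: nat
  assumes B: "unitary (2 ^ length sys) B" and dsys: "distinct (sys @ [c])"
begin

abbreviation emb_calc :: "(nat \<Rightarrow> complex) \<Rightarrow> lop" where
  "emb_calc f \<equiv> emb sys (fun_calc (2 ^ length sys) B f)"

lemma emb_calc_mult: "emb_calc f * emb_calc g = emb_calc (\<lambda>m. f m * g m)"
  using dsys by (simp add: emb_mult emb_eqm [OF fun_calc_mult [OF B]])

lemma emb_calc_one: "emb_calc (\<lambda>_. 1) = 1"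
  by (simp add: emb_eqm [OF fun_calc_one [OF B]] emb_idm)

lemma emb_calc_flipop: "emb_calc f * flipop c = flipop c * emb_calc f"
  unfolding flipop_emb by (rule emb_comm) (use dsys in auto)

lemma rot_zero: "rot B sys c (\<lambda>_. 0) = 1"
proof -
  have "emb_calc (\<lambda>_. 0) = 0" by (rule lop_eqI) (simp add: ap_emb fun_calc_entry)
  then show ?thesis by (simp add: rot_def emb_calc_one)
qed

text \<open>The addition theorems of sine and cosine, with X^2 = 1 and a common eigenbasis. Angles
  add exactly, so splitting and recombining rotations causes no Trotter error.\<close>

lemma rot_add: "rot B sys c \<theta> * rot B sys c \<eta> = rot B sys c (\<lambda>m. \<theta> m + \<eta> m)"
proof -
  define C S C' S' where d: "C = emb_calc (\<lambda>m. of_real (cos (\<theta> m)))" "S = emb_calc (\<lambda>m. of_real (sin (\<theta> m)))"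
    "C' = emb_calc (\<lambda>m. of_real (cos (\<eta> m)))" "S' = emb_calc (\<lambda>m. of_real (sin (\<eta> m)))"
  have x: "flipop c * C' = C' * flipop c" "flipop c * S' = S' * flipop c" unfolding d by (simp_all add: emb_calc_flipop)
  have "rot B sys c \<theta> * rot B sys c \<eta> = (C + scalar \<i> * (S * flipop c)) * (C' + scalar \<i> * (S' * flipop c))"
    by (simp add: rot_def d)
  also have "\<dots> = C * C' + scalar \<i> * (C * S' * flipop c) + scalar \<i> * (S * (flipop c * C')) + scalar \<i> * (scalar \<i> * (S * (flipop c * S') * flipop c))"
    by (simp add: distrib_left distrib_right mult.assoc scalar_left_comm [of C] scalar_left_comm [of S] scalar_left_comm [of "flipop c"])
  also have "\<dots> = (C * C' - S * S') + scalar \<i> * ((C * S' + S * C') * flipop c)"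
    unfolding x
    by (simp add: scalar_mult_left distrib_left distrib_right mult.assoc flipop_flipop scalar_uminus [symmetric])
  also have "C * C' - S * S' = emb_calc (\<lambda>m. of_real (cos (\<theta> m + \<eta> m)))"
    unfolding d emb_calc_mult by (simp add: emb_minus [symmetric] fun_calc_diff [symmetric] cos_add)
  also have "C * S' + S * C' = emb_calc (\<lambda>m. of_real (sin (\<theta> m + \<eta> m)))"
    unfolding d emb_calc_mult by (simp add: emb_add [symmetric] fun_calc_add [symmetric] sin_add add.commute mult.commute)
  finally show ?thesis by (simp add: rot_def)
qed

lemma adj_rot_mat: "adj (rot_mat n B' \<theta>) = rot_mat n B' (\<lambda>m. - \<theta> m)"
proof -
  have a: "fun_calc d B' g i j = cnj (fun_calc d B' g j i)" if "\<And>m. cnj (g m) = g m" for g d i j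
  proof -
    have "cnj (fun_calc d B' g j i) = adj (fun_calc d B' g) i j" by (simp add: adj_def)
    then show ?thesis unfolding adj_fun_calc by (simp add: that)
  qed
  have s: "fun_calc (2 ^ n) B' (\<lambda>m. complex_of_real (sin (- \<theta> m))) = (\<lambda>i j. - fun_calc (2 ^ n) B' (\<lambda>m. complex_of_real (sin (\<theta> m))) i j)"
    using fun_calc_scale [of "2 ^ n" B' "-1" "\<lambda>m. complex_of_real (sin (\<theta> m))"] by simp
  show ?thesis
  proof (intro ext)
    fix i j
    show "adj (rot_mat n B' \<theta>) i j = rot_mat n B' (\<lambda>m. - \<theta> m) i j"
      using a [of "\<lambda>m. complex_of_real (cos (\<theta> m))" "2 ^ n" "i mod 2 ^ n" "j mod 2 ^ n"]
        a [of "\<lambda>m. complex_of_real (sin (\<theta> m))" "2 ^ n" "i mod 2 ^ n" "j mod 2 ^ n"]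
      unfolding rot_mat_def s by (simp add: adj_def tensor_def idm_def flip_mat_def)
  qed
qed

lemma unitary_rot_mat: "unitary (2 ^ length (sys @ [c])) (rot_mat (length sys) B \<theta>)"
  by (rule unitary_of_emb [OF dsys]) (simp_all add: adj_rot_mat emb_rot_mat [OF dsys] rot_add rot_zero)

lemma op_bound_rot:
  assumes "set (sys @ [c]) \<subseteq> {..<M}" "\<And>q. co = Some q \<Longrightarrow> q \<notin> set (sys @ [c]) \<and> q < M"
  shows "op_bound (2 ^ M) (controlled (ctrl_proj co) (rot B sys c \<theta>)) 1"
  unfolding emb_rot_mat [OF dsys, symmetric] by (rule op_bound_controlled_emb [OF unitary_rot_mat dsys assms])

lemma op_bound_emb_calc:
  assumes "set sys \<subseteq> {..<M}" "\<And>m. m < 2 ^ length sys \<Longrightarrow> cmod (f m) \<le> r" "0 \<le> r"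
  shows "op_bound (2 ^ M) (emb_calc f) r"
  by (rule op_bound_emb [OF mat_bound_fun_calc [OF B assms(2,3)] assms(3) _ assms(1)]) (use dsys in auto)

lemma op_bound_flipop: "c < M \<Longrightarrow> op_bound (2 ^ M) (flipop c) 1"
  unfolding flipop_emb by (intro op_bound_emb mat_bound_unitary) (auto intro: unitary_flip_mat)

text \<open>Sine and cosine are 1-Lipschitz; the cosine part and the sine part contribute r
  each.\<close>

lemma op_bound_rot_diff:
  assumes "set (sys @ [c]) \<subseteq> {..<M}" "\<And>m. m < 2 ^ length sys \<Longrightarrow> \<bar>\<theta> m - \<eta> m\<bar> \<le> r" "0 \<le> r"
  shows "op_bound (2 ^ M) (controlled (ctrl_proj co) (rot B sys c \<theta>) - controlled (ctrl_proj co) (rot B sys c \<eta>)) (2 * r)"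
proof -
  have eq: "controlled (ctrl_proj co) (rot B sys c \<theta>) - controlled (ctrl_proj co) (rot B sys c \<eta>)
     = ctrl_proj co * (emb_calc (\<lambda>m. of_real (cos (\<theta> m)) - of_real (cos (\<eta> m))) + scalar \<i> * (emb_calc (\<lambda>m. of_real (sin (\<theta> m)) - of_real (sin (\<eta> m))) * flipop c))"
    unfolding fun_calc_diff emb_minus by (simp add: controlled_def rot_def algebra_simps)
  have cs: "\<bar>cos a - cos b\<bar> \<le> \<bar>a - b\<bar>" "\<bar>sin a - sin b\<bar> \<le> \<bar>a - b\<bar>" for a b :: real
  proof -
    have "\<bar>sin ((a + b) / 2)\<bar> * \<bar>sin ((b - a) / 2)\<bar> \<le> 1 * (\<bar>b - a\<bar> / 2)"
      using abs_sin_x_le_abs_x [of "(b - a) / 2"] by (intro mult_mono) auto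
    then show "\<bar>cos a - cos b\<bar> \<le> \<bar>a - b\<bar>" by (simp add: cos_diff_cos abs_mult)
    have "\<bar>sin ((a - b) / 2)\<bar> * \<bar>cos ((a + b) / 2)\<bar> \<le> (\<bar>a - b\<bar> / 2) * 1"
      using abs_sin_x_le_abs_x [of "(a - b) / 2"] by (intro mult_mono) auto
    then show "\<bar>sin a - sin b\<bar> \<le> \<bar>a - b\<bar>" by (simp add: sin_diff_sin abs_mult)
  qed
  have "op_bound (2 ^ M) (ctrl_proj co * (emb_calc (\<lambda>m. of_real (cos (\<theta> m)) - of_real (cos (\<eta> m))) + scalar \<i> * (emb_calc (\<lambda>m. of_real (sin (\<theta> m)) - of_real (sin (\<eta> m))) * flipop c)))
       (1 * (r + cmod \<i> * (r * 1)))"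
  proof (intro op_bound_mult op_bound_add op_bound_ctrl_proj op_bound_scalar op_bound_emb_calc op_bound_flipop assms(3))
    fix m :: nat assume m: "m < 2 ^ length sys"
    show "cmod (complex_of_real (cos (\<theta> m)) - complex_of_real (cos (\<eta> m))) \<le> r"
      "cmod (complex_of_real (sin (\<theta> m)) - complex_of_real (sin (\<eta> m))) \<le> r"
      unfolding of_real_diff [symmetric] norm_of_real
      using cs [of "\<theta> m" "\<eta> m"] assms(2) [OF m] by linarith+
  qed (use assms in auto)
  then show ?thesis unfolding eq by simp
qed

end

section \<open>Samplizing one query\<close>

text \<open>An entry (k, \<Delta>) of the schedule stands for a gadget with k samples, approximating
  the angle \<Delta> \<rho>^k. The argument \<beta> is the first sample block not yet
  consumed.\<close>

fun rotation_gates :: "nat option \<Rightarrow> nat \<Rightarrow> nat list \<Rightarrow> (nat \<Rightarrow> nat list) \<Rightarrow> nat \<Rightarrow> (nat \<times> real) list \<Rightarrow> gate list" where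
  "rotation_gates co c ss bf \<beta> [] = []"
| "rotation_gates co c ss bf \<beta> ((k, \<Delta>) # ks) = gadget co c ss (map bf [\<beta>..<\<beta> + k]) \<Delta> @ rotation_gates co c ss bf (\<beta> + k) ks"

text \<open>The last gate is -i \<sigma> X. With \<sigma> = 1 it completes -iX exp(i X \<theta>);
  with \<sigma> = -1 and negated angles it gives the adjoint, because X commutes with the
  rotation.\<close>

definition query_circ :: "nat option \<Rightarrow> nat \<Rightarrow> nat list \<Rightarrow> (nat \<Rightarrow> nat list) \<Rightarrow> complex \<Rightarrow> nat \<Rightarrow> (nat \<times> real) list \<Rightarrow> gate list" where
  "query_circ co c ss bf \<sigma> \<beta> ks = rotation_gates co c ss bf \<beta> ks @ [ctrl_gate co c 0 (- \<i> * \<sigma>)]"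

definition total_samples :: "(nat \<times> real) list \<Rightarrow> nat" where
  "total_samples ks = (\<Sum>p\<leftarrow>ks. fst p)"

definition angle :: "(nat \<times> real) list \<Rightarrow> (nat \<Rightarrow> real) \<Rightarrow> nat \<Rightarrow> real" where
  "angle ks l m = (\<Sum>p\<leftarrow>ks. snd p * l m ^ fst p)"

lemma length_rotation_gates:
  "(\<And>b. length (bf b) = length ss) \<Longrightarrow> length (rotation_gates co c ss bf \<beta> ks) = 14 * length ss * total_samples ks + length ks"
  by (induction ks arbitrary: \<beta> rule: list.induct)
     (auto simp: length_gadget total_samples_def algebra_simps)

lemma cos_minus_one_bound: "\<bar>cos x - 1\<bar> \<le> x\<^sup>2 / 2" for x :: real
proof -
  have "\<bar>cos x - 1\<bar> = 2 * (sin (x / 2))\<^sup>2"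
    using cos_double_sin [of "x / 2"] by simp
  also have "(sin (x / 2))\<^sup>2 \<le> (x / 2)\<^sup>2"
    using abs_sin_x_le_abs_x [of "x / 2"] by (simp only: abs_le_square_iff)
  finally show ?thesis by (simp add: power2_eq_square)
qed

text \<open>The Maclaurin remainder of order two; a cubic bound would not help, since the cosine
  remainder is quadratic.\<close>

lemma sin_minus_self_bound: "\<bar>sin x - x\<bar> \<le> x\<^sup>2 / 2" for x :: real
  using Maclaurin_sin_bound [of x 2]
  by (simp add: sin_coeff_def numeral_2_eq_2 fact_numeral)

context sampling
begin

context
  fixes sys :: "nat list" and c :: nat and co :: "nat option" and B :: cmat and \<rho> :: cmat and l :: "nat \<Rightarrow> real"
  assumes sys: "length sys = n" "distinct (sys @ [c])" "set (sys @ [c]) \<subseteq> {..<N}"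
    and co: "\<And>q. co = Some q \<Longrightarrow> q \<notin> set (sys @ [c]) \<and> q < N"
    and B: "unitary (2 ^ n) B" and \<rho>: "eqm (2 ^ n) \<rho> (fun_calc (2 ^ n) B (\<lambda>m. complex_of_real (l m)))"
    and l: "\<And>m. m < 2 ^ n \<Longrightarrow> 0 \<le> l m" "\<And>m. m < 2 ^ n \<Longrightarrow> l m \<le> 1"
begin

lemma sys': "length sys = n" "distinct sys" "set sys \<subseteq> {..<N}" "c \<notin> set sys" "c < N"
  using sys by auto

lemma B': "unitary (2 ^ length sys) B" using B sys by simp

abbreviation ctrl_rot :: "(nat \<Rightarrow> real) \<Rightarrow> lop" where "ctrl_rot \<theta> \<equiv> controlled (ctrl_proj co) (rot B sys c \<theta>)"

lemma rho_power: "emb sys \<rho> ^ k = emb_calc B sys (\<lambda>m. complex_of_real (l m ^ k))"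
proof (induction k)
  case 0
  then show ?case using emb_calc_one [OF B' sys(2)] by simp
next
  case (Suc k)
  have "emb sys \<rho> = emb_calc B sys (\<lambda>m. complex_of_real (l m))" using \<rho> sys by (intro emb_eqm) simp
  then show ?case using Suc by (simp add: emb_calc_mult [OF B' sys(2)])
qed

lemma ctrl_proj_emb: "set ws \<subseteq> set (sys @ [c]) \<Longrightarrow> ctrl_proj co * emb ws A = emb ws A * ctrl_proj co"
  using co by (intro ctrl_proj_emb_comm) auto

lemma ctrl_proj_proj1: "ctrl_proj co * proj1 c = proj1 c * ctrl_proj co"
  by (cases co) (simp_all add: ctrl_proj_def proj1_proj1_comm)

lemma ctrl_proj_flipop: "ctrl_proj co * flipop c = flipop c * ctrl_proj co"
  unfolding flipop_emb by (rule ctrl_proj_emb) simp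

lemma ctrl_proj_chain: "set bs \<subseteq> {..<BL} \<Longrightarrow> ctrl_proj co * chain sys bs = chain sys bs * ctrl_proj co"
  using co chain_proj1_comm [OF sys'(1-3)] by (cases co) (auto simp: ctrl_proj_def)

lemma ctrl_proj_rot: "ctrl_proj co * rot B sys c \<theta> = rot B sys c \<theta> * ctrl_proj co"
  using ctrl_proj_emb [of "sys @ [c]"] by (simp add: emb_rot_mat [OF sys(2), symmetric])

lemma ctrl_rot_mult: "ctrl_rot \<theta> * ctrl_rot \<eta> = ctrl_rot (\<lambda>m. \<theta> m + \<eta> m)"
  by (simp add: controlled_mult ctrl_proj_idem ctrl_proj_rot rot_add [OF B' sys(2)])

lemma op_bounded_ctrl_rot: "op_bounded (ctrl_rot \<theta>) 1"
  using sys co N_le by (intro op_bound_rot [OF B' sys(2)]) force+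

lemma free_proj1: "q < N \<Longrightarrow> bs \<subseteq> {..<BL} \<Longrightarrow> free bs (proj1 q)"
  using bw_wires unfolding free_def by (intro ballI commutes_proj1) fastforce

lemma free_ctrl_proj: "bs \<subseteq> {..<BL} \<Longrightarrow> free bs (ctrl_proj co)"
  using co free_proj1 free_one by (cases co) (auto simp: ctrl_proj_def)

lemma free_controlled: "free bs Q \<Longrightarrow> free bs A \<Longrightarrow> free bs (controlled Q A)"
  by (simp add: free_def commutes_controlled)

lemma free_flipop: "bs \<subseteq> {..<BL} \<Longrightarrow> free bs (flipop c)"
  unfolding flipop_emb using sys by (intro free_emb) auto

lemma free_rot: "bs \<subseteq> {..<BL} \<Longrightarrow> free bs (rot B sys c \<theta>)"
  unfolding emb_rot_mat [OF sys(2), symmetric] using sys by (intro free_emb) auto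

lemma free_ctrl_rot: "bs \<subseteq> {..<BL} \<Longrightarrow> free bs (ctrl_rot \<theta>)"
  by (intro free_controlled free_ctrl_proj free_rot)

lemma free_chain: "set bs \<subseteq> {..<BL} \<Longrightarrow> free ({..<BL} - set bs) (chain sys bs)"
  unfolding free_def
proof
  fix b assume a: "set bs \<subseteq> {..<BL}" "b \<in> {..<BL} - set bs"
  show "commutes (block b) (chain sys bs)"
  proof (rule chain_commutes [OF sys'(1-3) a(1)])
    show "set (block b) \<inter> set sys = {}" using a bw_wires [of b] sys by auto
    show "set (block b) \<inter> set (block b') = {}" if "b' \<in> set bs" for b'
      using a that by (intro bw_disjoint) auto
  qed
qed

lemma circ_lop_swap_gates:
  assumes "set bs \<subseteq> {..<BL}"
  shows "circ_lop (swap_gates c sys (map block bs)) = controlled (proj1 c) (chain sys bs)"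
  using assms
proof (induction bs)
  case (Cons b bs)
  have b: "length sys = length (block b)" "distinct (sys @ block b)" "c \<notin> set (sys @ block b)"
    using Cons.prems sys bw_wires [of b] by auto
  have 1: "proj1 c * block_swap sys (block b) = block_swap sys (block b) * proj1 c" using b by (intro proj1_block_swap_comm) auto
  have "circ_lop (swap_gates c sys (map block (b # bs))) = controlled (proj1 c) (block_swap sys (block b)) * controlled (proj1 c) (chain sys bs)"
    using Cons b by (simp add: circ_lop_append circ_lop_fredkins)
  then show ?case by (simp add: controlled_mult proj1_idem 1)
qed simp

lemma wf_gates_swap_gates:
  assumes "set bs \<subseteq> {..<BL}"
  shows "wf_gates Mw (swap_gates c sys (map block bs))"
  using assms
proof (induction bs)
  case (Cons b bs)
  have "wf_gates Mw (fredkins c sys (block b))"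
    using Cons.prems sys bw_wires [of b] N_le by (intro wf_gates_fredkins) force+
  then show ?case using Cons by simp
qed simp

lemma wf_gates_gadget:
  assumes "set bs \<subseteq> {..<BL}"
  shows "wf_gates Mw (gadget co c sys (map block bs) \<Delta>)"
proof -
  have "is_gate Mw (ctrl_gate co c (complex_of_real (cos \<Delta>)) (\<i> * complex_of_real (sin \<Delta>)))"
    using sys co N_le by (intro is_gate_rotation) force+
  then show ?thesis using wf_gates_swap_gates [OF assms] wf_gates_swap_gates [of "rev bs"] assms by (simp add: gadget_def rev_map)
qed

text \<open>The swaps turn \<open>X\<^sub>c\<close> into \<open>|0><1| C + |1><0| C\<^sup>-\<^sup>1\<close>, and tracing out the samples turns
  both \<open>C\<close> and \<open>C\<^sup>-\<^sup>1\<close> into \<open>\<rho>\<^sup>k\<close>.\<close>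

lemma phi_conjugated_flipop:
  assumes bs: "set bs \<subseteq> {..<BL}" "distinct bs" "\<And>b. b \<in> set bs \<Longrightarrow> \<tau> b = \<rho>"
    and ZL: "free (set bs) Z" "free (set bs) L"
  defines "S \<equiv> controlled (proj1 c) (chain sys (rev bs)) * flipop c * controlled (proj1 c) (chain sys bs)"
  shows "\<phi> (Z * S * L) = \<phi> (Z * (flipop c * emb sys \<rho> ^ length bs) * L)"
proof -
  let ?p = "proj1 c" and ?x = "flipop c" and ?C = "chain sys bs" and ?D = "chain sys (rev bs)" and ?r = "emb sys \<rho> ^ length bs"
  have rb: "set (rev bs) \<subseteq> {..<BL}" using bs by simp
  have pD: "?p * ?D = ?D * ?p" by (rule chain_proj1_comm [OF sys'(1-3) rb sys'(5,4)])
  have xp: "?x * ?p = (1 - ?p) * ?x" by (rule flipop_proj1)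
  have xq: "?x * (1 - ?p) = ?p * ?x" using flipop_proj1 [of c] by (simp add: algebra_simps)
  have z: "(1 - ?p) * ?p = 0" "?p * (1 - ?p) = 0" using proj1_idem [of c] by (simp_all add: algebra_simps)
  have W: "controlled ?p A = (1 - ?p) + ?p * A" for A by (simp add: controlled_def algebra_simps)
  \<comment> \<open>Four blocks according to the value of the wire c before and after the flip. The
    two diagonal blocks vanish because X changes that value.\<close>
  have "S = (1 - ?p) * (?x * (1 - ?p)) + (1 - ?p) * (?x * ?p) * ?C + ?p * ?D * (?x * (1 - ?p)) + ?p * ?D * (?x * ?p) * ?C"
    unfolding S_def W by (simp only: distrib_left distrib_right mult.assoc add_ac)
  also have "(1 - ?p) * (?x * (1 - ?p)) = 0" unfolding xq mult.assoc [symmetric] z by simp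
  also have "(1 - ?p) * (?x * ?p) = (1 - ?p) * ?x"
    unfolding xp mult.assoc [symmetric] using proj1_idem [of c] by (simp add: algebra_simps)
  also have "?p * ?D * (?x * (1 - ?p)) = ?p * ?D * ?x"
    unfolding xq by (simp add: pD mult.assoc) (simp add: mult.assoc [symmetric] proj1_idem)
  also have "?p * ?D * (?x * ?p) * ?C = 0"
  proof -
    have "?p * ?D * (?x * ?p) = ?D * (?p * (1 - ?p)) * ?x" unfolding xp pD by (simp add: mult.assoc)
    then show ?thesis unfolding z by simp
  qed
  finally have S: "S = (1 - ?p) * ?x * ?C + ?p * ?D * ?x" by simp
  have fr: "free (set bs) ?p" "free (set bs) ?x" "free (set bs) (1 - ?p)"
    using free_proj1 [OF sys'(5) bs(1)] free_flipop [OF bs(1)] by (auto simp: free_def commutes_minus commutes_one)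
  have "\<phi> (Z * S * L) = \<phi> ((Z * (1 - ?p) * ?x) * ?C * L) + \<phi> ((Z * ?p) * ?D * (?x * L))"
    unfolding S by (simp add: phi_add [symmetric] distrib_left distrib_right mult.assoc)
  also have "\<phi> ((Z * (1 - ?p) * ?x) * ?C * L) = \<phi> ((Z * (1 - ?p) * ?x) * ?r * L)"
    by (intro phi_chain [OF sys'(1-3) bs] free_mult ZL fr)
  \<comment> \<open>The reversed chain also yields a power of \<rho>, because all blocks in
    \<open>bs\<close> carry the same state.\<close>
  also have "\<phi> ((Z * ?p) * ?D * (?x * L)) = \<phi> ((Z * ?p) * emb sys \<rho> ^ length (rev bs) * (?x * L))"
    using bs ZL fr by (intro phi_chain [OF sys'(1-3) rb]) (auto intro: free_mult)
  also have "\<phi> ((Z * ?p) * emb sys \<rho> ^ length (rev bs) * (?x * L)) = \<phi> (Z * ?p * ?x * ?r * L)"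
    unfolding rho_power using emb_calc_flipop [OF B' sys(2), of "\<lambda>m. complex_of_real (l m ^ length bs)"]
    by (simp add: mult.assoc) (simp add: mult.assoc [symmetric])
  also have "\<phi> ((Z * (1 - ?p) * ?x) * ?r * L) + \<phi> (Z * ?p * ?x * ?r * L) = \<phi> (Z * (?x * ?r) * L)"
    by (simp add: phi_add [symmetric] algebra_simps)
  finally show ?thesis .
qed

text \<open>V(t) = W^-1 exp(i t X) W is a one-parameter group, which identifies the adjoint circuit
  as V(-\<Delta>). To first order in \<Delta> it contributes the conjugated flip and the ideal
  rotation contributes X \<rho>^k; under \<phi> these agree by \<open>phi_conjugated_flipop\<close>,
  so \<open>apx_first_order\<close> applies. The control commutes with W, which is why the swaps
  need not be controlled by it.\<close>

lemma gadget_apx: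
  assumes bs: "set bs \<subseteq> {..<BL}" "distinct bs" "\<And>b. b \<in> set bs \<Longrightarrow> \<tau> b = \<rho>" and \<Delta>: "\<bar>\<Delta>\<bar> \<le> 1"
  defines "gs \<equiv> gadget co c sys (map block bs) \<Delta>"
  shows "apx (set bs) (circ_lop gs) (circ_lop_adj gs) (ctrl_rot (\<lambda>m. \<Delta> * l m ^ length bs)) (ctrl_rot (\<lambda>m. - (\<Delta> * l m ^ length bs))) (8 * \<Delta>\<^sup>2)"
proof -
  let ?Q = "ctrl_proj co" and ?k = "length bs"
  have rb: "set (rev bs) \<subseteq> {..<BL}" using bs by simp
  define W where "W = controlled (proj1 c) (chain sys bs)"
  define Wi where "Wi = controlled (proj1 c) (chain sys (rev bs))"
  define R where "R = (\<lambda>t. scalar (complex_of_real (cos t)) + scalar (\<i> * complex_of_real (sin t)) * flipop c)"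
  define V where "V = (\<lambda>t. Wi * controlled ?Q (R t) * W)"
  define S where "S = Wi * flipop c * W"
  have Wg: "circ_lop (swap_gates c sys (map block bs)) = W" "circ_lop (swap_gates c sys (map block (rev bs))) = Wi"
    using circ_lop_swap_gates [OF bs(1)] circ_lop_swap_gates [OF rb] by (simp_all add: W_def Wi_def)
  have pc: "proj1 c * chain sys bs = chain sys bs * proj1 c" "proj1 c * chain sys (rev bs) = chain sys (rev bs) * proj1 c"
    using chain_proj1_comm [OF sys'(1-3) bs(1) sys'(5,4)] chain_proj1_comm [OF sys'(1-3) rb sys'(5,4)] by auto
  have WW: "Wi * W = 1" "W * Wi = 1"
    unfolding W_def Wi_def
    by (simp_all add: controlled_mult proj1_idem pc chain_inv [OF sys'(1-3) bs(1)] chain_inv' [OF sys'(1-3) bs(1)])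
  have QWi: "Wi * ?Q = ?Q * Wi"
    unfolding Wi_def using controlled_comm [OF ctrl_proj_proj1 ctrl_proj_chain [OF rb]] by simp
  have QX: "?Q * R t = R t * ?Q" for t
    unfolding R_def by (simp add: distrib_left distrib_right scalar_comm scalar_left_comm [of ?Q] ctrl_proj_flipop mult.assoc)
  have RR: "R s * R t = R (s + t)" for s t
  proof -
    have "R s * R t = scalar (cos s) * scalar (cos t) + scalar (cos s) * (scalar (\<i> * sin t) * flipop c)
       + scalar (\<i> * sin s) * (flipop c * scalar (cos t)) + scalar (\<i> * sin s) * (flipop c * (scalar (\<i> * sin t) * flipop c))"
      by (simp add: R_def distrib_left distrib_right mult.assoc)
    also have "\<dots> = scalar (cos s * cos t - sin s * sin t) + scalar (\<i> * (sin s * cos t + cos s * sin t)) * flipop c"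
      by (rule lop_eqI) (simp add: ap_scale ap_flipop bit_setb algebra_simps)
    finally show ?thesis by (simp add: R_def cos_add sin_add)
  qed
  have R0: "R 0 = 1" by (simp add: R_def)
  have VV: "V s * V t = V (s + t)" for s t
  proof -
    have "V s * V t = Wi * controlled ?Q (R s) * (W * Wi) * controlled ?Q (R t) * W" by (simp add: V_def mult.assoc)
    also have "\<dots> = Wi * (controlled ?Q (R s) * controlled ?Q (R t)) * W" by (simp add: WW mult.assoc)
    also have "\<dots> = V (s + t)" by (simp add: controlled_mult ctrl_proj_idem QX RR V_def)
    finally show ?thesis .
  qed
  have V0: "V 0 = 1" by (simp add: V_def R0 WW)
  have wf: "wf_gates Mw gs" unfolding gs_def by (rule wf_gates_gadget [OF bs(1)])
  have cop: "circ_lop gs = V \<Delta>"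
    using emb_ctrl_gate [of co c] co Wg
    by (auto simp: gs_def gadget_def circ_lop_append rev_map V_def R_def mult.assoc)
  have cadj: "circ_lop_adj gs = V (- \<Delta>)"
    using circ_lop_adj_eq [OF wf, of "V (- \<Delta>)"] unfolding cop VV by (simp add: V0)
  have Vt: "V t = 1 + ?Q * (scalar (complex_of_real (cos t) - 1) + scalar (\<i> * complex_of_real (sin t)) * S)" for t
  proof -
    have Wsc: "Wi * (scalar a * Y) = scalar a * (Wi * Y)" "Wi * scalar a = scalar a * Wi" for a Y
      by (rule scalar_left_comm, rule scalar_comm)
    have QQ: "Wi * (?Q * Y) = ?Q * (Wi * Y)" for Y using QWi by (metis mult.assoc)
    have "V t = Wi * W + Wi * (?Q * ((R t - 1) * W))"
      by (simp add: V_def controlled_def distrib_left distrib_right mult.assoc)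
    also have "R t - 1 = scalar (complex_of_real (cos t) - 1) + scalar (\<i> * complex_of_real (sin t)) * flipop c"
      using scalar_diff [of _ 1] by (simp add: R_def)
    also have "Wi * (?Q * ((scalar (complex_of_real (cos t) - 1) + scalar (\<i> * complex_of_real (sin t)) * flipop c) * W))
       = ?Q * (scalar (complex_of_real (cos t) - 1) * (Wi * W) + scalar (\<i> * complex_of_real (sin t)) * S)"
      unfolding QQ by (simp add: S_def distrib_left distrib_right mult.assoc Wsc)
    finally show ?thesis by (simp add: WW)
  qed
  define H where "H = flipop c * emb sys \<rho> ^ ?k"
  define \<theta> where "\<theta> = (\<lambda>m. \<Delta> * l m ^ ?k)"
  define A where "A = scalar (\<i> * complex_of_real \<Delta>) * (?Q * S)"
  define Bo where "Bo = scalar (\<i> * complex_of_real \<Delta>) * (?Q * H)"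
  define e where "e = (\<lambda>s. ?Q * (scalar (complex_of_real (cos \<Delta> - 1)) + scalar (s * \<i> * complex_of_real (sin \<Delta> - \<Delta>)) * S))"
  define f where "f = (\<lambda>s. ?Q * (emb_calc B sys (\<lambda>m. complex_of_real (cos (\<theta> m) - 1))
      + scalar (s * \<i>) * (emb_calc B sys (\<lambda>m. complex_of_real (sin (\<theta> m) - \<theta> m)) * flipop c)))"
  have Qsc: "?Q * (scalar a * Y) = scalar a * (?Q * Y)" for a Y by (rule scalar_left_comm)
  have Vs: "V \<Delta> = 1 + A + e 1" "V (- \<Delta>) = 1 - A + e (-1)"
  proof -
    have a1: "scalar (\<i> * complex_of_real (sin \<Delta>)) = scalar (\<i> * complex_of_real \<Delta>) + scalar (1 * \<i> * complex_of_real (sin \<Delta> - \<Delta>))"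
      by (simp add: scalar_add algebra_simps)
    have a2: "scalar (\<i> * complex_of_real (sin (- \<Delta>))) = - scalar (\<i> * complex_of_real \<Delta>) + scalar (- 1 * \<i> * complex_of_real (sin \<Delta> - \<Delta>))"
      by (simp add: scalar_add scalar_uminus algebra_simps)
    have a3: "complex_of_real (cos t) - 1 = complex_of_real (cos t - 1)" for t by simp
    have g: "1 + ?Q * (c0 + (s1 + s2) * S) = 1 + ?Q * (s1 * S) + ?Q * (c0 + s2 * S)"
      "1 + ?Q * (c0 + (- s1 + s2) * S) = 1 - ?Q * (s1 * S) + ?Q * (c0 + s2 * S)" for c0 s1 s2
      by (simp_all add: algebra_simps)
    show "V \<Delta> = 1 + A + e 1" unfolding Vt a1 a3 A_def e_def Qsc [symmetric] g(1) ..
    show "V (- \<Delta>) = 1 - A + e (-1)" unfolding Vt a2 a3 A_def e_def Qsc [symmetric] g(2) cos_minus ..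
  qed
  have Hef: "H = emb_calc B sys (\<lambda>m. complex_of_real (l m ^ ?k)) * flipop c"
    unfolding H_def rho_power emb_calc_flipop [OF B' sys(2)] ..
  have Bo: "Bo = ?Q * (scalar \<i> * (emb_calc B sys (\<lambda>m. complex_of_real (\<theta> m)) * flipop c))"
  proof -
    have "emb_calc B sys (\<lambda>m. complex_of_real (\<theta> m)) = scalar (complex_of_real \<Delta>) * emb_calc B sys (\<lambda>m. complex_of_real (l m ^ ?k))"
      by (simp add: \<theta>_def fun_calc_scale emb_scale)
    then show ?thesis unfolding Bo_def Hef by (simp add: Qsc scalar_mult_left mult.assoc)
  qed
  have RTs: "ctrl_rot \<theta> = 1 + Bo + f 1" "ctrl_rot (\<lambda>m. - \<theta> m) = 1 - Bo + f (-1)"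
  proof -
    have 1: "emb_calc B sys (\<lambda>m. complex_of_real (cos (\<theta> m) - 1)) = emb_calc B sys (\<lambda>m. complex_of_real (cos (\<theta> m))) - 1"
      unfolding of_real_diff fun_calc_diff emb_minus by (simp add: emb_calc_one [OF B' sys(2)])
    have 2: "emb_calc B sys (\<lambda>m. complex_of_real (sin (\<theta> m) - \<theta> m)) = emb_calc B sys (\<lambda>m. complex_of_real (sin (\<theta> m))) - emb_calc B sys (\<lambda>m. complex_of_real (\<theta> m))"
      unfolding of_real_diff fun_calc_diff emb_minus ..
    have 3: "emb_calc B sys (\<lambda>m. complex_of_real (sin (- \<theta> m))) = scalar (- 1) * emb_calc B sys (\<lambda>m. complex_of_real (sin (\<theta> m)))"
      unfolding emb_scale [symmetric] fun_calc_scale [symmetric] by simp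
    show "ctrl_rot \<theta> = 1 + Bo + f 1"
      unfolding Bo f_def 1 2 controlled_def rot_def by (simp add: algebra_simps)
    have r: "rot B sys c (\<lambda>m. - \<theta> m) = emb_calc B sys (\<lambda>m. complex_of_real (cos (\<theta> m)))
        - scalar \<i> * (emb_calc B sys (\<lambda>m. complex_of_real (sin (\<theta> m))) * flipop c)"
      unfolding rot_def 3 by (simp add: scalar_uminus [symmetric])
    show "ctrl_rot (\<lambda>m. - \<theta> m) = 1 - Bo + f (-1)"
      unfolding Bo f_def 1 2 controlled_def r by (simp add: algebra_simps scalar_uminus [symmetric])
  qed
  have cMw: "c < Mw" "set sys \<subseteq> {..<Mw}" using sys' N_le by auto
  have nW: "op_bounded W 1" "op_bounded Wi 1" unfolding Wg [symmetric] using wf_gates_swap_gates [OF bs(1)] wf_gates_swap_gates [OF rb] by (auto intro: op_bound_circ_lop)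
  have nX: "op_bounded (flipop c) 1" by (rule op_bound_flipop [OF B' sys(2) cMw(1)])
  have nS: "op_bounded S 1" unfolding S_def by (intro op_bounded_mult1 nW nX)
  have l1: "\<bar>l m ^ k\<bar> \<le> 1" if "m < 2 ^ n" for m k
    using l [OF that] by (simp add: power_le_one)
  have nEf: "op_bounded (emb_calc B sys g) r" if "\<And>m. m < 2 ^ n \<Longrightarrow> cmod (g m) \<le> r" "0 \<le> r" for g r
    using that sys by (intro op_bound_emb_calc [OF B' sys(2) cMw(2)]) auto
  have nH: "op_bounded H 1" unfolding Hef
    by (intro op_bounded_mult1 nX nEf) (use l1 in \<open>auto simp: norm_power simp del: of_real_power\<close>)
  have nAB: "op_bounded A \<bar>\<Delta>\<bar>" "op_bounded Bo \<bar>\<Delta>\<bar>"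
    using op_bound_mult [OF op_bound_scalar [of _ "\<i> * complex_of_real \<Delta>"] op_bounded_mult1 [OF op_bound_ctrl_proj nS]]
      op_bound_mult [OF op_bound_scalar [of _ "\<i> * complex_of_real \<Delta>"] op_bounded_mult1 [OF op_bound_ctrl_proj nH]]
    by (simp_all add: A_def Bo_def norm_mult)
  \<comment> \<open>The remainders of cosine and sine are at most \<Delta>^2/2 each. The sign s
    distinguishes V from its inverse.\<close>
  have ne: "op_bounded (e s) (\<Delta>\<^sup>2)" if "cmod s = 1" for s
  proof -
    have "op_bounded (e s) (1 * (cmod (complex_of_real (cos \<Delta> - 1)) + cmod (s * \<i> * complex_of_real (sin \<Delta> - \<Delta>)) * 1))"
      unfolding e_def by (intro op_bound_mult op_bound_ctrl_proj op_bound_add op_bound_scalar nS)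
    then show ?thesis
      by (rule op_bound_mono)
         (use cos_minus_one_bound [of \<Delta>] sin_minus_self_bound [of \<Delta>] that
          in \<open>simp only: norm_mult norm_of_real norm_ii mult_1_left mult_1_right\<close>)
  qed
  have nf: "op_bounded (f s) (\<Delta>\<^sup>2)" if "cmod s = 1" for s
  proof -
    have th: "(\<theta> m)\<^sup>2 / 2 \<le> \<Delta>\<^sup>2 / 2" if "m < 2 ^ n" for m
    proof -
      have "\<bar>\<theta> m\<bar> \<le> \<bar>\<Delta>\<bar> * 1" unfolding \<theta>_def abs_mult by (intro mult_left_mono l1 that) auto
      then show ?thesis by (simp add: abs_le_square_iff)
    qed
    have "op_bounded (f s) (1 * (\<Delta>\<^sup>2 / 2 + cmod (s * \<i>) * (\<Delta>\<^sup>2 / 2 * 1)))"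
      unfolding f_def
    proof (intro op_bound_mult op_bound_ctrl_proj op_bound_add op_bound_scalar nX nEf)
      fix m :: nat assume m: "m < 2 ^ n"
      show "cmod (complex_of_real (cos (\<theta> m) - 1)) \<le> \<Delta>\<^sup>2 / 2" "cmod (complex_of_real (sin (\<theta> m) - \<theta> m)) \<le> \<Delta>\<^sup>2 / 2"
        unfolding norm_of_real
        using cos_minus_one_bound [of "\<theta> m"] sin_minus_self_bound [of "\<theta> m"] th [OF m] by linarith+
    qed auto
    then show ?thesis using that by (simp add: norm_mult)
  qed
  have frV: "free ({..<BL} - set bs) (V t)" for t
  proof -
    have s: "{..<BL} - set bs \<subseteq> {..<BL}" by auto
    have "free ({..<BL} - set bs) W" "free ({..<BL} - set bs) Wi"
      unfolding W_def Wi_def using free_chain [OF bs(1)] free_chain [OF rb]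
      by (auto intro!: free_controlled free_proj1 s sys')
    moreover have "free ({..<BL} - set bs) (controlled ?Q (R t))"
      using free_flipop [OF s] unfolding R_def by (intro free_controlled free_ctrl_proj s) (auto simp: free_def intro!: commutes_add commutes_mult commutes_scalar)
    ultimately show ?thesis unfolding V_def by (intro free_mult)
  qed
  have "apx (set bs) (V \<Delta>) (V (- \<Delta>)) (ctrl_rot \<theta>) (ctrl_rot (\<lambda>m. - \<theta> m)) (8 * \<bar>\<Delta>\<bar>\<^sup>2)"
  proof (rule apx_first_order [OF Vs RTs])
    show "op_bounded (V \<Delta>) 1" "op_bounded (V (- \<Delta>)) 1" using op_bound_circ_lop [OF wf] op_bound_circ_lop_adj [OF wf] by (simp_all add: cop cadj)
    fix Z L assume ZL: "free (set bs) Z" "free (set bs) L"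
    have ph: "\<phi> ((Z * ?Q) * S * L) = \<phi> ((Z * ?Q) * H * L)"
      unfolding S_def W_def Wi_def H_def
      by (intro phi_conjugated_flipop bs ZL free_mult free_ctrl_proj)
    have "Z * (scalar a * (?Q * Y)) * L = scalar a * ((Z * ?Q) * Y * L)" for a Y
      unfolding scalar_left_comm [of Z] by (simp add: mult.assoc)
    then show "\<phi> (Z * A * L) = \<phi> (Z * Bo * L)" unfolding A_def Bo_def by (simp add: phi_scalar ph)
  qed (use nAB ne [of 1] ne [of "-1"] nf [of 1] nf [of "-1"] \<Delta> bs(1) in \<open>auto intro!: op_bounded_ctrl_rot frV free_ctrl_rot\<close>)
  then show ?thesis by (simp add: cop cadj \<theta>_def)
qed

lemma angle_Cons: "angle ((k, \<Delta>) # ks) l m = \<Delta> * l m ^ k + angle ks l m"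
  by (simp add: angle_def)

text \<open>Consecutive gadgets consume consecutive, hence disjoint, intervals of blocks. So
  \<open>apx_mult\<close> adds the errors while the ideal rotations multiply by adding
  angles.\<close>

lemma rotation_gates_apx:
  assumes "\<And>p. p \<in> set ks \<Longrightarrow> \<bar>snd p\<bar> \<le> 1" "\<beta> + total_samples ks \<le> BL"
    "\<And>b. \<beta> \<le> b \<Longrightarrow> b < \<beta> + total_samples ks \<Longrightarrow> \<tau> b = \<rho>"
  shows "wf_gates Mw (rotation_gates co c sys block \<beta> ks) \<and>
    apx {\<beta>..<\<beta> + total_samples ks} (circ_lop (rotation_gates co c sys block \<beta> ks)) (circ_lop_adj (rotation_gates co c sys block \<beta> ks))
      (ctrl_rot (angle ks l)) (ctrl_rot (\<lambda>m. - angle ks l m)) (\<Sum>p\<leftarrow>ks. 8 * (snd p)\<^sup>2)"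
  using assms
proof (induction ks arbitrary: \<beta>)
  case Nil
  have "apx {} 1 1 1 1 0" by (intro apx_exact op_bound_one free_one)
  then show ?case by (simp add: total_samples_def angle_def rot_zero [OF B' sys(2)])
next
  case (Cons p ks)
  obtain k \<Delta> where p: "p = (k, \<Delta>)" by (cases p)
  have tot: "total_samples (p # ks) = k + total_samples ks" by (simp add: total_samples_def p)
  let ?bs = "[\<beta>..<\<beta> + k]"
  have bs: "set ?bs \<subseteq> {..<BL}" using Cons.prems(2) unfolding tot by auto
  have IH: "wf_gates Mw (rotation_gates co c sys block (\<beta> + k) ks)"
    "apx {\<beta> + k..<\<beta> + k + total_samples ks} (circ_lop (rotation_gates co c sys block (\<beta> + k) ks)) (circ_lop_adj (rotation_gates co c sys block (\<beta> + k) ks))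
      (ctrl_rot (angle ks l)) (ctrl_rot (\<lambda>m. - angle ks l m)) (\<Sum>p\<leftarrow>ks. 8 * (snd p)\<^sup>2)"
    using Cons.IH [of "\<beta> + k"] Cons.prems unfolding tot by simp_all
  have g: "apx (set ?bs) (circ_lop (gadget co c sys (map block ?bs) \<Delta>)) (circ_lop_adj (gadget co c sys (map block ?bs) \<Delta>))
     (ctrl_rot (\<lambda>m. \<Delta> * l m ^ length ?bs)) (ctrl_rot (\<lambda>m. - (\<Delta> * l m ^ length ?bs))) (8 * \<Delta>\<^sup>2)"
  proof (rule gadget_apx [OF bs])
    show "\<tau> b = \<rho>" if "b \<in> set ?bs" for b using Cons.prems(3) [of b] that unfolding tot by simp
    show "\<bar>\<Delta>\<bar> \<le> 1" using Cons.prems(1) [of p] by (simp add: p)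
  qed simp
  have d: "set ?bs \<inter> {\<beta> + k..<\<beta> + k + total_samples ks} = {}" by auto
  have s2: "{\<beta> + k..<\<beta> + k + total_samples ks} \<subseteq> {..<BL}" using Cons.prems(2) unfolding tot by auto
  have un: "set ?bs \<union> {\<beta> + k..<\<beta> + k + total_samples ks} = {\<beta>..<\<beta> + total_samples (p # ks)}" unfolding tot by auto
  have "apx {\<beta>..<\<beta> + total_samples (p # ks)} (circ_lop (rotation_gates co c sys block \<beta> (p # ks))) (circ_lop_adj (rotation_gates co c sys block \<beta> (p # ks)))
      (ctrl_rot (angle (p # ks) l)) (ctrl_rot (\<lambda>m. - angle (p # ks) l m)) (8 * \<Delta>\<^sup>2 + (\<Sum>p\<leftarrow>ks. 8 * (snd p)\<^sup>2))"
  proof -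
    have an: "angle (p # ks) l = (\<lambda>m. angle ks l m + \<Delta> * l m ^ k)"
      by (rule ext) (simp add: p angle_Cons)
    show ?thesis
      using apx_mult [OF g IH(2) d bs s2]
      unfolding un an by (simp add: p circ_lop_append circ_lop_adj_append ctrl_rot_mult add.commute)
  qed
  then show ?case using IH(1) wf_gates_gadget [OF bs] by (simp add: p)
qed

text \<open>An angle error r costs 2r in operator norm, once on each side of the observable, hence
  the term 4r. The final gate is exact.\<close>

lemma query_apx:
  assumes ks: "\<And>p. p \<in> set ks \<Longrightarrow> \<bar>snd p\<bar> \<le> 1" "\<beta> + total_samples ks \<le> BL"
    "\<And>b. \<beta> \<le> b \<Longrightarrow> b < \<beta> + total_samples ks \<Longrightarrow> \<tau> b = \<rho>"
    and \<sigma>: "\<sigma> = 1 \<or> \<sigma> = -1"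
    and \<psi>: "\<And>m. m < 2 ^ n \<Longrightarrow> \<bar>angle ks l m - \<psi> m\<bar> \<le> r" "0 \<le> r"
  shows "wf_gates Mw (query_circ co c sys block \<sigma> \<beta> ks) \<and>
    apx {\<beta>..<\<beta> + total_samples ks} (circ_lop (query_circ co c sys block \<sigma> \<beta> ks)) (circ_lop_adj (query_circ co c sys block \<sigma> \<beta> ks))
      (controlled (ctrl_proj co) (scalar (- \<i> * \<sigma>) * flipop c * rot B sys c \<psi>))
      (controlled (ctrl_proj co) (rot B sys c (\<lambda>m. - \<psi> m) * (scalar (\<i> * \<sigma>) * flipop c)))
      ((\<Sum>p\<leftarrow>ks. 8 * (snd p)\<^sup>2) + 4 * r)"
proof -
  let ?g = "ctrl_gate co c 0 (- \<i> * \<sigma>)"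
  have c: "c < Mw" "set (sys @ [c]) \<subseteq> {..<Mw}" using sys N_le by auto
  have ss: "\<sigma> * \<sigma> = 1" "cnj \<sigma> = \<sigma>" using \<sigma> by auto
  have gg: "is_gate Mw ?g"
    using co c N_le ss by (intro is_gate_ctrl_gate) (force simp: mult_ac)+
  have wf: "wf_gates Mw (rotation_gates co c sys block \<beta> ks)" and a: "apx {\<beta>..<\<beta> + total_samples ks} (circ_lop (rotation_gates co c sys block \<beta> ks)) (circ_lop_adj (rotation_gates co c sys block \<beta> ks))
      (ctrl_rot (angle ks l)) (ctrl_rot (\<lambda>m. - angle ks l m)) (\<Sum>p\<leftarrow>ks. 8 * (snd p)\<^sup>2)"
    using rotation_gates_apx [OF ks] by auto
  have r2: "apx {\<beta>..<\<beta> + total_samples ks} (circ_lop (rotation_gates co c sys block \<beta> ks)) (circ_lop_adj (rotation_gates co c sys block \<beta> ks))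
      (ctrl_rot \<psi>) (ctrl_rot (\<lambda>m. - \<psi> m)) ((\<Sum>p\<leftarrow>ks. 8 * (snd p)\<^sup>2) + 2 * (2 * r))"
  proof (rule apx_perturb [OF a])
    show "op_bounded (ctrl_rot (angle ks l) - ctrl_rot \<psi>) (2 * r)"
      using \<psi> sys by (intro op_bound_rot_diff [OF B' sys(2) c(2)]) auto
    show "op_bounded (ctrl_rot (\<lambda>m. - angle ks l m) - ctrl_rot (\<lambda>m. - \<psi> m)) (2 * r)"
      using \<psi> sys by (intro op_bound_rot_diff [OF B' sys(2) c(2)]) (auto simp: abs_minus_commute)
  qed (simp_all add: op_bounded_ctrl_rot free_ctrl_rot)
  define Y where "Y = (\<lambda>\<sigma>. controlled (ctrl_proj co) (scalar (- \<i> * \<sigma>) * flipop c))"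
  have copg: "circ_lop [?g] = Y \<sigma>"
    using emb_ctrl_gate [of co c 0 "- \<i> * \<sigma>"] co by (auto simp: Y_def)
  have Qs: "ctrl_proj co * (scalar a * flipop c) = (scalar a * flipop c) * ctrl_proj co" for a
    by (simp add: scalar_left_comm [of "ctrl_proj co"] ctrl_proj_flipop mult.assoc)
  have xx: "scalar a * flipop c * (scalar b * flipop c) = scalar (a * b)" for a b
    unfolding mult.assoc scalar_left_comm [of "flipop c"] flipop_flipop by (simp add: scalar_mult)
  have YY: "Y (- \<sigma>) * Y \<sigma> = 1"
  proof -
    have "(- \<i> * - \<sigma>) * (- \<i> * \<sigma>) = 1" using \<sigma> by auto
    then show ?thesis unfolding Y_def controlled_mult [OF ctrl_proj_idem Qs] xx by simp
  qed
  have cadg: "circ_lop_adj [?g] = Y (- \<sigma>)"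
    by (rule circ_lop_adj_eq [of Mw]) (use gg YY in \<open>simp_all only: copg wf_gates_simps simp_thms\<close>)
  have fY: "free {..<BL} (Y s)" for s
    unfolding Y_def by (intro free_controlled free_ctrl_proj) (use free_flipop [of "{..<BL}"] in \<open>auto simp: free_def intro!: commutes_mult commutes_scalar\<close>)
  have "op_bounded (Y \<sigma>) 1" "op_bounded (Y (- \<sigma>)) 1"
    using op_bound_circ_lop [of Mw "[?g]"] op_bound_circ_lop_adj [of Mw "[?g]"] gg unfolding copg cadg by simp_all
  then have b: "apx {} (Y \<sigma>) (Y (- \<sigma>)) (Y \<sigma>) (Y (- \<sigma>)) 0" by (intro apx_exact fY)
  have sub: "{\<beta>..<\<beta> + total_samples ks} \<subseteq> {..<BL}" using ks(2) by auto
  have T: "Y \<sigma> * ctrl_rot \<psi> = controlled (ctrl_proj co) (scalar (- \<i> * \<sigma>) * flipop c * rot B sys c \<psi>)"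
    "ctrl_rot (\<lambda>m. - \<psi> m) * Y (- \<sigma>) = controlled (ctrl_proj co) (rot B sys c (\<lambda>m. - \<psi> m) * (scalar (\<i> * \<sigma>) * flipop c))"
    unfolding Y_def by (simp_all add: controlled_mult ctrl_proj_idem Qs ctrl_proj_rot)
  have "circ_lop (query_circ co c sys block \<sigma> \<beta> ks) = Y \<sigma> * circ_lop (rotation_gates co c sys block \<beta> ks)"
    "circ_lop_adj (query_circ co c sys block \<sigma> \<beta> ks) = circ_lop_adj (rotation_gates co c sys block \<beta> ks) * Y (- \<sigma>)"
    unfolding query_circ_def circ_lop_append circ_lop_adj_append copg cadg by simp_all
  then show ?thesis
    using apx_mult [OF r2 b _ sub] wf gg unfolding T by (simp add: query_circ_def)
qed

end

end

section \<open>States with a product sample register\<close>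

lemma bit_idx: "bit (idx ws x) i \<longleftrightarrow> i < length ws \<and> bit x (ws ! i)"
proof (induction ws arbitrary: i)
  case (Cons w ws)
  have "bit (of_bool (bit x w) + 2 * idx ws x) i = (case i of 0 \<Rightarrow> bit x w | Suc j \<Rightarrow> bit (idx ws x) j)"
    by (cases i) (auto simp: bit_0 bit_Suc)
  then show ?case by (cases i) (simp_all add: Cons.IH)
qed simp

lemma idx_upt: "idx [p..<p + q] x = (x div 2 ^ p) mod 2 ^ q"
proof -
  have "idx [p..<p + q] x = take_bit q (drop_bit p x)"
    by (rule bit_eqI) (auto simp: bit_idx bit_take_bit_iff bit_drop_bit_eq)
  then show ?thesis by (simp add: take_bit_eq_mod drop_bit_eq_div)
qed

lemma bit_low_high:
  assumes "(x::nat) < 2 ^ N"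
  shows "bit (x + 2 ^ N * a) q = (if q < N then bit x q else bit a (q - N))"
proof -
  show ?thesis
  proof (cases "q < N")
    case True
    have "bit (x + 2 ^ N * a) q = bit (take_bit N (x + 2 ^ N * a)) q" using True by (simp add: bit_take_bit_iff)
    also have "take_bit N (x + 2 ^ N * a) = x" using assms by (simp add: take_bit_eq_mod)
    finally show ?thesis using True by simp
  next
    case False
    have "bit (x + 2 ^ N * a) q = bit (drop_bit N (x + 2 ^ N * a)) (q - N)"
      using False by (simp add: bit_drop_bit_eq)
    also have "drop_bit N (x + 2 ^ N * a) = a" using assms by (simp add: drop_bit_eq_div)
    finally show ?thesis using False by simp
  qed
qed

text \<open>v is the matrix of V on the low N wires, and the higher bits, collected in a, stay
  fixed. This links the dimension-free operators to the matrices in which channels are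
  defined.\<close>

definition rep :: "nat \<Rightarrow> lop \<Rightarrow> cmat \<Rightarrow> bool" where
  "rep N V v \<longleftrightarrow> (\<forall>g a x. x < 2 ^ N \<longrightarrow> ap V g (x + 2 ^ N * a) = (\<Sum>l<2 ^ N. v x l * g (l + 2 ^ N * a)))"

lemma repD: "rep N V v \<Longrightarrow> x < 2 ^ N \<Longrightarrow> ap V g (x + 2 ^ N * a) = (\<Sum>l<2 ^ N. v x l * g (l + 2 ^ N * a))"
  by (simp add: rep_def)

lemma rep_one: "rep N 1 idm"
  by (simp add: rep_def idm_def if_distrib [of "\<lambda>x. x * _"] cong: if_cong)

lemma rep_mult: "rep N V v \<Longrightarrow> rep N U u \<Longrightarrow> rep N (V * U) (mprod (2 ^ N) v u)"
  unfolding rep_def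
proof (intro allI impI)
  fix g :: "nat \<Rightarrow> complex" and a x :: nat
  assume V: "\<forall>g a x. x < 2 ^ N \<longrightarrow> ap V g (x + 2 ^ N * a) = (\<Sum>l<2 ^ N. v x l * g (l + 2 ^ N * a))"
    and U: "\<forall>g a x. x < 2 ^ N \<longrightarrow> ap U g (x + 2 ^ N * a) = (\<Sum>l<2 ^ N. u x l * g (l + 2 ^ N * a))" and x: "x < 2 ^ N"
  have "ap (V * U) g (x + 2 ^ N * a) = (\<Sum>l<2 ^ N. \<Sum>m<2 ^ N. v x l * u l m * g (m + 2 ^ N * a))"
    using V U x by (simp add: sum_distrib_left mult.assoc)
  also have "\<dots> = (\<Sum>m<2 ^ N. \<Sum>l<2 ^ N. v x l * u l m * g (m + 2 ^ N * a))" by (rule sum.swap)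
  finally show "ap (V * U) g (x + 2 ^ N * a) = (\<Sum>l<2 ^ N. mprod (2 ^ N) v u x l * g (l + 2 ^ N * a))"
    by (simp add: mprod_def sum_distrib_right)
qed

text \<open>Row x of \<open>embed\<close> is supported on the indices l that agree with x outside
  \<open>ws\<close>, which are exactly those of the form \<open>put ws v x\<close>. The sum over l
  thus becomes the sum over v in \<open>emb\<close>.\<close>

lemma rep_emb:
  assumes ws: "distinct ws" "set ws \<subseteq> {..<N}"
  shows "rep N (emb ws G) (embed N ws G)"
  unfolding rep_def
proof (intro allI impI)
  fix g :: "nat \<Rightarrow> complex" and a x :: nat assume x: "x < 2 ^ N"
  have i: "idx ws (x + 2 ^ N * a) = idx ws x"
    using ws(2) by (intro idx_cong) (auto simp: bit_low_high [OF x])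
  have p: "put ws v (x + 2 ^ N * a) = put ws v x + 2 ^ N * a" for v
  proof (rule bit_eqI)
    fix q
    have l: "put ws v x < 2 ^ N" by (rule put_less [OF ws(2) x])
    show "bit (put ws v (x + 2 ^ N * a)) q = bit (put ws v x + 2 ^ N * a) q"
    proof (cases "q \<in> set ws")
      case True
      then have "q < N" using ws by auto
      then show ?thesis using bit_put_in [OF True, of v "x + 2 ^ N * a" x] by (simp add: bit_low_high [OF l])
    next
      case False
      then show ?thesis by (simp add: bit_low_high [OF l] bit_low_high [OF x] bit_put_notin)
    qed
  qed
  have agree: "(\<forall>q<N. q \<notin> set ws \<longrightarrow> bit x q = bit l q) \<longleftrightarrow> l = put ws (idx ws l) x" if "l < 2 ^ N" for l
  proof
    assume a: "\<forall>q<N. q \<notin> set ws \<longrightarrow> bit x q = bit l q"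
    show "l = put ws (idx ws l) x"
    proof (rule bit_eqI)
      fix q
      show "bit l q = bit (put ws (idx ws l) x) q"
      proof (cases "q \<in> set ws")
        case True
        then show ?thesis using bit_put_in [OF True, of "idx ws l" l x] by simp
      next
        case False
        then show ?thesis using a x that by (cases "q < N") (auto simp: bit_put_notin less_2p_bits)
      qed
    qed
  next
    assume "l = put ws (idx ws l) x"
    then show "\<forall>q<N. q \<notin> set ws \<longrightarrow> bit x q = bit l q" by (metis bit_put_notin)
  qed
  have "(\<Sum>l<2 ^ N. embed N ws G x l * g (l + 2 ^ N * a))
      = (\<Sum>l\<in>{l. l < 2 ^ N \<and> l = put ws (idx ws l) x}. G (idx ws x) (idx ws l) * g (l + 2 ^ N * a))"
    by (rule sum.mono_neutral_cong_right) (auto simp: embed_def agree)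
  also have "\<dots> = (\<Sum>v<2 ^ length ws. G (idx ws x) v * g (put ws v x + 2 ^ N * a))"
    by (rule sum.reindex_bij_witness [of _ "\<lambda>v. put ws v x" "idx ws"])
       (use ws put_less [OF ws(2) x] in \<open>auto simp: idx_put_mod put_mod\<close>)
  finally show "ap (emb ws G) g (x + 2 ^ N * a) = (\<Sum>l<2 ^ N. embed N ws G x l * g (l + 2 ^ N * a))"
    by (simp add: ap_emb i p)
qed

lemma adj_embed: "adj (embed N ws G) = embed N ws (adj G)"
  by (intro ext) (auto simp: adj_def embed_def)

lemma adj_idm: "adj idm = idm"
  by (intro ext) (auto simp: adj_def idm_def)

lemma rep_circ_lop: "wf_gates M gs \<Longrightarrow> rep M (circ_lop gs) (circ M gs)"
  by (induction gs) (auto intro!: rep_one rep_mult rep_emb simp: is_gate_def)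

lemma rep_circ_lop_adj: "wf_gates M gs \<Longrightarrow> rep M (circ_lop_adj gs) (adj (circ M gs))"
  by (induction gs) (auto intro!: rep_one rep_mult rep_emb simp: is_gate_def adj_idm adj_mprod adj_embed)

text \<open>Fubini over disjoint groups of wires, kept free of division. When the groups exhaust all
  M wires the powers of two cancel.\<close>

lemma sum_partition:
  fixes f :: "'i \<Rightarrow> nat \<Rightarrow> real"
  assumes "finite I" "\<And>i. i \<in> I \<Longrightarrow> distinct (ws i) \<and> set (ws i) \<subseteq> {..<M}"
    "\<And>i j. i \<in> I \<Longrightarrow> j \<in> I \<Longrightarrow> i \<noteq> j \<Longrightarrow> set (ws i) \<inter> set (ws j) = {}"
  shows "2 ^ (\<Sum>i\<in>I. length (ws i)) * (\<Sum>x<2 ^ M. \<Prod>i\<in>I. f i (idx (ws i) x))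
    = 2 ^ M * (\<Prod>i\<in>I. \<Sum>u<2 ^ length (ws i). f i u)"
  using assms
proof (induction I)
  case (insert i I)
  have dis: "set (ws j) \<inter> set (ws i) = {}" if "j \<in> I" for j
    using insert.hyps that by (intro insert.prems) auto
  have "2 ^ length (ws i) * (\<Sum>x<2 ^ M. f i (idx (ws i) x) * (\<Prod>j\<in>I. f j (idx (ws j) x)))
     = (\<Sum>v<2 ^ length (ws i). f i v) * (\<Sum>x<2 ^ M. \<Prod>j\<in>I. f j (idx (ws j) x))"
    using insert.prems(1) [of i] dis by (intro sum_idx_factor prod.cong refl) (auto simp: idx_put_disjoint)
  moreover have "2 ^ (\<Sum>i\<in>I. length (ws i)) * (\<Sum>x<2 ^ M. \<Prod>i\<in>I. f i (idx (ws i) x))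
    = 2 ^ M * (\<Prod>i\<in>I. \<Sum>u<2 ^ length (ws i). f i u)"
    using insert.prems by (intro insert.IH) auto
  moreover have "a * b * t = m * (f * p)" if 1: "a * t = f * u" and 2: "b * u = m * p" for a b t m f p u :: real
  proof -
    have "a * b * t = b * (a * t)" by simp
    also have "\<dots> = f * (b * u)" unfolding 1 by simp
    also have "\<dots> = m * (f * p)" unfolding 2 by simp
    finally show ?thesis .
  qed
  ultimately show ?case unfolding sum.insert [OF insert.hyps] prod.insert [OF insert.hyps] power_add by blast
qed simp

lemma trnorm_decomposition_ex:
  "\<exists>q b. (\<forall>i j. i < d \<longrightarrow> j < d \<longrightarrow> A i j = (\<Sum>m<d. q m i * cnj (b m j))) \<and>
     (\<Sum>m<d. vnorm d (q m) * vnorm d (b m)) = trnorm d A"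
proof (rule trnorm_decomposition [of d A])
  fix q b
  assume "\<And>i j. i < d \<Longrightarrow> j < d \<Longrightarrow> A i j = (\<Sum>m<d. q m i * cnj (b m j))"
    "(\<Sum>m<d. vnorm d (q m) * vnorm d (b m)) = trnorm d A"
  then show ?thesis by blast
qed

text \<open>Wire layout: N input qubits, then BL sample blocks of n qubits each, then r reference
  qubits on top. \<open>Xi\<close> is the operator on input and reference over which the diamond
  norm ranges, so only its trace norm is restricted.\<close>

locale product_state =
  fixes N n BL r :: nat and Xi :: cmat and \<tau> :: "nat \<Rightarrow> cmat"
  assumes X1: "trnorm (2 ^ (N + r)) Xi \<le> 1"
    and dens: "b < BL \<Longrightarrow> Defs.density (2 ^ n) (\<tau> b)"
begin

definition M :: nat where "M = N + BL * n"
definition block :: "nat \<Rightarrow> nat list" where "block b = [N + b * n..<N + b * n + n]"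
definition ws0 :: "nat list" where "ws0 = [0..<N] @ [M..<M + r]"
definition joint_state :: "nat \<Rightarrow> nat \<Rightarrow> complex" where
  "joint_state x y = Xi (idx ws0 x) (idx ws0 y) * (\<Prod>b<BL. \<tau> b (idx (block b) x) (idx (block b) y))"
text \<open>The trace of A times the joint operator: the y-th diagonal entry comes from applying A
  to column y.\<close>

definition phi :: "lop \<Rightarrow> complex" where
  "phi A = (\<Sum>y<2 ^ (M + r). ap A (\<lambda>x. joint_state x y) y)"

lemma block_props:
  assumes "b < BL"
  shows "distinct (block b)" "length (block b) = n" "set (block b) \<inter> {..<N} = {}" "set (block b) \<subseteq> {..<M}"
    "set (block b) \<inter> set ws0 = {}"
proof -
  have "Suc b * n \<le> BL * n" using assms by (intro mult_le_mono) auto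
  then show "set (block b) \<subseteq> {..<M}" "set (block b) \<inter> set ws0 = {}"
    by (auto simp: block_def M_def ws0_def)
qed (auto simp: block_def)

lemma block_disj: "b \<noteq> b' \<Longrightarrow> set (block b) \<inter> set (block b') = {}"
proof -
  have "set (block b) \<inter> set (block b') = {}" if "b < b'" for b b'
  proof -
    have "Suc b * n \<le> b' * n" using that by (intro mult_le_mono) auto
    then show ?thesis by (auto simp: block_def)
  qed
  then show "b \<noteq> b' \<Longrightarrow> set (block b) \<inter> set (block b') = {}" by (metis inf_commute linorder_neqE_nat)
qed

lemma ws0_props: "distinct ws0" "length ws0 = N + r" "set ws0 \<subseteq> {..<M + r}"
  by (auto simp: ws0_def M_def)

lemma phi_add: "phi (A + B) = phi A + phi B"
  by (simp add: phi_def sum.distrib)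

lemma phi_scalar: "phi (scalar c * A) = c * phi A"
  by (simp add: phi_def sum_distrib_left)

text \<open>The ensemble of eigenvectors scaled by the roots of the eigenvalues; the squared norms
  add up to the trace 1.\<close>

lemma density_factor:
  assumes "b < BL"
  shows "\<exists>R. (\<forall>i<2 ^ n. \<forall>j<2 ^ n. \<tau> b i j = (\<Sum>s<2 ^ n. R s i * cnj (R s j)))
     \<and> (\<Sum>s<(2::nat) ^ n. (vnorm (2 ^ n) (R s))\<^sup>2) = 1"
proof -
  obtain B l where B: "unitary (2 ^ n) B" "\<And>m. m < 2 ^ n \<Longrightarrow> 0 \<le> l m" "(\<Sum>m<2 ^ n. l m) = 1"
    "eqm (2 ^ n) (\<tau> b) (fun_calc (2 ^ n) B (\<lambda>m. complex_of_real (l m)))"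
    using density_spectral [OF dens [OF assms]] by metis
  define R where "R = (\<lambda>s i. complex_of_real (sqrt (l s)) * B i s)"
  have "\<tau> b i j = (\<Sum>s<2 ^ n. R s i * cnj (R s j))" if "i < 2 ^ n" "j < 2 ^ n" for i j
  proof -
    have "\<tau> b i j = (\<Sum>m<2 ^ n. B i m * complex_of_real (l m) * cnj (B j m))"
      using B(4) that by (simp add: eqm_def fun_calc_entry)
    also have "\<dots> = (\<Sum>s<2 ^ n. R s i * cnj (R s j))"
    proof (intro sum.cong refl)
      fix m :: nat assume "m \<in> {..<2 ^ n}"
      then have "complex_of_real (l m) = complex_of_real (sqrt (l m)) * complex_of_real (sqrt (l m))"
        using B(2) [of m] by (simp flip: of_real_mult)
      then show "B i m * complex_of_real (l m) * cnj (B j m) = R m i * cnj (R m j)" by (simp add: R_def mult_ac)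
    qed
    finally show ?thesis .
  qed
  moreover have "(vnorm (2 ^ n) (R s))\<^sup>2 = l s" if "s < 2 ^ n" for s
  proof -
    have "complex_of_real ((vnorm (2 ^ n) (\<lambda>i. B i s))\<^sup>2) = 1"
      using unitary_col [OF B(1) that that] by (simp add: ip_self idm_def del: of_real_power)
    then have "(vnorm (2 ^ n) (\<lambda>i. B i s))\<^sup>2 = 1" by (simp only: of_real_eq_1_iff)
    then show ?thesis using B(2) [OF that] unfolding R_def vnorm_scale by (simp add: power_mult_distrib)
  qed
  ultimately show ?thesis using B(3) by (intro exI [of _ R]) simp
qed

lemma vnorm_product:
  assumes "\<And>x. Q x = q (idx ws0 x) * (\<Prod>b<BL. R b (idx (block b) x))"
  shows "vnorm (2 ^ (M + r)) Q = vnorm (2 ^ (N + r)) q * (\<Prod>b<BL. vnorm (2 ^ n) (R b))"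
proof -
  \<comment> \<open>The input and reference wires form group number BL, after the sample blocks. The
    lengths of all groups add up to M + r, so \<open>sum_partition\<close> loses its powers of
    two.\<close>
  define ws where "ws = (\<lambda>i. if i < BL then block i else ws0)"
  define f where "f = (\<lambda>i u. if i < BL then (cmod (R i u))\<^sup>2 else (cmod (q u))\<^sup>2)"
  have len: "(\<Sum>i<Suc BL. length (ws i)) = M + r"
    by (simp add: ws_def block_props ws0_props M_def)
  have e: "(vnorm (2 ^ (M + r)) Q)\<^sup>2 = (\<Sum>x<2 ^ (M + r). \<Prod>i<Suc BL. f i (idx (ws i) x))"
    unfolding vnorm_sq assms
    by (simp add: f_def ws_def norm_mult power_mult_distrib prod_norm [symmetric] prod_power_distrib mult.commute)
  have "2 ^ (\<Sum>i<Suc BL. length (ws i)) * (\<Sum>x<2 ^ (M + r). \<Prod>i<Suc BL. f i (idx (ws i) x))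
      = 2 ^ (M + r) * (\<Prod>i<Suc BL. \<Sum>u<2 ^ length (ws i). f i u)"
  proof (rule sum_partition)
    fix i assume "i \<in> {..<Suc BL}"
    then show "distinct (ws i) \<and> set (ws i) \<subseteq> {..<M + r}"
      using block_props(1,4) [of i] ws0_props by (auto simp: ws_def subset_iff intro: trans_less_add1)
  next
    fix i j assume "i \<in> {..<Suc BL}" "j \<in> {..<Suc BL}" "i \<noteq> j"
    then show "set (ws i) \<inter> set (ws j) = {}"
      using block_props(5) [of i] block_props(5) [of j] block_disj [of i j] by (auto simp: ws_def less_Suc_eq)
  qed simp
  then have "(vnorm (2 ^ (M + r)) Q)\<^sup>2 = (\<Prod>i<Suc BL. \<Sum>u<2 ^ length (ws i). f i u)"
    unfolding len e by (simp del: prod.lessThan_Suc)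
  also have "\<dots> = (vnorm (2 ^ (N + r)) q * (\<Prod>b<BL. vnorm (2 ^ n) (R b)))\<^sup>2"
    by (simp add: f_def ws_def block_props ws0_props power_mult_distrib vnorm_sq prod_power_distrib mult.commute)
  finally show ?thesis by (simp add: power2_eq_iff_nonneg prod_nonneg)
qed

text \<open>\<open>Xi\<close> is expanded into rank-one terms and every sample into its ensemble, so
  \<open>phi A\<close> is a sum of scalar products of product vectors, one of them under A.
  Cauchy-Schwarz leaves c times the trace norm of \<open>Xi\<close> times a product of ensemble
  weights, each summing to 1.\<close>

lemma phi_bound:
  assumes A: "op_bound (2 ^ (M + r)) A c"
  shows "cmod (phi A) \<le> c"
proof -
  let ?D = "2 ^ (M + r) :: nat"
  have c0: "0 \<le> c" using A by (simp add: op_bound_def)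
  let ?d = "2 ^ (N + r) :: nat"
  obtain q b where qb0: "(\<forall>i j. i < ?d \<longrightarrow> j < ?d \<longrightarrow> Xi i j = (\<Sum>m<?d. q m i * cnj (b m j))) \<and>
     (\<Sum>m<?d. vnorm ?d (q m) * vnorm ?d (b m)) = trnorm ?d Xi"
    using trnorm_decomposition_ex [of ?d Xi] by (elim exE)
  then have qb: "(\<Sum>m<?d. vnorm ?d (q m) * vnorm ?d (b m)) = trnorm ?d Xi" by (rule conjunct2)
  have qb1: "Xi i j = (\<Sum>m<?d. q m i * cnj (b m j))" if "i < ?d" "j < ?d" for i j
    using qb0 [THEN conjunct1, rule_format, OF that] .
  have "\<forall>b\<in>{..<BL}. \<exists>R. (\<forall>i<2 ^ n. \<forall>j<2 ^ n. \<tau> b i j = (\<Sum>s<2 ^ n. R s i * cnj (R s j)))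
     \<and> (\<Sum>s<(2::nat) ^ n. (vnorm (2 ^ n) (R s))\<^sup>2) = 1" using density_factor by blast
  then obtain R where R: "\<forall>b\<in>{..<BL}. (\<forall>i<2 ^ n. \<forall>j<2 ^ n. \<tau> b i j = (\<Sum>s<2 ^ n. R b s i * cnj (R b s j)))
     \<and> (\<Sum>s<(2::nat) ^ n. (vnorm (2 ^ n) (R b s))\<^sup>2) = 1"
    unfolding bchoice_iff by blast
  define S where "S = ({..<BL} \<rightarrow>\<^sub>E {..<(2::nat) ^ n})"
  define Q where "Q = (\<lambda>(p :: nat \<Rightarrow> nat \<Rightarrow> complex) m s x. p m (idx ws0 x) * (\<Prod>b<BL. R b (s b) (idx (block b) x)) :: complex)"
  have joint_state: "joint_state x y = (\<Sum>m<2 ^ (N + r). \<Sum>s\<in>S. cnj (Q b m s y) * Q q m s x)" for x y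
  proof -
    have i0: "idx ws0 z < 2 ^ (N + r)" for z using idx_less [of ws0 z] ws0_props by simp
    have ib: "idx (block b) z < 2 ^ n" if "b < BL" for b z using idx_less [of "block b" z] block_props [OF that] by simp
    have "(\<Prod>b<BL. \<tau> b (idx (block b) x) (idx (block b) y)) = (\<Prod>b<BL. \<Sum>s<2 ^ n. R b s (idx (block b) x) * cnj (R b s (idx (block b) y)))"
      using R ib by (intro prod.cong refl) simp
    also have "\<dots> = (\<Sum>s\<in>S. \<Prod>b<BL. R b (s b) (idx (block b) x) * cnj (R b (s b) (idx (block b) y)))"
      unfolding S_def by (subst prod_sum_PiE) auto
    finally show ?thesis
      unfolding joint_state_def qb1 [OF i0 i0]
      by (simp add: sum_distrib_left sum_distrib_right Q_def prod.distrib mult_ac) (rule sum.swap)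
  qed
  have "phi A = (\<Sum>y<?D. \<Sum>m<2 ^ (N + r). \<Sum>s\<in>S. cnj (Q b m s y) * ap A (Q q m s) y)"
    unfolding phi_def joint_state by (simp add: ap_sum_arg ap_scale)
  also have "\<dots> = (\<Sum>m<2 ^ (N + r). \<Sum>s\<in>S. ip ?D (Q b m s) (ap A (Q q m s)))"
    unfolding ip_def by (subst sum.swap, intro sum.cong refl sum.swap)
  finally have "cmod (phi A) \<le> (\<Sum>m<2 ^ (N + r). \<Sum>s\<in>S. cmod (ip ?D (Q b m s) (ap A (Q q m s))))"
    by (auto intro!: order_trans [OF norm_sum] sum_mono norm_sum)
  also have "\<dots> \<le> (\<Sum>m<2 ^ (N + r). \<Sum>s\<in>S. vnorm ?D (Q b m s) * (c * vnorm ?D (Q q m s)))"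
  proof (intro sum_mono)
    fix m s
    have "cmod (ip ?D (Q b m s) (ap A (Q q m s))) \<le> vnorm ?D (Q b m s) * vnorm ?D (ap A (Q q m s))" by (rule ip_cauchy)
    also have "\<dots> \<le> vnorm ?D (Q b m s) * (c * vnorm ?D (Q q m s))"
      using A by (intro mult_left_mono) (auto simp: op_bound_def)
    finally show "cmod (ip ?D (Q b m s) (ap A (Q q m s))) \<le> vnorm ?D (Q b m s) * (c * vnorm ?D (Q q m s))" .
  qed
  also have "\<dots> = (\<Sum>m<2 ^ (N + r). \<Sum>s\<in>S. c * (vnorm (2 ^ (N + r)) (q m) * vnorm (2 ^ (N + r)) (b m)) * (\<Prod>b<BL. (vnorm (2 ^ n) (R b (s b)))\<^sup>2))"
  proof (intro sum.cong refl)
    fix m s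
    have "vnorm ?D (Q p m s) = vnorm (2 ^ (N + r)) (p m) * (\<Prod>b<BL. vnorm (2 ^ n) (R b (s b)))" for p
      by (rule vnorm_product) (simp add: Q_def)
    then show "vnorm ?D (Q b m s) * (c * vnorm ?D (Q q m s))
       = c * (vnorm (2 ^ (N + r)) (q m) * vnorm (2 ^ (N + r)) (b m)) * (\<Prod>b<BL. (vnorm (2 ^ n) (R b (s b)))\<^sup>2)"
      by (simp add: power2_eq_square prod.distrib mult_ac)
  qed
  also have "\<dots> = c * trnorm (2 ^ (N + r)) Xi * (\<Sum>s\<in>S. \<Prod>b<BL. (vnorm (2 ^ n) (R b (s b)))\<^sup>2)"
    unfolding qb [symmetric] by (simp add: sum_distrib_left sum_distrib_right mult_ac)
  also have "(\<Sum>s\<in>S. \<Prod>b<BL. (vnorm (2 ^ n) (R b (s b)))\<^sup>2) = (\<Prod>b<BL. \<Sum>s<2 ^ n. (vnorm (2 ^ n) (R b s))\<^sup>2)"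
    unfolding S_def by (subst prod_sum_PiE) auto
  also have "\<dots> = 1" using R by (intro prod.neutral) auto
  finally show ?thesis using mult_left_le [OF X1 c0] by (simp add: mult.commute)
qed

text \<open>Commutation brings G in front of Z, where on the diagonal it becomes a function of the
  block bits alone. The remaining weight ignores these bits, so the sum factors. The case G =
  \<open>idm\<close>, where the trace of \<tau> is 1, identifies the second factor as a multiple of
  \<open>phi Z\<close>.\<close>

lemma phi_prod:
  assumes b: "b < BL" and Z: "commutes (block b) Z"
  shows "phi (Z * emb (block b) G) = (\<Sum>i<2 ^ n. \<Sum>j<2 ^ n. G i j * \<tau> b j i) * phi Z"
proof -
  let ?w = "block b" and ?D = "2 ^ (M + r) :: nat"
  note bp = block_props [OF b]
  define \<zeta> where "\<zeta> = (\<lambda>y x. Xi (idx ws0 x) (idx ws0 y) * (\<Prod>b'\<in>{..<BL} - {b}. \<tau> b' (idx (block b') x) (idx (block b') y)))"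
  have joint_state: "joint_state x y = \<tau> b (idx ?w x) (idx ?w y) * \<zeta> y x" for x y
    using b prod.remove [of "{..<BL}" b "\<lambda>b. \<tau> b (idx (block b) x) (idx (block b) y)"] by (simp add: joint_state_def \<zeta>_def)
  have d0: "set ws0 \<inter> set ?w = {}" using bp by blast
  have dB: "set (block b') \<inter> set ?w = {}" if "b' \<in> {..<BL} - {b}" for b' using that by (intro block_disj) auto
  have i1: "idx ws0 (put ?w v x) = idx ws0 x" for v x by (rule idx_put_disjoint [OF d0])
  have i2: "idx (block b') (put ?w v x) = idx (block b') x" if "b' \<in> {..<BL} - {b}" for b' v x
    by (rule idx_put_disjoint [OF dB [OF that]])
  have z1: "\<zeta> y (put ?w v x) = \<zeta> y x" for v x y
    unfolding \<zeta>_def i1 using i2 by (intro arg_cong2 [where f = "(*)"] prod.cong) auto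
  have z2: "\<zeta> (put ?w v y) = \<zeta> y" for v y
    unfolding \<zeta>_def i1 using i2 by (intro ext arg_cong2 [where f = "(*)"] prod.cong) auto
  have wsub: "set ?w \<subseteq> {..<M + r}" using bp(4) by (auto simp: subset_iff intro: trans_less_add1)
  define w where "w = (\<lambda>y. ap Z (\<zeta> y) y)"
  \<comment> \<open>Overwriting the block by a fixed u is itself an operator on these wires. It
    fixes the vector \<open>\<zeta> y\<close> and commutes with Z, so it fixes the image under Z as
    well.\<close>
  have wput: "w (put ?w v y) = w y" for v y
  proof -
    define u where "u = v mod 2 ^ n"
    have pv: "put ?w v y = put ?w u y" using put_mod [of ?w v y] bp by (simp add: u_def)
    have u: "u < 2 ^ length ?w" using bp by (simp add: u_def)
    define K where "K = emb ?w (\<lambda>i j. if j = u then 1 else 0)"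
    have K: "ap K g x = g (put ?w u x)" for g x
    proof -
      have "ap K g x = (\<Sum>v<2 ^ length ?w. if v = u then g (put ?w u x) else 0)"
        unfolding K_def ap_emb by (intro sum.cong refl) auto
      then show ?thesis using u by simp
    qed
    have "ap K (\<zeta> y) = \<zeta> y" by (rule ext) (simp add: K z1)
    then have "ap K (ap Z (\<zeta> y)) = ap Z (\<zeta> y)"
      using cmD [OF Z] unfolding K_def by (metis ap_times)
    then show ?thesis unfolding pv w_def z2 by (metis K)
  qed
  have main: "phi (Z * emb ?w G) * 2 ^ n = (\<Sum>i<2 ^ n. \<Sum>j<2 ^ n. G i j * \<tau> b j i) * (\<Sum>y<?D. w y)" for G
  proof -
    define h where "h = (\<lambda>y u. \<Sum>v<2 ^ n. G u v * \<tau> b v (idx ?w y))"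
    \<comment> \<open>For fixed y, G acts on the sample factor of the column only and yields the
      vector \<open>h y\<close>. Written as a diagonal operator on the block, this vector can be
      moved past Z in turn.\<close>
    have "ap (emb ?w G) (\<lambda>x. joint_state x y) = ap (emb ?w (diag (h y))) (\<zeta> y)" for y
    proof
      fix x
      show "ap (emb ?w G) (\<lambda>x. joint_state x y) x = ap (emb ?w (diag (h y))) (\<zeta> y) x"
        unfolding ap_emb [of ?w G] emb_diag h_def sum_distrib_right using bp
        by (intro sum.cong) (simp_all add: joint_state z1 mult.assoc)
    qed
    then have "ap (Z * emb ?w G) (\<lambda>x. joint_state x y) y = ap (emb ?w (diag (h y)) * Z) (\<zeta> y) y" for y
      unfolding cmD [OF Z] by simp
    then have "phi (Z * emb ?w G) = (\<Sum>y<?D. (\<Sum>v<2 ^ n. G (idx ?w y) v * \<tau> b v (idx ?w y)) * w y)"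
      unfolding phi_def by (simp add: emb_diag h_def w_def)
    then show ?thesis
      using sum_idx_factor [OF bp(1) wsub wput, of "\<lambda>i. \<Sum>j<2 ^ n. G i j * \<tau> b j i"] bp(2)
      by (simp add: mult.commute)
  qed
  have tr: "(\<Sum>i<2 ^ n. \<Sum>j<2 ^ n. idm i j * \<tau> b j i) = 1"
  proof -
    have "(\<Sum>i<2 ^ n. \<Sum>j<2 ^ n. idm i j * \<tau> b j i) = mtrace (2 ^ n) (\<tau> b)"
      unfolding mtrace_def idm_def by (intro sum.cong refl) (simp add: if_distrib [of "\<lambda>x. x * _"] cong: if_cong)
    then show ?thesis using dens [OF b] by (simp add: Defs.density_def)
  qed
  have "phi Z * 2 ^ n = (\<Sum>y<?D. w y)" using main [of idm] by (simp add: tr emb_idm)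
  then have "phi (Z * emb ?w G) * 2 ^ n = ((\<Sum>i<2 ^ n. \<Sum>j<2 ^ n. G i j * \<tau> b j i) * phi Z) * 2 ^ n"
    unfolding main by (simp add: mult.assoc)
  then show ?thesis by simp
qed

sublocale sampling phi "M + r" N n BL block \<tau>
proof
  show "N \<le> M + r" by (simp add: M_def)
  show "b < BL \<Longrightarrow> distinct (block b) \<and> length (block b) = n \<and> set (block b) \<inter> {..<N} = {} \<and> set (block b) \<subseteq> {..<M + r}" for b
    using block_props by fastforce
qed (use phi_add phi_scalar phi_bound phi_prod block_disj in auto)

end

section \<open>Channel outputs expressed by the functional\<close>

lemma split_index:
  fixes i z :: nat
  assumes "i < 2 ^ N" "z < 2 ^ K"
  shows "i + 2 ^ N * z < 2 ^ (N + K)"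
proof -
  have "i + 2 ^ N * z < 2 ^ N * Suc z" using assms by simp
  also have "\<dots> \<le> 2 ^ N * 2 ^ K" using assms by (intro mult_le_mono) auto
  finally show ?thesis by (simp add: power_add)
qed

context product_state
begin

lemma M_eq: "M = N + BL * n" by (simp add: M_def)

lemma idx_ws0:
  assumes "i < 2 ^ N" "z < 2 ^ (BL * n)" "a < 2 ^ r"
  shows "idx ws0 (i + 2 ^ N * z + 2 ^ M * a) = i + 2 ^ N * a"
proof -
  have l: "i + 2 ^ N * z < 2 ^ M" unfolding M_eq by (rule split_index [OF assms(1,2)])
  have 1: "(i + 2 ^ N * z + 2 ^ M * a) mod 2 ^ N = i"
    using assms(1) by (simp add: M_eq power_add mult.assoc)
  have 2: "(i + 2 ^ N * z + 2 ^ M * a) div 2 ^ M = a" using l by simp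
  show ?thesis
    unfolding ws0_def idx_append using idx_upt [of 0 N] idx_upt [of M r] assms 1 2 by simp
qed

lemma idx_mid:
  assumes "i < 2 ^ N" "z < 2 ^ (BL * n)"
  shows "idx [N..<M] (i + 2 ^ N * z + 2 ^ M * a) = z"
proof -
  have "(i + 2 ^ N * z + 2 ^ M * a) div 2 ^ N = z + 2 ^ (BL * n) * a"
  proof -
    have e: "i + 2 ^ N * z + 2 ^ M * a = i + 2 ^ N * (z + 2 ^ (BL * n) * a)"
      by (simp add: M_eq power_add algebra_simps)
    show ?thesis unfolding e using assms(1) by simp
  qed
  then show ?thesis using idx_upt [of N "BL * n"] assms(2) by (simp add: M_eq)
qed

lemma put_ws0:
  assumes "i < 2 ^ N" "z < 2 ^ (BL * n)" "a < 2 ^ r" "j < 2 ^ N" "b < 2 ^ r"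
  shows "put ws0 (j + 2 ^ N * b) (i + 2 ^ N * z + 2 ^ M * a) = j + 2 ^ N * z + 2 ^ M * b"
proof (rule bit_eqI)
  fix q
  let ?x = "i + 2 ^ N * z + 2 ^ M * a" and ?y = "j + 2 ^ N * z + 2 ^ M * b"
  have yi: "idx ws0 ?y = j + 2 ^ N * b" by (rule idx_ws0 [OF assms(4,2,5)])
  have lx: "i + 2 ^ N * z < 2 ^ M" and ly: "j + 2 ^ N * z < 2 ^ M"
    unfolding M_eq by (rule split_index [OF assms(1,2)], rule split_index [OF assms(4,2)])
  show "bit (put ws0 (j + 2 ^ N * b) ?x) q = bit ?y q"
  proof (cases "q \<in> set ws0")
    case True
    then show ?thesis unfolding yi [symmetric] using bit_put_in [OF True, of "idx ws0 ?y" ?x ?y] by simp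
  next
    case False
    then consider "N \<le> q" "q < M" | "M + r \<le> q" by (auto simp: ws0_def)
    then show ?thesis
    proof cases
      case 1
      then show ?thesis using False
        by (simp add: bit_put_notin bit_low_high [OF lx] bit_low_high [OF ly] bit_low_high [OF assms(1)] bit_low_high [OF assms(4)])
    next
      case 2
      have "?x < 2 ^ (M + r)" "?y < 2 ^ (M + r)" using split_index [OF lx assms(3)] split_index [OF ly assms(5)] by auto
      then show ?thesis using False 2 by (simp add: bit_put_notin less_2p_bits)
    qed
  qed
qed

definition Out :: "cmat \<Rightarrow> cmat" where
  "Out v = (\<lambda>i j. \<Sum>z<2 ^ (BL * n). \<Sum>l'<2 ^ M. \<Sum>l<2 ^ M.
      v (i mod 2 ^ N + 2 ^ N * z) l * joint_state (l + 2 ^ M * (i div 2 ^ N)) (l' + 2 ^ M * (j div 2 ^ N))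
        * cnj (v (j mod 2 ^ N + 2 ^ N * z) l'))"

text \<open>The bridge between the functional \<open>phi\<close> and traces of density matrices: \<open>Out v\<close> is the
  output of the channel with Stinespring unitary \<open>v\<close> (reference system included).\<close>

lemma phi_Out:
  assumes V: "rep M V v" and V': "rep M V' (adj v)"
  shows "phi (V' * emb ws0 W * V) = mtrace (2 ^ (N + r)) (mprod (2 ^ (N + r)) W (Out v))"
proof -
  let ?N = "2 ^ N :: nat" and ?M = "2 ^ M :: nat" and ?r = "2 ^ r :: nat" and ?K = "2 ^ (BL * n) :: nat"
  define T where "T = (\<lambda>l' a l b. joint_state (l + ?M * b) (l' + ?M * a))"
  have inner: "ap (emb ws0 W * V) g (j + ?N * z + ?M * a)
      = (\<Sum>i<?N. \<Sum>b<?r. \<Sum>l<?M. W (j + ?N * a) (i + ?N * b) * (v (i + ?N * z) l * g (l + ?M * b)))"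
    if "j < ?N" "z < ?K" "a < ?r" for g j z a
  proof -
    have "ap (emb ws0 W * V) g (j + ?N * z + ?M * a)
      = (\<Sum>i<?N. \<Sum>b<?r. W (j + ?N * a) (i + ?N * b) * ap V g (i + ?N * z + ?M * b))"
      unfolding ap_times ap_emb ws0_props(2) sum_pow2_add idx_ws0 [OF that]
      using that by (intro sum.cong refl) (simp add: put_ws0)
    also have "\<dots> = (\<Sum>i<?N. \<Sum>b<?r. \<Sum>l<?M. W (j + ?N * a) (i + ?N * b) * (v (i + ?N * z) l * g (l + ?M * b)))"
    proof (intro sum.cong refl)
      fix i b assume "i \<in> {..<?N}"
      then have "i + ?N * z < ?M" unfolding M_eq using that by (intro split_index) auto
      then show "W (j + ?N * a) (i + ?N * b) * ap V g (i + ?N * z + ?M * b)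
         = (\<Sum>l<?M. W (j + ?N * a) (i + ?N * b) * (v (i + ?N * z) l * g (l + ?M * b)))"
        by (simp add: repD [OF V] sum_distrib_left)
    qed
    finally show ?thesis .
  qed
  have outer: "ap (V' * emb ws0 W * V) (\<lambda>x. joint_state x (l' + ?M * a)) (l' + ?M * a)
     = (\<Sum>j<?N. \<Sum>z<?K. \<Sum>i<?N. \<Sum>b<?r. \<Sum>l<?M.
          W (j + ?N * a) (i + ?N * b) * (v (i + ?N * z) l * T l' a l b * cnj (v (j + ?N * z) l')))"
    if "l' < ?M" "a < ?r" for l' a
  proof -
    have "ap (V' * emb ws0 W * V) (\<lambda>x. joint_state x (l' + ?M * a)) (l' + ?M * a)
      = (\<Sum>m<?M. cnj (v m l') * ap (emb ws0 W * V) (\<lambda>x. joint_state x (l' + ?M * a)) (m + ?M * a))"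
      unfolding mult.assoc ap_times [of V'] repD [OF V' that(1)] by (simp add: adj_def)
    also have "\<dots> = (\<Sum>j<?N. \<Sum>z<?K. cnj (v (j + ?N * z) l') * ap (emb ws0 W * V) (\<lambda>x. joint_state x (l' + ?M * a)) (j + ?N * z + ?M * a))"
      unfolding M_eq sum_pow2_add ..
    also have "\<dots> = (\<Sum>j<?N. \<Sum>z<?K. \<Sum>i<?N. \<Sum>b<?r. \<Sum>l<?M.
          W (j + ?N * a) (i + ?N * b) * (v (i + ?N * z) l * T l' a l b * cnj (v (j + ?N * z) l')))"
      using that(2) by (intro sum.cong refl, subst inner) (auto simp: T_def sum_distrib_left mult_ac)
    finally show ?thesis .
  qed
  define F where "F = (\<lambda>l' a j z i b l. W (j + ?N * a) (i + ?N * b) * (v (i + ?N * z) l * T l' a l b * cnj (v (j + ?N * z) l')))"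
  have "phi (V' * emb ws0 W * V) = (\<Sum>l'<?M. \<Sum>a<?r. ap (V' * emb ws0 W * V) (\<lambda>x. joint_state x (l' + ?M * a)) (l' + ?M * a))"
    unfolding phi_def sum_pow2_add ..
  also have "\<dots> = (\<Sum>l'<?M. \<Sum>a<?r. \<Sum>j<?N. \<Sum>z<?K. \<Sum>i<?N. \<Sum>b<?r. \<Sum>l<?M. F l' a j z i b l)"
    unfolding F_def by (intro sum.cong refl outer) auto
  \<comment> \<open>The sums are permuted until those over the traced-out samples z and the inner
    indices l', l stand innermost; these three form \<open>Out v\<close>.\<close>
  also have "\<dots> = (\<Sum>a<?r. \<Sum>l'<?M. \<Sum>j<?N. \<Sum>z<?K. \<Sum>i<?N. \<Sum>b<?r. \<Sum>l<?M. F l' a j z i b l)"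
    by (rule sum.swap)
  also have "\<dots> = (\<Sum>a<?r. \<Sum>j<?N. \<Sum>l'<?M. \<Sum>z<?K. \<Sum>i<?N. \<Sum>b<?r. \<Sum>l<?M. F l' a j z i b l)"
    by (intro sum.cong refl sum.swap)
  also have "\<dots> = (\<Sum>j<?N. \<Sum>a<?r. \<Sum>l'<?M. \<Sum>z<?K. \<Sum>i<?N. \<Sum>b<?r. \<Sum>l<?M. F l' a j z i b l)"
    by (rule sum.swap)
  also have "\<dots> = (\<Sum>j<?N. \<Sum>a<?r. \<Sum>z<?K. \<Sum>l'<?M. \<Sum>i<?N. \<Sum>b<?r. \<Sum>l<?M. F l' a j z i b l)"
    by (intro sum.cong refl sum.swap)
  also have "\<dots> = (\<Sum>j<?N. \<Sum>a<?r. \<Sum>z<?K. \<Sum>i<?N. \<Sum>l'<?M. \<Sum>b<?r. \<Sum>l<?M. F l' a j z i b l)"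
    by (intro sum.cong refl sum.swap)
  also have "\<dots> = (\<Sum>j<?N. \<Sum>a<?r. \<Sum>i<?N. \<Sum>z<?K. \<Sum>l'<?M. \<Sum>b<?r. \<Sum>l<?M. F l' a j z i b l)"
    by (intro sum.cong refl sum.swap)
  also have "\<dots> = (\<Sum>j<?N. \<Sum>a<?r. \<Sum>i<?N. \<Sum>z<?K. \<Sum>b<?r. \<Sum>l'<?M. \<Sum>l<?M. F l' a j z i b l)"
    by (intro sum.cong refl sum.swap)
  also have "\<dots> = (\<Sum>j<?N. \<Sum>a<?r. \<Sum>i<?N. \<Sum>b<?r. \<Sum>z<?K. \<Sum>l'<?M. \<Sum>l<?M. F l' a j z i b l)"
    by (intro sum.cong refl sum.swap)
  also have "\<dots> = (\<Sum>j<?N. \<Sum>a<?r. \<Sum>i<?N. \<Sum>b<?r. W (j + ?N * a) (i + ?N * b) * Out v (i + ?N * b) (j + ?N * a))"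
    unfolding Out_def F_def T_def by (intro sum.cong refl) (simp add: sum_distrib_left)
  also have "\<dots> = mtrace (2 ^ (N + r)) (mprod (2 ^ (N + r)) W (Out v))"
    unfolding mtrace_def mprod_def sum_pow2_add ..
  finally show ?thesis .
qed

definition sample_prod :: "nat \<Rightarrow> nat \<Rightarrow> complex" where
  "sample_prod z z' = (\<Prod>b<BL. \<tau> b ((z div 2 ^ (b * n)) mod 2 ^ n) ((z' div 2 ^ (b * n)) mod 2 ^ n))"

lemma joint_state_eq:
  assumes "i < 2 ^ N" "z < 2 ^ (BL * n)" "a < 2 ^ r" "i' < 2 ^ N" "z' < 2 ^ (BL * n)" "a' < 2 ^ r"
  shows "joint_state (i + 2 ^ N * z + 2 ^ M * a) (i' + 2 ^ N * z' + 2 ^ M * a') = Xi (i + 2 ^ N * a) (i' + 2 ^ N * a') * sample_prod z z'"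
proof -
  have "idx (block b) (i + 2 ^ N * z + 2 ^ M * a) = (z div 2 ^ (b * n)) mod 2 ^ n" if "b < BL" "i < 2 ^ N" "z < 2 ^ (BL * n)" for b i z a
  proof -
    have bl: "Suc b * n \<le> BL * n" using that(1) by (intro mult_le_mono) auto
    have q: "idx (block b) x = ((x div 2 ^ N) mod 2 ^ (BL * n) div 2 ^ (b * n)) mod 2 ^ n" for x
    proof (rule bit_eqI)
      fix q
      show "bit (idx (block b) x) q = bit (((x div 2 ^ N) mod 2 ^ (BL * n) div 2 ^ (b * n)) mod 2 ^ n) q"
        using bl unfolding take_bit_eq_mod [symmetric] drop_bit_eq_div [symmetric]
        by (auto simp: block_def bit_idx bit_take_bit_iff bit_drop_bit_eq add_ac)
    qed
    have "(i + 2 ^ N * z + 2 ^ M * a) div 2 ^ N mod 2 ^ (BL * n) = z"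
      using idx_mid [OF that(2,3), of a] idx_upt [of N "BL * n"] by (simp add: M_eq)
    then show ?thesis unfolding q by simp
  qed
  then show ?thesis using assms unfolding joint_state_def sample_prod_def by (simp add: idx_ws0)
qed

lemma sample_prod_trace: "(\<Sum>z<2 ^ (BL * n). sample_prod z z) = 1"
proof -
  have "b \<le> BL \<Longrightarrow> (\<Sum>z<2 ^ (b * n). \<Prod>b'<b. \<tau> b' ((z div 2 ^ (b' * n)) mod 2 ^ n) ((z div 2 ^ (b' * n)) mod 2 ^ n)) = 1" for b
  proof (induction b)
    case (Suc b)
    let ?t = "\<lambda>b' z. \<tau> b' ((z div 2 ^ (b' * n)) mod 2 ^ n) ((z div 2 ^ (b' * n)) mod 2 ^ n)"
    have "(\<Sum>z<2 ^ (b * n + n). \<Prod>b'<Suc b. ?t b' z) = (\<Sum>u<2 ^ (b * n). \<Sum>s<2 ^ n. (\<Prod>b'<b. ?t b' u) * \<tau> b s s)"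
      unfolding sum_pow2_add
    proof (intro sum.cong refl)
      fix u s :: nat assume us: "u \<in> {..<2 ^ (b * n)}" "s \<in> {..<2 ^ n}"
      have "((u + 2 ^ (b * n) * s) div 2 ^ (b' * n)) mod 2 ^ n = (u div 2 ^ (b' * n)) mod 2 ^ n" if "b' < b" for b'
      proof -
        have "Suc b' * n \<le> b * n" using that by (intro mult_le_mono) auto
        then obtain k where "b * n = b' * n + n + k" by (auto simp: le_iff_add)
        then have e: "u + 2 ^ (b * n) * s = u + 2 ^ (b' * n) * (2 ^ n * (2 ^ k * s))"
          by (simp add: power_add mult_ac)
        show ?thesis unfolding e by simp
      qed
      then show "(\<Prod>b'<Suc b. ?t b' (u + 2 ^ (b * n) * s)) = (\<Prod>b'<b. ?t b' u) * \<tau> b s s"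
        using us by simp
    qed
    also have "\<dots> = (\<Sum>u<2 ^ (b * n). \<Prod>b'<b. ?t b' u) * mtrace (2 ^ n) (\<tau> b)"
      by (simp add: mtrace_def sum_distrib_left sum_distrib_right) (rule sum.swap)
    also have "\<dots> = 1" using Suc dens [of b] by (simp add: Defs.density_def)
    finally show ?case by (simp add: add.commute)
  qed simp
  then show ?thesis unfolding sample_prod_def by blast
qed

text \<open>If v acts as u on the input and trivially on the samples, tracing out the samples gives
  the factor 1. This describes the ideal run in the same register as the circuit.\<close>

lemma Out_unused:
  assumes u: "\<And>i z l z'. i < 2 ^ N \<Longrightarrow> l < 2 ^ N \<Longrightarrow> z < 2 ^ (BL * n) \<Longrightarrow> z' < 2 ^ (BL * n) \<Longrightarrow>
      v (i + 2 ^ N * z) (l + 2 ^ N * z') = (if z = z' then u i l else 0)"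
    and ij: "i < 2 ^ (N + r)" "j < 2 ^ (N + r)"
  shows "Out v i j = ext_map N (uchan (2 ^ N) u) Xi i j"
proof -
  let ?N = "2 ^ N :: nat" and ?M = "2 ^ M :: nat" and ?K = "2 ^ (BL * n) :: nat"
  define i0 j0 a b where d: "i0 = i mod ?N" "j0 = j mod ?N" "a = i div ?N" "b = j div ?N"
  have lt: "i0 < ?N" "j0 < ?N" "a < 2 ^ r" "b < 2 ^ r"
    using ij by (auto simp: d power_add less_mult_imp_div_less mult.commute)
  have col: "(\<Sum>l<?M. v (i0 + ?N * z) l * g l) = (\<Sum>l<?N. u i0 l * g (l + ?N * z))" if "z < ?K" "i0 < ?N" for z i0 g
  proof -
    have "(\<Sum>l<?M. v (i0 + ?N * z) l * g l) = (\<Sum>l<?N. \<Sum>z'<?K. if z' = z then u i0 l * g (l + ?N * z) else 0)"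
      unfolding M_eq sum_pow2_add using that by (intro sum.cong refl) (auto simp: u)
    then show ?thesis using that by simp
  qed
  have col': "(\<Sum>l<?M. g l * cnj (v (j0 + ?N * z) l)) = (\<Sum>l<?N. g (l + ?N * z) * cnj (u j0 l))" if "z < ?K" for z g
    using arg_cong [OF col [OF that lt(2), of "\<lambda>l. cnj (g l)"], of cnj] by (simp add: mult.commute)
  have "Out v i j = (\<Sum>z<?K. \<Sum>l'<?M. (\<Sum>l<?M. v (i0 + ?N * z) l * joint_state (l + ?M * a) (l' + ?M * b)) * cnj (v (j0 + ?N * z) l'))"
    unfolding Out_def d by (simp add: sum_distrib_right)
  also have "\<dots> = (\<Sum>z<?K. \<Sum>l'<?N. (\<Sum>l<?N. u i0 l * joint_state (l + ?N * z + ?M * a) (l' + ?N * z + ?M * b)) * cnj (u j0 l'))"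
  proof (rule sum.cong [OF refl])
    fix z assume "z \<in> {..<?K}"
    then have z: "z < ?K" by simp
    show "(\<Sum>l'<?M. (\<Sum>l<?M. v (i0 + ?N * z) l * joint_state (l + ?M * a) (l' + ?M * b)) * cnj (v (j0 + ?N * z) l'))
      = (\<Sum>l'<?N. (\<Sum>l<?N. u i0 l * joint_state (l + ?N * z + ?M * a) (l' + ?N * z + ?M * b)) * cnj (u j0 l'))"
      unfolding col' [OF z] col [OF z lt(1)] ..
  qed
  also have "\<dots> = (\<Sum>z<?K. \<Sum>l'<?N. (\<Sum>l<?N. u i0 l * (Xi (l + ?N * a) (l' + ?N * b) * sample_prod z z)) * cnj (u j0 l'))"
    using lt by (intro sum.cong refl) (simp add: joint_state_eq)
  also have "\<dots> = (\<Sum>z<?K. sample_prod z z * (\<Sum>l'<?N. (\<Sum>l<?N. u i0 l * Xi (l + ?N * a) (l' + ?N * b)) * cnj (u j0 l')))"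
    by (simp add: sum_distrib_left sum_distrib_right mult_ac)
  also have "\<dots> = (\<Sum>l'<?N. (\<Sum>l<?N. u i0 l * Xi (l + ?N * a) (l' + ?N * b)) * cnj (u j0 l'))"
    unfolding sum_distrib_right [symmetric] sample_prod_trace by simp
  finally show ?thesis by (simp add: ext_map_def uchan_def mprod_def adj_def d)
qed

text \<open>For fixed reference indices, \<open>joint_state\<close> is the corresponding block of
  \<open>Xi\<close> tensored with the samples, which is the state fed into a samplized
  circuit.\<close>

lemma Out_samples:
  assumes om: "\<And>z z'. z < 2 ^ (BL * n) \<Longrightarrow> z' < 2 ^ (BL * n) \<Longrightarrow> om z z' = sample_prod z z'"
    and ij: "i < 2 ^ (N + r)" "j < 2 ^ (N + r)"
  shows "Out v i j = ext_map N (\<lambda>Y. ptrace N M (uchan (2 ^ M) v (tensor N Y om))) Xi i j"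
proof -
  let ?N = "2 ^ N :: nat" and ?M = "2 ^ M :: nat" and ?K = "2 ^ (BL * n) :: nat"
  define a b where d: "a = i div ?N" "b = j div ?N"
  have lt: "a < 2 ^ r" "b < 2 ^ r"
    using ij by (auto simp: d power_add less_mult_imp_div_less mult.commute)
  have e: "joint_state (l + ?M * a) (l' + ?M * b) = tensor N (\<lambda>i j. Xi (i + ?N * a) (j + ?N * b)) om l l'" if l: "l < ?M" "l' < ?M" for l l'
  proof -
    have q: "l div ?N < ?K" "l' div ?N < ?K"
      using l by (auto simp: M_eq power_add less_mult_imp_div_less mult.commute)
    have "joint_state (l mod ?N + ?N * (l div ?N) + ?M * a) (l' mod ?N + ?N * (l' div ?N) + ?M * b)
       = Xi (l mod ?N + ?N * a) (l' mod ?N + ?N * b) * sample_prod (l div ?N) (l' div ?N)"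
      using q lt by (intro joint_state_eq) auto
    then show ?thesis using q by (simp add: tensor_def om)
  qed
  have MN: "M - N = BL * n" by (simp add: M_eq)
  show ?thesis
    unfolding ext_map_def ptrace_def uchan_def mprod_def adj_def MN Out_def d [symmetric]
    by (intro sum.cong refl) (simp add: sum_distrib_right e)
qed

end

section \<open>Compiling query algorithms\<close>

text \<open>Flattens the nested tensor products of \<open>tpow\<close> and
  \<open>sample_state\<close>: factor b reads the b-th digit in base \<open>2 ^ n\<close>.\<close>

definition blocks_state :: "nat \<Rightarrow> cmat list \<Rightarrow> cmat" where
  "blocks_state n ts = (\<lambda>z z'. \<Prod>b<length ts. (ts ! b) ((z div 2 ^ (b * n)) mod 2 ^ n) ((z' div 2 ^ (b * n)) mod 2 ^ n))"

lemma mod_block: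
  fixes z :: nat
  assumes "b < L"
  shows "z mod 2 ^ (L * n) div 2 ^ (b * n) mod 2 ^ n = z div 2 ^ (b * n) mod 2 ^ n"
proof -
  have "Suc b * n \<le> L * n" using assms by (intro mult_le_mono) auto
  then show ?thesis
    unfolding take_bit_eq_mod [symmetric] drop_bit_eq_div [symmetric]
    by (intro bit_eqI) (auto simp: bit_take_bit_iff bit_drop_bit_eq)
qed

lemma div_block: "z div 2 ^ (L * n) div 2 ^ (b * n) = z div 2 ^ ((L + b) * n)" for z :: nat
  by (simp add: div_mult2_eq [symmetric] power_add [symmetric] distrib_right)

lemma blocks_state_append:
  "tensor (length ts * n) (blocks_state n ts) (blocks_state n us) = blocks_state n (ts @ us)"
proof (intro ext)
  fix z z'
  let ?b = "\<lambda>b x. (x div 2 ^ (b * n)) mod 2 ^ n :: nat"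
  have "blocks_state n (ts @ us) z z'
     = (\<Prod>b<length ts. (ts ! b) (?b b z) (?b b z')) * (\<Prod>b<length us. (us ! b) (?b (length ts + b) z) (?b (length ts + b) z'))"
  proof -
    have "(\<Prod>b<m + k. f b) = (\<Prod>b<m. f b) * (\<Prod>b<k. f (m + b))" for m k and f :: "nat \<Rightarrow> complex"
      by (induction k) (simp_all add: mult.assoc)
    then show ?thesis by (simp add: blocks_state_def nth_append)
  qed
  then show "tensor (length ts * n) (blocks_state n ts) (blocks_state n us) z z' = blocks_state n (ts @ us) z z'"
    by (simp add: tensor_def blocks_state_def mod_block div_block)
qed

lemma tpow_blocks: "tpow n s \<rho> = blocks_state n (replicate s \<rho>)"
proof (induction s)
  case 0
  then show ?case by (simp add: blocks_state_def)
next
  case (Suc s)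
  have "tensor n \<rho> Y = tensor (length [\<rho>] * n) (blocks_state n [\<rho>]) Y" for Y
    by (intro ext) (simp add: tensor_def blocks_state_def)
  then have "tpow n (Suc s) \<rho> = tensor (length [\<rho>] * n) (blocks_state n [\<rho>]) (blocks_state n (replicate s \<rho>))"
    using Suc by simp
  then show ?case unfolding blocks_state_append by simp
qed

definition sample_list :: "(nat \<Rightarrow> nat) \<Rightarrow> (nat \<Rightarrow> cmat) \<Rightarrow> nat list \<Rightarrow> cmat list" where
  "sample_list s \<rho> js = concat (map (\<lambda>j. replicate (s j) (\<rho> j)) js)"

lemma sample_state_blocks: "sample_state n s \<rho> js = blocks_state n (sample_list s \<rho> js)"
proof (induction js)
  case Nil
  then show ?case by (simp add: blocks_state_def sample_list_def)
next
  case (Cons j js)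
  have "sample_state n s \<rho> (j # js)
      = tensor (length (replicate (s j) (\<rho> j)) * n) (blocks_state n (replicate (s j) (\<rho> j))) (blocks_state n (sample_list s \<rho> js))"
    using Cons by (simp add: tpow_blocks)
  then show ?case unfolding blocks_state_append by (simp add: sample_list_def)
qed

lemma length_sample_list: "length (sample_list s \<rho> [0..<k]) = (\<Sum>j<k. s j)"
  by (induction k) (simp_all add: sample_list_def)

lemma sample_list_nth:
  assumes "j < k" "i < s j"
  shows "sample_list s \<rho> [0..<k] ! ((\<Sum>i<j. s i) + i) = \<rho> j"
proof -
  have "[0..<k] = [0..<j] @ j # [Suc j..<k]"
    using assms upt_add_eq_append [of 0 j "k - j"] by (simp add: upt_conv_Cons)
  then have "sample_list s \<rho> [0..<k] = sample_list s \<rho> [0..<j] @ replicate (s j) (\<rho> j) @ sample_list s \<rho> [Suc j..<k]"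
    by (simp add: sample_list_def)
  then show ?thesis using assms(2) by (simp add: nth_append length_sample_list)
qed

lemma set_sample_list: "set (sample_list s \<rho> [0..<k]) \<subseteq> \<rho> ` {..<k}"
  by (auto simp: sample_list_def)

text \<open>\<open>\<rho>/2 - i X sqrt (1 - \<rho>\<^sup>2/4)\<close>, for \<open>\<rho>\<close> with eigenbasis \<open>B\<close> and eigenvalues \<open>l\<close>; this is
  \<open>-iX exp (i X arcsin (\<rho>/2))\<close>.\<close>

definition enc_unitary :: "nat \<Rightarrow> cmat \<Rightarrow> (nat \<Rightarrow> real) \<Rightarrow> cmat" where
  "enc_unitary n B l = (\<lambda>i j. tensor n (fun_calc (2 ^ n) B (\<lambda>m. complex_of_real (l m / 2))) idm i j
     - \<i> * tensor n (fun_calc (2 ^ n) B (\<lambda>m. complex_of_real (sqrt (1 - (l m / 2)\<^sup>2)))) (tensor 1 (flip_mat 0 1) idm) i j)"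

lemma fun_calc_cong: "(\<And>m. m < d \<Longrightarrow> g m = h m) \<Longrightarrow> fun_calc d B g = fun_calc d B h"
  by (intro ext) (simp add: fun_calc_entry)

lemma fun_calc_real_sym:
  assumes "\<And>m. cnj (g m) = g m"
  shows "cnj (fun_calc d B g j i) = fun_calc d B g i j"
proof -
  have "cnj (fun_calc d B g j i) = adj (fun_calc d B g) i j" by (simp add: adj_def)
  then show ?thesis unfolding adj_fun_calc by (simp add: assms)
qed

lemma adj_enc_unitary: "adj (enc_unitary n B l) = (\<lambda>i j. tensor n (fun_calc (2 ^ n) B (\<lambda>m. complex_of_real (l m / 2))) idm i j
     + \<i> * tensor n (fun_calc (2 ^ n) B (\<lambda>m. complex_of_real (sqrt (1 - (l m / 2)\<^sup>2)))) (tensor 1 (flip_mat 0 1) idm) i j)"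
proof (intro ext)
  fix i j
  have "cnj (tensor n (fun_calc (2 ^ n) B g) idm j i) = tensor n (fun_calc (2 ^ n) B g) idm i j"
    "cnj (tensor n (fun_calc (2 ^ n) B g) (tensor 1 (flip_mat 0 1) idm) j i) = tensor n (fun_calc (2 ^ n) B g) (tensor 1 (flip_mat 0 1) idm) i j"
    if "\<And>m. cnj (g m) = g m" for g
    using fun_calc_real_sym [OF that] by (auto simp: tensor_def idm_def flip_mat_def)
  then show "adj (enc_unitary n B l) i j = tensor n (fun_calc (2 ^ n) B (\<lambda>m. complex_of_real (l m / 2))) idm i j
     + \<i> * tensor n (fun_calc (2 ^ n) B (\<lambda>m. complex_of_real (sqrt (1 - (l m / 2)\<^sup>2)))) (tensor 1 (flip_mat 0 1) idm) i j"
    by (simp add: enc_unitary_def adj_def)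
qed

text \<open>With sin \<psi> = l/2 and cos \<psi> = sqrt (1 - l^2/4), multiplying cos + i X sin by
  -iX gives sin - i X cos. X commutes with the rotation; both orders are recorded, since a product
  with the adjoint has to bring the two rotations side by side.\<close>

lemma emb_enc_unitary:
  assumes d: "distinct (sys @ [c] @ rest)" and B: "unitary (2 ^ length sys) B"
    and l: "\<forall>m<2 ^ length sys. 0 \<le> l m \<and> l m \<le> 1"
  defines "\<psi> \<equiv> \<lambda>m. arcsin (l m / 2)"
  shows "emb (sys @ [c] @ rest) (enc_unitary (length sys) B l) = scalar (- \<i>) * flipop c * rot B sys c \<psi>"
    "emb (sys @ [c] @ rest) (enc_unitary (length sys) B l) = rot B sys c \<psi> * (scalar (- \<i>) * flipop c)"
    "emb (sys @ [c] @ rest) (adj (enc_unitary (length sys) B l)) = scalar \<i> * flipop c * rot B sys c (\<lambda>m. - \<psi> m)"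
    "emb (sys @ [c] @ rest) (adj (enc_unitary (length sys) B l)) = rot B sys c (\<lambda>m. - \<psi> m) * (scalar \<i> * flipop c)"
proof -
  let ?ws = "sys @ [c] @ rest"
  have dc: "distinct (sys @ [c])" using d by simp
  define C S where CS: "C = emb_calc B sys (\<lambda>m. complex_of_real (cos (\<psi> m)))" "S = emb_calc B sys (\<lambda>m. complex_of_real (sin (\<psi> m)))"
  have e1: "emb ?ws (tensor (length sys) A idm) = emb sys A" for A
    using emb_append [OF d, of A idm] by (simp add: emb_idm)
  have e2: "emb ?ws (tensor (length sys) A (tensor 1 (flip_mat 0 1) idm)) = emb sys A * flipop c" for A
  proof -
    have "emb ?ws (tensor (length sys) A (tensor 1 (flip_mat 0 1) idm)) = emb sys A * emb ([c] @ rest) (tensor (length [c]) (flip_mat 0 1) idm)"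
      using emb_append [OF d] by simp
    also have "emb ([c] @ rest) (tensor (length [c]) (flip_mat 0 1) idm) = emb [c] (flip_mat 0 1) * emb rest idm"
      using d by (intro emb_append) auto
    finally show ?thesis by (simp add: emb_idm flipop_emb)
  qed
  have ef: "emb_calc B sys (\<lambda>m. complex_of_real (l m / 2)) = S" "emb_calc B sys (\<lambda>m. complex_of_real (sqrt (1 - (l m / 2)\<^sup>2))) = C"
  proof -
    have "sin (\<psi> m) = l m / 2" "cos (\<psi> m) = sqrt (1 - (l m / 2)\<^sup>2)" if "m < 2 ^ length sys" for m
      using l that by (auto simp: \<psi>_def intro!: sin_arcsin cos_arcsin)
    then have "fun_calc (2 ^ length sys) B (\<lambda>m. complex_of_real (l m / 2)) = fun_calc (2 ^ length sys) B (\<lambda>m. complex_of_real (sin (\<psi> m)))"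
      "fun_calc (2 ^ length sys) B (\<lambda>m. complex_of_real (sqrt (1 - (l m / 2)\<^sup>2))) = fun_calc (2 ^ length sys) B (\<lambda>m. complex_of_real (cos (\<psi> m)))"
      by (auto intro!: fun_calc_cong simp del: of_real_divide)
    then show "emb_calc B sys (\<lambda>m. complex_of_real (l m / 2)) = S" "emb_calc B sys (\<lambda>m. complex_of_real (sqrt (1 - (l m / 2)\<^sup>2))) = C"
      by (simp_all add: CS)
  qed
  have U: "emb ?ws (enc_unitary (length sys) B l) = S - scalar \<i> * (C * flipop c)"
    unfolding enc_unitary_def emb_minus emb_scale e1 e2 ef ..
  have U': "emb ?ws (adj (enc_unitary (length sys) B l)) = S + scalar \<i> * (C * flipop c)"
    unfolding adj_enc_unitary emb_add emb_scale e1 e2 ef ..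
  have x: "flipop c * C = C * flipop c" "flipop c * S = S * flipop c" unfolding CS by (simp_all add: emb_calc_flipop [OF B dc])
  have r: "rot B sys c \<psi> = C + scalar \<i> * (S * flipop c)" by (simp add: rot_def CS)
  have r': "rot B sys c (\<lambda>m. - \<psi> m) = C - scalar \<i> * (S * flipop c)"
  proof -
    have "emb_calc B sys (\<lambda>m. complex_of_real (sin (- \<psi> m))) = scalar (- 1) * S"
      unfolding CS emb_scale [symmetric] fun_calc_scale [symmetric] by simp
    then show ?thesis by (simp add: rot_def CS scalar_uminus [symmetric])
  qed
  have ii: "scalar \<i> * (scalar \<i> * Y) = - Y" for Y by (simp add: scalar_mult_left scalar_uminus [symmetric])
  have xs: "flipop c * (scalar \<i> * Y) = scalar \<i> * (flipop c * Y)" "S * (scalar \<i> * Y) = scalar \<i> * (S * Y)" "C * (scalar \<i> * Y) = scalar \<i> * (C * Y)" for Y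
    by (rule scalar_left_comm)+
  have xx: "flipop c * (C * flipop c) = C" "flipop c * (S * flipop c) = S" "S * (flipop c * flipop c) = S"
    by (simp_all add: mult.assoc [symmetric] x) (simp_all add: mult.assoc flipop_flipop)
  have a: "scalar \<i> * flipop c * (C + scalar \<i> * (S * flipop c)) = scalar \<i> * (C * flipop c) - S"
    "scalar \<i> * flipop c * (C - scalar \<i> * (S * flipop c)) = scalar \<i> * (C * flipop c) + S"
    "(C + scalar \<i> * (S * flipop c)) * (scalar \<i> * flipop c) = scalar \<i> * (C * flipop c) - S"
    "(C - scalar \<i> * (S * flipop c)) * (scalar \<i> * flipop c) = scalar \<i> * (C * flipop c) + S"
    by (simp_all add: distrib_left distrib_right left_diff_distrib right_diff_distrib mult.assoc xs xx x ii)
  show "emb ?ws (enc_unitary (length sys) B l) = scalar (- \<i>) * flipop c * rot B sys c \<psi>"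
    "emb ?ws (enc_unitary (length sys) B l) = rot B sys c \<psi> * (scalar (- \<i>) * flipop c)"
    unfolding U r scalar_uminus [symmetric] using a by simp_all
  show "emb ?ws (adj (enc_unitary (length sys) B l)) = scalar \<i> * flipop c * rot B sys c (\<lambda>m. - \<psi> m)"
    "emb ?ws (adj (enc_unitary (length sys) B l)) = rot B sys c (\<lambda>m. - \<psi> m) * (scalar \<i> * flipop c)"
    unfolding U' r' using a by simp_all
qed

text \<open>Checked on wires 0, ..., n + a - 1, where the matrix factors into a phase times X on
  wire n and a rotation. The remaining a - 1 ancillas carry the identity.\<close>

lemma unitary_enc_unitary:
  assumes B: "unitary (2 ^ n) B" and l: "\<And>m. m < 2 ^ n \<Longrightarrow> 0 \<le> l m \<and> l m \<le> 1" and a: "1 \<le> a"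
  shows "unitary (2 ^ (n + a)) (enc_unitary n B l)"
proof -
  define sys where "sys = [0..<n]"
  define rest where "rest = [Suc n..<n + a]"
  have d: "distinct (sys @ [n] @ rest)" and dc: "distinct (sys @ [n])" and ls: "length sys = n"
    by (auto simp: sys_def rest_def)
  have B': "unitary (2 ^ length sys) B" using B ls by simp
  have l': "\<forall>m<2 ^ length sys. 0 \<le> l m \<and> l m \<le> 1" using l ls by simp
  let ?\<psi> = "\<lambda>m. arcsin (l m / 2)"
  have u: "emb (sys @ [n] @ rest) (enc_unitary n B l) = scalar (- \<i>) * flipop n * rot B sys n ?\<psi>"
    "emb (sys @ [n] @ rest) (enc_unitary n B l) = rot B sys n ?\<psi> * (scalar (- \<i>) * flipop n)"
    "emb (sys @ [n] @ rest) (adj (enc_unitary n B l)) = scalar \<i> * flipop n * rot B sys n (\<lambda>m. - ?\<psi> m)"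
    "emb (sys @ [n] @ rest) (adj (enc_unitary n B l)) = rot B sys n (\<lambda>m. - ?\<psi> m) * (scalar \<i> * flipop n)"
    using emb_enc_unitary [OF d B' l'] unfolding ls by blast+
  have sxx: "scalar a * flipop n * (scalar b * flipop n) = scalar (a * b)" for a b
    unfolding mult.assoc scalar_left_comm [of "flipop n"] flipop_flipop by (simp add: scalar_mult)
  have r: "rot B sys n \<theta> * rot B sys n (\<lambda>m. - \<theta> m) = 1" "rot B sys n (\<lambda>m. - \<theta> m) * rot B sys n \<theta> = 1" for \<theta>
    by (simp_all add: rot_add [OF B' dc] rot_zero [OF B' dc])
  have "unitary (2 ^ length (sys @ [n] @ rest)) (enc_unitary n B l)"
  proof (rule unitary_of_emb [OF d])
    have m: "p * q * (s * t) = p * (q * s) * t" for p q s t :: lop by (simp add: mult.assoc)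
    have "emb (sys @ [n] @ rest) (enc_unitary n B l) * emb (sys @ [n] @ rest) (adj (enc_unitary n B l))
      = scalar (- \<i>) * flipop n * rot B sys n ?\<psi> * (rot B sys n (\<lambda>m. - ?\<psi> m) * (scalar \<i> * flipop n))"
      unfolding u(1) u(4) ..
    also have "\<dots> = scalar (- \<i>) * flipop n * (rot B sys n ?\<psi> * rot B sys n (\<lambda>m. - ?\<psi> m)) * (scalar \<i> * flipop n)" by (rule m)
    also have "\<dots> = 1" unfolding r mult_1_right sxx by simp
    finally show "emb (sys @ [n] @ rest) (enc_unitary n B l) * emb (sys @ [n] @ rest) (adj (enc_unitary n B l)) = 1" .
    have "emb (sys @ [n] @ rest) (adj (enc_unitary n B l)) * emb (sys @ [n] @ rest) (enc_unitary n B l)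
      = scalar \<i> * flipop n * rot B sys n (\<lambda>m. - ?\<psi> m) * (rot B sys n ?\<psi> * (scalar (- \<i>) * flipop n))"
      unfolding u(2) u(3) ..
    also have "\<dots> = scalar \<i> * flipop n * (rot B sys n (\<lambda>m. - ?\<psi> m) * rot B sys n ?\<psi>) * (scalar (- \<i>) * flipop n)" by (rule m)
    also have "\<dots> = 1" unfolding r mult_1_right sxx by simp
    finally show "emb (sys @ [n] @ rest) (adj (enc_unitary n B l)) * emb (sys @ [n] @ rest) (enc_unitary n B l) = 1" .
  qed
  moreover have "length (sys @ [n] @ rest) = n + a" using a by (simp add: sys_def rest_def)
  ultimately show ?thesis by (simp only:)
qed

text \<open>X has no diagonal entries, so the block with all ancillas in state 0 is the sine part
  alone, which is exactly \<rho>/2.\<close>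

lemma block_encoding_enc_unitary:
  assumes B: "unitary (2 ^ n) B" and l: "\<And>m. m < 2 ^ n \<Longrightarrow> 0 \<le> l m \<and> l m \<le> 1" and a: "1 \<le> a"
    and \<rho>: "eqm (2 ^ n) \<rho> (fun_calc (2 ^ n) B (\<lambda>m. complex_of_real (l m)))"
  shows "block_encoding n a 1 0 (enc_unitary n B l) (\<lambda>x y. \<rho> x y / 2)"
  unfolding block_encoding_def
proof
  show "unitary (2 ^ (n + a)) (enc_unitary n B l)" by (rule unitary_enc_unitary [OF B l a])
  let ?D = "\<lambda>i j. complex_of_real 1 * enc_unitary n B l i j - \<rho> i j / 2"
  have z: "?D i j = 0" if "i < 2 ^ n" "j < 2 ^ n" for i j
  proof -
    have "fun_calc (2 ^ n) B (\<lambda>m. complex_of_real (l m / 2)) i j = (1/2) * fun_calc (2 ^ n) B (\<lambda>m. complex_of_real (l m)) i j"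
      using fun_calc_scale [of "2 ^ n" B "1/2" "\<lambda>m. complex_of_real (l m)"] by simp
    then show ?thesis using \<rho> that by (simp add: enc_unitary_def tensor_def idm_def flip_mat_def eqm_def)
  qed
  have mv: "mvec (2 ^ n) ?D v i = 0" if "i < 2 ^ n" for v i
    unfolding mvec_def
  proof (rule sum.neutral, rule ballI)
    fix j :: nat assume "j \<in> {..<2 ^ n}"
    then have "?D i j = 0" by (intro z that) simp
    then show "?D i j * v j = 0" by (simp only: mult_zero_left)
  qed
  have "vnorm (2 ^ n) (mvec (2 ^ n) ?D v) = 0" for v
    unfolding vnorm_L2 L2_set_eq_0_iff [OF finite_lessThan] by (intro ballI, subst mv) auto
  \<comment> \<open>A unit vector is needed so that the set under the supremum is {0} rather than
    empty.\<close>
  moreover have "\<exists>v. vnorm (2 ^ n) v = 1"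
  proof
    have "(\<Sum>i<(2::nat) ^ n. (cmod (if i = 0 then 1 else 0))\<^sup>2) = (\<Sum>i<(2::nat) ^ n. if i = 0 then 1 else 0 :: real)"
      by (intro sum.cong) auto
    then show "vnorm (2 ^ n) (\<lambda>i. if i = 0 then 1 else 0) = 1" by (simp add: vnorm_def)
  qed
  ultimately have "{vnorm (2 ^ n) (mvec (2 ^ n) ?D v) |v. vnorm (2 ^ n) v = 1} = {0}" by auto
  then show "opnorm (2 ^ n) ?D \<le> 0" by (simp add: opnorm_def)
qed

section \<open>Compilation of a run of the algorithm\<close>

fun step_lop :: "(nat \<Rightarrow> cmat) \<Rightarrow> step \<Rightarrow> lop" where
  "step_lop U (AGate G ws) = emb ws G"
| "step_lop U (AQuery j dg co ws) = controlled (ctrl_proj co) (emb ws (if dg then adj (U j) else U j))"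

fun step_lop_adj :: "(nat \<Rightarrow> cmat) \<Rightarrow> step \<Rightarrow> lop" where
  "step_lop_adj U (AGate G ws) = emb ws (adj G)"
| "step_lop_adj U (AQuery j dg co ws) = controlled (ctrl_proj co) (emb ws (if dg then U j else adj (U j)))"

fun run_lop :: "(nat \<Rightarrow> cmat) \<Rightarrow> step list \<Rightarrow> lop" where
  "run_lop U [] = 1"
| "run_lop U (s # ss) = run_lop U ss * step_lop U s"

fun run_lop_adj :: "(nat \<Rightarrow> cmat) \<Rightarrow> step list \<Rightarrow> lop" where
  "run_lop_adj U [] = 1"
| "run_lop_adj U (s # ss) = step_lop_adj U s * run_lop_adj U ss"

text \<open>The condition of \<open>valid_alg\<close> on a single step, detached from the record so
  that inductions can run over step lists.\<close>

definition wf_step :: "nat \<Rightarrow> nat \<Rightarrow> (nat \<Rightarrow> nat) \<Rightarrow> step \<Rightarrow> bool" where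
  "wf_step k N ow s = (case s of
       AGate G ws \<Rightarrow> is_gate N (G, ws)
     | AQuery j dg c ws \<Rightarrow> j < k \<and> length ws = ow j \<and> distinct ws \<and> set ws \<subseteq> {..<N} \<and>
          (case c of None \<Rightarrow> True | Some q \<Rightarrow> q < N \<and> q \<notin> set ws))"

lemma rep_step_lop:
  assumes "wf_step k N ow s"
  shows "rep N (step_lop U s) (step_op N U s)" "rep N (step_lop_adj U s) (adj (step_op N U s))"
proof -
  have "rep N (step_lop U s) (step_op N U s) \<and> rep N (step_lop_adj U s) (adj (step_op N U s))"
  proof (cases s)
    case (AGate G ws)
    then show ?thesis using assms by (auto simp: wf_step_def is_gate_def adj_embed intro!: rep_emb)
  next
    case (AQuery j dg co ws)
    show ?thesis
    proof (cases co)
      case None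
      then show ?thesis using assms AQuery by (auto simp: wf_step_def ctrl_proj_def adj_embed intro!: rep_emb)
    next
      case (Some q)
      have "controlled (proj1 q) (emb ws A) = emb (q # ws) (ctrl A)" for A
        using assms AQuery Some by (simp add: wf_step_def emb_ctrl controlled_def)
      then show ?thesis using assms AQuery Some
        by (auto simp: wf_step_def ctrl_proj_def adj_embed adj_ctrl intro!: rep_emb)
    qed
  qed
  then show "rep N (step_lop U s) (step_op N U s)" "rep N (step_lop_adj U s) (adj (step_op N U s))" by auto
qed

lemma rep_run_lop: "\<forall>s\<in>set ss. wf_step k N ow s \<Longrightarrow> rep N (run_lop U ss) (run_steps N U ss)"
  by (induction ss) (auto intro!: rep_one rep_mult rep_step_lop)

lemma rep_run_lop_adj: "\<forall>s\<in>set ss. wf_step k N ow s \<Longrightarrow> rep N (run_lop_adj U ss) (adj (run_steps N U ss))"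
  by (induction ss) (auto intro!: rep_one rep_mult rep_step_lop simp: adj_idm adj_mprod)

definition sample_wires :: "nat \<Rightarrow> nat \<Rightarrow> nat \<Rightarrow> nat list" where
  "sample_wires N n b = [N + b * n..<N + b * n + n]"

definition scale_angles :: "real \<Rightarrow> (nat \<times> real) list \<Rightarrow> (nat \<times> real) list" where
  "scale_angles s ks = map (\<lambda>(k, \<Delta>). (k, s * \<Delta>)) ks"

text \<open>Of the wires of the oracle, the first n form the system and the next one is the ancilla
  on which X acts; further ancillas stay idle.\<close>

definition query_gates :: "nat \<Rightarrow> nat \<Rightarrow> (nat \<times> real) list \<Rightarrow> bool \<Rightarrow> nat option \<Rightarrow> nat list \<Rightarrow> nat \<Rightarrow> gate list" where
  "query_gates N n ks dg co ws \<beta> =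
     query_circ co (ws ! n) (take n ws) (sample_wires N n) (if dg then -1 else 1) \<beta> (scale_angles (if dg then -1 else 1) ks)"

text \<open>\<open>cnt j\<close> is the first sample block of \<open>\<rho>\<^sub>j\<close> that has not been consumed yet.\<close>

fun compile :: "nat \<Rightarrow> nat \<Rightarrow> (nat \<times> real) list \<Rightarrow> (nat \<Rightarrow> nat) \<Rightarrow> step list \<Rightarrow> gate list" where
  "compile N n ks cnt [] = []"
| "compile N n ks cnt (AGate G ws # ss) = (G, ws) # compile N n ks cnt ss"
| "compile N n ks cnt (AQuery j dg co ws # ss) =
     query_gates N n ks dg co ws (cnt j) @ compile N n ks (cnt(j := cnt j + total_samples ks)) ss"

definition qcount :: "nat \<Rightarrow> step list \<Rightarrow> nat" where
  "qcount j ss = length (filter (is_query_to j) ss)"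

lemma qcount_simps [simp]: "qcount j [] = 0" "qcount j (AGate G ws # ss) = qcount j ss"
  "qcount j (AQuery j' dg co ws # ss) = (if j = j' then Suc (qcount j ss) else qcount j ss)"
  by (auto simp: qcount_def is_query_to_def)

lemma total_samples_scale: "total_samples (scale_angles s ks) = total_samples ks"
  by (induction ks) (auto simp: total_samples_def scale_angles_def)

lemma angle_scale: "angle (scale_angles s ks) l m = s * angle ks l m"
  by (induction ks) (auto simp: angle_def scale_angles_def algebra_simps)

text \<open>A controlled swap costs 7 gates per qubit and each sample is swapped in and out, hence
  14 n per sample. In addition there is one rotation per schedule entry and one final gate per
  query.\<close>

lemma length_compile:
  assumes "\<forall>s\<in>set ss. wf_step k N ow s" "\<forall>j<k. n + 1 \<le> ow j"
  shows "length (compile N n ks cnt ss) = length (filter (\<lambda>s. case s of AGate _ _ \<Rightarrow> True | _ \<Rightarrow> False) ss)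
     + (\<Sum>j<k. qcount j ss) * (14 * n * total_samples ks + length ks + 1)"
  using assms(1)
proof (induction ss arbitrary: cnt)
  case (Cons s ss)
  show ?case
  proof (cases s)
    case (AGate G ws)
    then show ?thesis using Cons by simp
  next
    case (AQuery j dg co ws)
    then have j: "j < k" "n + 1 \<le> length ws" using Cons.prems assms(2) by (auto simp: wf_step_def)
    have "length (query_gates N n ks dg co ws \<beta>) = 14 * n * total_samples ks + length ks + 1" for \<beta>
      unfolding query_gates_def query_circ_def using j
      by (simp add: length_rotation_gates sample_wires_def total_samples_scale) (simp add: scale_angles_def)
    moreover have "(\<Sum>i<k. qcount i (s # ss)) = Suc (\<Sum>i<k. qcount i ss)"
    proof -
      have "(\<Sum>i<k. qcount i (s # ss)) = (\<Sum>i<k. qcount i ss + (if i = j then 1 else 0))"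
        by (intro sum.cong) (auto simp: AQuery)
      then show ?thesis using j by (simp add: sum.distrib)
    qed
    ultimately show ?thesis using Cons AQuery by simp
  qed
qed simp

context product_state
begin

lemma sample_wires_block: "sample_wires N n = block" by (simp add: fun_eq_iff sample_wires_def block_def)

text \<open>Induction along the steps with \<open>apx_mult\<close>. Gates of the algorithm are
  exact; a query to oracle j consumes the front of the interval reserved for it, so the unconsumed
  intervals shrink and stay disjoint. The errors of \<open>query_apx\<close> add up over all
  queries.\<close>

lemma apx_compile:
  assumes ss: "\<forall>s\<in>set ss. wf_step k N ow s" and ow: "\<forall>j<k. n + 1 \<le> ow j"
    and cnt: "\<And>j. j < k \<Longrightarrow> cnt j + total_samples ks * qcount j ss \<le> BL"
    and ty: "\<And>j b. j < k \<Longrightarrow> cnt j \<le> b \<Longrightarrow> b < cnt j + total_samples ks * qcount j ss \<Longrightarrow> \<tau> b = \<rho> j"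
    and dis: "\<And>i j. i < k \<Longrightarrow> j < k \<Longrightarrow> i \<noteq> j \<Longrightarrow>
        {cnt i..<cnt i + total_samples ks * qcount i ss} \<inter> {cnt j..<cnt j + total_samples ks * qcount j ss} = {}"
    and B: "\<And>j. j < k \<Longrightarrow> unitary (2 ^ n) (B j)"
    and \<rho>: "\<And>j. j < k \<Longrightarrow> eqm (2 ^ n) (\<rho> j) (fun_calc (2 ^ n) (B j) (\<lambda>m. complex_of_real (l j m)))"
    and l: "\<And>j m. j < k \<Longrightarrow> m < 2 ^ n \<Longrightarrow> 0 \<le> l j m \<and> l j m \<le> 1"
    and ks: "\<And>p. p \<in> set ks \<Longrightarrow> \<bar>snd p\<bar> \<le> 1"
    and r: "\<And>x. 0 \<le> x \<Longrightarrow> x \<le> 1 \<Longrightarrow> \<bar>(\<Sum>p\<leftarrow>ks. snd p * x ^ fst p) - arcsin (x / 2)\<bar> \<le> rr" "0 \<le> rr"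
  defines "U \<equiv> \<lambda>j. enc_unitary n (B j) (l j)"
  shows "wf_gates (M + r) (compile N n ks cnt ss) \<and>
    apx (\<Union>j<k. {cnt j..<cnt j + total_samples ks * qcount j ss}) (circ_lop (compile N n ks cnt ss)) (circ_lop_adj (compile N n ks cnt ss))
      (run_lop U ss) (run_lop_adj U ss) (real (\<Sum>j<k. qcount j ss) * ((\<Sum>p\<leftarrow>ks. 8 * (snd p)\<^sup>2) + 4 * rr))"
  using ss cnt ty dis
proof (induction ss arbitrary: cnt)
  case Nil
  have "apx {} 1 1 1 1 0" by (intro apx_exact op_bound_one free_one)
  then show ?case by simp
next
  case (Cons s ss)
  have Mw: "M + r \<ge> N" by (simp add: M_def)
  show ?case
  proof (cases s)
    case (AGate G ws)
    have g: "is_gate N (G, ws)" using Cons.prems(1) AGate by (simp add: wf_step_def)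
    then have g': "is_gate (M + r) (G, ws)" using Mw by (auto simp: is_gate_def)
    have a: "apx {} (emb ws G) (emb ws (adj G)) (emb ws G) (emb ws (adj G)) 0"
      using op_bound_gate [OF g'] g by (intro apx_exact free_emb) (auto simp: is_gate_def)
    have IH: "wf_gates (M + r) (compile N n ks cnt ss)"
      "apx (\<Union>j<k. {cnt j..<cnt j + total_samples ks * qcount j ss}) (circ_lop (compile N n ks cnt ss)) (circ_lop_adj (compile N n ks cnt ss))
      (run_lop U ss) (run_lop_adj U ss) (real (\<Sum>j<k. qcount j ss) * ((\<Sum>p\<leftarrow>ks. 8 * (snd p)\<^sup>2) + 4 * rr))"
      using Cons.IH [of cnt] Cons.prems by (simp_all add: AGate)
    have sub: "(\<Union>j<k. {cnt j..<cnt j + total_samples ks * qcount j ss}) \<subseteq> {..<BL}"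
      using Cons.prems(2) by (fastforce simp: AGate)
    show ?thesis using apx_mult [OF a IH(2) _ _ sub] IH(1) g' by (simp add: AGate)
  next
    case (AQuery j dg co ws)
    let ?t = "total_samples ks" and ?\<beta> = "cnt j"
    define cnt' where "cnt' = cnt(j := cnt j + ?t)"
    have w: "j < k" "length ws = ow j" "distinct ws" "set ws \<subseteq> {..<N}" "\<And>q. co = Some q \<Longrightarrow> q < N \<and> q \<notin> set ws"
      using Cons.prems(1) AQuery by (auto simp: wf_step_def)
    define sys c rest where d: "sys = take n ws" "c = ws ! n" "rest = drop (Suc n) ws"
    have nl: "n < length ws" using ow w by auto
    have ws: "ws = sys @ [c] @ rest" using nl by (simp add: d id_take_nth_drop)
    have sys: "length sys = n" "distinct (sys @ [c])" "set (sys @ [c]) \<subseteq> {..<N}"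
    proof -
      show "length sys = n" using nl by (simp add: d)
      have "distinct (sys @ [c] @ rest)" "set (sys @ [c] @ rest) \<subseteq> {..<N}" using w(3,4) ws by metis+
      then show "distinct (sys @ [c])" "set (sys @ [c]) \<subseteq> {..<N}" by auto
    qed
    have co: "q \<notin> set (sys @ [c]) \<and> q < N" if "co = Some q" for q using w(5) [OF that] ws by auto
    have qj: "qcount j (s # ss) = Suc (qcount j ss)" by (simp add: AQuery)
    have qi: "qcount i (s # ss) = qcount i ss" if "i \<noteq> j" for i using that by (simp add: AQuery)
    have un: "{?\<beta>..<?\<beta> + ?t} \<union> (\<Union>i<k. {cnt' i..<cnt' i + ?t * qcount i ss})
        = (\<Union>i<k. {cnt i..<cnt i + ?t * qcount i (s # ss)})"
    proof -
      have jj: "{?\<beta>..<?\<beta> + ?t} \<union> {cnt' j..<cnt' j + ?t * qcount j ss} = {cnt j..<cnt j + ?t * qcount j (s # ss)}"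
        unfolding qj cnt'_def by auto
      have ii: "{cnt' i..<cnt' i + ?t * qcount i ss} = {cnt i..<cnt i + ?t * qcount i (s # ss)}" if "i \<noteq> j" for i
        unfolding qi [OF that] cnt'_def using that by simp
      have s: "(\<Union>i<k. F i) = F j \<union> (\<Union>i\<in>{..<k} - {j}. F i)" for F :: "nat \<Rightarrow> nat set" using w(1) by auto
      show ?thesis unfolding s jj [symmetric] using ii by auto
    qed
    have inc: "{cnt' i..<cnt' i + ?t * qcount i ss} \<subseteq> {cnt i..<cnt i + ?t * qcount i (s # ss)}" for i
      by (cases "i = j") (auto simp: cnt'_def qj qi)
    have IH: "wf_gates (M + r) (compile N n ks cnt' ss) \<and>
      apx (\<Union>j<k. {cnt' j..<cnt' j + ?t * qcount j ss}) (circ_lop (compile N n ks cnt' ss)) (circ_lop_adj (compile N n ks cnt' ss))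
      (run_lop U ss) (run_lop_adj U ss) (real (\<Sum>j<k. qcount j ss) * ((\<Sum>p\<leftarrow>ks. 8 * (snd p)\<^sup>2) + 4 * rr))"
    proof (rule Cons.IH)
      show "\<forall>s\<in>set ss. wf_step k N ow s" using Cons.prems(1) by simp
      show "cnt' i + ?t * qcount i ss \<le> BL" if "i < k" for i
        using Cons.prems(2) [OF that] by (cases "i = j") (auto simp: cnt'_def qj qi)
      show "\<tau> b = \<rho> i" if "i < k" "cnt' i \<le> b" "b < cnt' i + ?t * qcount i ss" for i b
        using Cons.prems(3) [OF that(1), of b] inc [of i] that by (auto simp: subset_iff)
      show "{cnt' i..<cnt' i + ?t * qcount i ss} \<inter> {cnt' j..<cnt' j + ?t * qcount j ss} = {}" if "i < k" "j < k" "i \<noteq> j" for i j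
        using Cons.prems(4) [OF that] inc [of i] inc [of j] by blast
    qed
    define \<sigma> :: complex where "\<sigma> = (if dg then -1 else 1)"
    define sr :: real where "sr = (if dg then -1 else 1)"
    have l1: "0 \<le> l j m" and l2: "l j m \<le> 1" if "m < 2 ^ n" for m using l [OF w(1) that] by auto
    have q: "wf_gates (M + r) (query_circ co c sys block \<sigma> ?\<beta> (scale_angles sr ks)) \<and>
      apx {?\<beta>..<?\<beta> + total_samples (scale_angles sr ks)} (circ_lop (query_circ co c sys block \<sigma> ?\<beta> (scale_angles sr ks)))
       (circ_lop_adj (query_circ co c sys block \<sigma> ?\<beta> (scale_angles sr ks)))
      (controlled (ctrl_proj co) (scalar (- \<i> * \<sigma>) * flipop c * rot (B j) sys c (\<lambda>m. sr * arcsin (l j m / 2))))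
      (controlled (ctrl_proj co) (rot (B j) sys c (\<lambda>m. - (sr * arcsin (l j m / 2))) * (scalar (\<i> * \<sigma>) * flipop c)))
      ((\<Sum>p\<leftarrow>scale_angles sr ks. 8 * (snd p)\<^sup>2) + 4 * rr)"
    proof (rule query_apx [where \<rho> = "\<rho> j" and l = "l j"])
      show "\<bar>snd p\<bar> \<le> 1" if "p \<in> set (scale_angles sr ks)" for p
        using that ks by (force simp: scale_angles_def sr_def)
      show "?\<beta> + total_samples (scale_angles sr ks) \<le> BL"
        using Cons.prems(2) [OF w(1)] by (simp add: total_samples_scale qj)
      show "\<tau> b = \<rho> j" if "?\<beta> \<le> b" "b < ?\<beta> + total_samples (scale_angles sr ks)" for b
        using Cons.prems(3) [OF w(1), of b] that by (simp add: total_samples_scale qj)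
      show "\<bar>angle (scale_angles sr ks) (l j) m - sr * arcsin (l j m / 2)\<bar> \<le> rr" if "m < 2 ^ n" for m
        using r(1) [of "l j m"] l [OF w(1) that] unfolding angle_scale
        by (auto simp: angle_def sr_def abs_minus_commute)
      show "q \<notin> set (sys @ [c]) \<and> q < N" if "co = Some q" for q by (rule co [OF that])
    qed (fact sys B [OF w(1)] \<rho> [OF w(1)] r l1 l2 | simp add: \<sigma>_def)+
    have eq: "(\<Sum>p\<leftarrow>scale_angles sr ks. 8 * (snd p)\<^sup>2) = (\<Sum>p\<leftarrow>ks. 8 * (snd p)\<^sup>2)"
      by (induction ks) (auto simp: scale_angles_def sr_def)
    have gs: "query_gates N n ks dg co ws ?\<beta> = query_circ co c sys block \<sigma> ?\<beta> (scale_angles sr ks)"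
      by (simp add: query_gates_def sample_wires_block d \<sigma>_def sr_def)
    have Bs: "unitary (2 ^ length sys) (B j)" using B [OF w(1)] sys by simp
    have dws: "distinct (sys @ [c] @ rest)" using w(3) ws by metis
    have lm: "\<forall>m<2 ^ length sys. 0 \<le> l j m \<and> l j m \<le> 1" using l [OF w(1)] sys by simp
    note um = emb_enc_unitary [OF dws Bs lm, folded ws, unfolded sys(1)]
    \<comment> \<open>For an adjoint query both signs flip: iX exp(-i X \<psi>) is the adjoint of
      -iX exp(i X \<psi>), as X commutes with the rotation.\<close>
    have t1: "scalar (- \<i> * \<sigma>) * flipop c * rot (B j) sys c (\<lambda>m. sr * arcsin (l j m / 2)) = emb ws (if dg then adj (U j) else U j)"
      using um by (simp add: U_def \<sigma>_def sr_def)
    have t2: "rot (B j) sys c (\<lambda>m. - (sr * arcsin (l j m / 2))) * (scalar (\<i> * \<sigma>) * flipop c) = emb ws (if dg then U j else adj (U j))"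
      using um by (simp add: U_def \<sigma>_def sr_def)
    have d1: "{?\<beta>..<?\<beta> + ?t} \<inter> (\<Union>i<k. {cnt' i..<cnt' i + ?t * qcount i ss}) = {}"
    proof -
      have "{?\<beta>..<?\<beta> + ?t} \<inter> {cnt' i..<cnt' i + ?t * qcount i ss} = {}" if "i < k" for i
      proof (cases "i = j")
        case True
        then show ?thesis by (auto simp: cnt'_def)
      next
        case False
        then have "{cnt i..<cnt i + ?t * qcount i (s # ss)} \<inter> {cnt j..<cnt j + ?t * qcount j (s # ss)} = {}"
          using Cons.prems(4) that w(1) by blast
        moreover have "{?\<beta>..<?\<beta> + ?t} \<subseteq> {cnt j..<cnt j + ?t * qcount j (s # ss)}" unfolding qj by auto
        ultimately show ?thesis using inc [of i] by blast
      qed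
      then show ?thesis by blast
    qed
    have sub: "(\<Union>i<k. {cnt i..<cnt i + ?t * qcount i (s # ss)}) \<subseteq> {..<BL}"
      using Cons.prems(2) by fastforce
    have s1: "{?\<beta>..<?\<beta> + ?t} \<subseteq> {..<BL}" "(\<Union>i<k. {cnt' i..<cnt' i + ?t * qcount i ss}) \<subseteq> {..<BL}"
      using sub unfolding un [symmetric] by auto
    have qq: "wf_gates (M + r) (query_gates N n ks dg co ws ?\<beta>)"
      "apx {?\<beta>..<?\<beta> + ?t} (circ_lop (query_gates N n ks dg co ws ?\<beta>)) (circ_lop_adj (query_gates N n ks dg co ws ?\<beta>))
        (step_lop U s) (step_lop_adj U s) ((\<Sum>p\<leftarrow>ks. 8 * (snd p)\<^sup>2) + 4 * rr)"
      using q unfolding gs [symmetric] eq total_samples_scale t1 t2 by (simp_all add: AQuery)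
    have sum: "(\<Sum>i<k. qcount i (s # ss)) = Suc (\<Sum>i<k. qcount i ss)"
    proof -
      have "(\<Sum>i<k. qcount i (s # ss)) = (\<Sum>i<k. qcount i ss + (if i = j then 1 else 0))"
        by (intro sum.cong) (auto simp: AQuery)
      then show ?thesis using w(1) by (simp add: sum.distrib)
    qed
    have cc: "compile N n ks cnt (s # ss) = query_gates N n ks dg co ws ?\<beta> @ compile N n ks cnt' ss"
      by (simp add: AQuery cnt'_def)
    show ?thesis
      using apx_mult [OF qq(2) IH [THEN conjunct2] d1 s1] qq(1) IH
      unfolding cc sum un circ_lop_append circ_lop_adj_append by (simp add: algebra_simps)
  qed
qed

end

section \<open>The rotation schedule\<close>

text \<open>\<open>arcsin (z / 2)\<close> is holomorphic for \<open>|z| < 2\<close>, so Cauchy's estimate on \<open>|z| = 3/2\<close> gives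
  geometrically decaying coefficients.\<close>

lemma arcsin_half_series:
  obtains a :: "nat \<Rightarrow> real" and C :: real where "1 \<le> C" "\<And>k. \<bar>a k\<bar> \<le> C * (2/3) ^ k"
    "\<And>x. 0 \<le> x \<Longrightarrow> x \<le> 1 \<Longrightarrow> (\<lambda>k. a k * x ^ k) sums arcsin (x / 2)"
proof -
  define f where "f = (\<lambda>z::complex. Arcsin (z / 2))"
  have hol: "f holomorphic_on ball 0 2"
  proof -
    have "Arcsin holomorphic_on (\<lambda>z. z / 2) ` ball 0 2"
    proof (rule holomorphic_on_Arcsin)
      fix z :: complex assume "z \<in> (\<lambda>z. z / 2) ` ball 0 2"
      then have "norm z < 1" by (auto simp: norm_divide)
      then show "\<bar>Re z\<bar> < 1" using abs_Re_le_cmod [of z] by linarith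
    qed
    then have "(Arcsin \<circ> (\<lambda>z. z / 2)) holomorphic_on ball 0 2"
      by (intro holomorphic_on_compose) (auto intro!: holomorphic_intros)
    then show ?thesis by (simp add: f_def o_def)
  qed
  have sub: "cball (0::complex) (3/2) \<subseteq> ball 0 2" by auto
  have cont: "continuous_on (cball 0 (3/2)) f"
    using holomorphic_on_imp_continuous_on [OF hol] continuous_on_subset sub by blast
  have "compact (f ` cball 0 (3/2))" by (intro compact_continuous_image cont) simp
  then obtain b where b: "\<And>z. z \<in> cball 0 (3/2) \<Longrightarrow> norm (f z) \<le> b"
    using compact_imp_bounded bounded_iff by (metis image_eqI)
  define C where "C = max b 1"
  \<comment> \<open>Real parts suffice: for real x the real part of the sum is already the real
    arcsine.\<close>
  define a where "a = (\<lambda>k. Re ((deriv ^^ k) f 0 / fact k))"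
  show ?thesis
  proof (rule that [of C a])
    show "1 \<le> C" by (simp add: C_def)
    fix k
    have "norm ((deriv ^^ k) f 0) \<le> fact k * C / (3/2) ^ k"
    proof (rule Cauchy_inequality)
      show "f holomorphic_on ball 0 (3/2)" using hol by (rule holomorphic_on_subset) auto
      show "continuous_on (cball 0 (3/2)) f" by (rule cont)
      show "norm (f x) \<le> C" if "norm (0 - x) = 3/2" for x using b [of x] that by (simp add: C_def)
    qed simp
    then have "norm ((deriv ^^ k) f 0 / fact k) \<le> C / (3/2) ^ k"
      by (simp add: norm_divide field_simps)
    then have "\<bar>a k\<bar> \<le> C / (3/2) ^ k" unfolding a_def using abs_Re_le_cmod order_trans by blast
    also have "\<dots> = C * (2/3) ^ k" by (simp add: power_divide)
    finally show "\<bar>a k\<bar> \<le> C * (2/3) ^ k" .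
  next
    fix x :: real assume x: "0 \<le> x" "x \<le> 1"
    have "(\<lambda>n. (deriv ^^ n) f 0 / fact n * (complex_of_real x - 0) ^ n) sums f (complex_of_real x)"
      using x by (intro holomorphic_power_series [OF hol]) auto
    then have "(\<lambda>n. Re ((deriv ^^ n) f 0 / fact n * (complex_of_real x) ^ n)) sums Re (f (complex_of_real x))"
      by (intro sums_Re) simp
    moreover have "Re (f (complex_of_real x)) = arcsin (x / 2)"
      using x arcsin_eq_Re_Arcsin [of "x / 2"] by (simp add: f_def)
    moreover have "Re (c * complex_of_real x ^ n) = Re c * x ^ n" for c n
      by (simp flip: of_real_power)
    ultimately show "(\<lambda>k. a k * x ^ k) sums arcsin (x / 2)" unfolding a_def by (simp only:)
  qed
qed

lemma sum_list_concat: "sum_list (map g (concat xss)) = (\<Sum>xs\<leftarrow>xss. sum_list (map g xs))" for g :: "'a \<Rightarrow> real"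
  by (induction xss) auto

text \<open>Term \<open>a\<^sub>k x\<^sup>k\<close> of the series is split into \<open>T\<close> equal rotations, for \<open>k < K\<close>.  Their second-order errors
  add up to \<open>O(1/T)\<close>, the truncation costs \<open>O((2/3)\<^sup>K)\<close>.\<close>

lemma schedule_exists:
  obtains ks :: "real \<Rightarrow> (nat \<times> real) list" and rr :: "real \<Rightarrow> real" and c :: real where "0 < c"
    "\<And>y p. 1/2 \<le> y \<Longrightarrow> p \<in> set (ks y) \<Longrightarrow> \<bar>snd p\<bar> \<le> 1"
    "\<And>y. 1/2 \<le> y \<Longrightarrow> 0 \<le> rr y"
    "\<And>y x. 1/2 \<le> y \<Longrightarrow> 0 \<le> x \<Longrightarrow> x \<le> 1 \<Longrightarrow> \<bar>(\<Sum>p\<leftarrow>ks y. snd p * x ^ fst p) - arcsin (x / 2)\<bar> \<le> rr y"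
    "\<And>y. 1/2 \<le> y \<Longrightarrow> (\<Sum>p\<leftarrow>ks y. 8 * (snd p)\<^sup>2) + 4 * rr y \<le> 1 / y"
    "\<And>y. 1/2 \<le> y \<Longrightarrow> real (total_samples (ks y)) \<le> c * y * (ln (2 + y))\<^sup>2"
    "\<And>y. 1/2 \<le> y \<Longrightarrow> real (length (ks y)) \<le> c * y * (ln (2 + y))\<^sup>2"
    "\<And>y. 1/2 \<le> y \<Longrightarrow> 1 \<le> c * y * (ln (2 + y))\<^sup>2"
proof -
  obtain a C where C1: "1 \<le> C" and aC: "\<And>k. \<bar>a k\<bar> \<le> C * (2/3) ^ k"
    and ser: "\<And>x. 0 \<le> x \<Longrightarrow> x \<le> 1 \<Longrightarrow> (\<lambda>k. a k * x ^ k) sums arcsin (x / 2)"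
    by (rule arcsin_half_series) blast
  \<comment> \<open>K is chosen so that (3/2)^K is at least 24 C (2 + y), which puts 4
    \<open>rr y\<close> = 12 C (2/3)^K below 1/(2y). Since 24 C = 2^p \<le> (2 + y)^p, this holds
    once K is at least (1 + p) ln (2 + y) / ln (3/2).\<close>
  define p where "p = ln (24 * C) / ln 2"
  define C3 where "C3 = (1 + p) / ln (3/2)"
  \<comment> \<open>The squared angles sum to at most 2 C^2 / T by geometric decay; weighted by 8
    they give 16 C^2 / T, which this choice keeps below 1/(2y). It also keeps every single angle at
    most 1.\<close>
  define T where "T = (\<lambda>y::real. nat \<lceil>64 * C\<^sup>2 * y\<rceil>)"
  define K where "K = (\<lambda>y::real. nat \<lceil>C3 * ln (2 + y)\<rceil>)"
  define ks where "ks = (\<lambda>y. concat (map (\<lambda>k. replicate (T y) (k, a k / real (T y))) [0..<K y]))"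
  \<comment> \<open>The geometric tail: C (2/3)^K / (1 - 2/3).\<close>
  define rr where "rr = (\<lambda>y. 3 * C * (2/3) ^ K y)"
  define c where "c = (64 * C\<^sup>2 + 2) * (C3 + 2)\<^sup>2"
  have p0: "0 \<le> p" using C1 by (simp add: p_def)
  have l32: "0 < ln (3/2 :: real)" by simp
  have C3: "0 < C3" using p0 l32 by (simp add: C3_def)
  have lnb: "1/2 \<le> ln (2 + y)" if "1/2 \<le> y" for y :: real
  proof -
    have "1/2 \<le> ln (2::real)" using ln2_ge_two_thirds by linarith
    also have "\<dots> \<le> ln (2 + y)" using that by simp
    finally show ?thesis .
  qed
  have C2: "1 \<le> C\<^sup>2" "C \<le> C\<^sup>2"
    using C1 power_increasing [of 1 2 C] by (simp_all add: one_le_power)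
  have Tlo: "64 * C\<^sup>2 * y \<le> real (T y)" for y unfolding T_def by linarith
  have T0: "C \<le> real (T y)" "0 < real (T y)" if "1/2 \<le> y" for y
  proof -
    have "64 * C\<^sup>2 * (1/2) \<le> 64 * C\<^sup>2 * y" using that C2 by (intro mult_left_mono) auto
    then show "C \<le> real (T y)" using Tlo [of y] C2 by linarith
    then show "0 < real (T y)" using C1 by linarith
  qed
  have Thi: "real (T y) \<le> (64 * C\<^sup>2 + 2) * y" if "1/2 \<le> y" for y
  proof -
    have "0 \<le> 64 * C\<^sup>2 * y" using that by simp
    then have "real (T y) \<le> 64 * C\<^sup>2 * y + 1" unfolding T_def by linarith
    also have "\<dots> \<le> (64 * C\<^sup>2 + 2) * y" using that by (simp add: algebra_simps)
    finally show ?thesis .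
  qed
  have Klo: "C3 * ln (2 + y) \<le> real (K y)" for y unfolding K_def by linarith
  have Kpos: "1 \<le> real (K y)" if "1/2 \<le> y" for y
  proof -
    have "0 < C3 * ln (2 + y)" using C3 lnb [OF that] by simp
    then have "0 < real (K y)" using Klo [of y] by linarith
    then show ?thesis by simp
  qed
  have Khi: "real (K y) \<le> (C3 + 2) * ln (2 + y)" if "1/2 \<le> y" for y
  proof -
    have "0 < C3 * ln (2 + y)" using C3 lnb [OF that] by simp
    then have "real (K y) \<le> C3 * ln (2 + y) + 1" unfolding K_def by linarith
    also have "\<dots> \<le> (C3 + 2) * ln (2 + y)" using lnb [OF that] by (simp add: algebra_simps)
    finally show ?thesis .
  qed
  have len: "length (ks y) = K y * T y" for y
    unfolding ks_def by (simp add: length_concat o_def sum_list_triv)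
  have ssum: "(\<Sum>q\<leftarrow>ks y. g q) = (\<Sum>k<K y. real (T y) * g (k, a k / real (T y)))" for y and g :: "nat \<times> real \<Rightarrow> real"
    unfolding ks_def sum_list_concat
    by (simp add: o_def sum_list_replicate interv_sum_list_conv_sum_set_nat atLeast0LessThan)
  have TK: "real (T y) * (real (K y))\<^sup>2 \<le> c * y * (ln (2 + y))\<^sup>2" if "1/2 \<le> y" for y
  proof -
    have "real (T y) * (real (K y))\<^sup>2 \<le> ((64 * C\<^sup>2 + 2) * y) * ((C3 + 2) * ln (2 + y))\<^sup>2"
      using Thi [OF that] Khi [OF that] that by (intro mult_mono power_mono) auto
    then show ?thesis by (simp add: c_def power_mult_distrib mult_ac)
  qed
  have KK: "real (K y) \<le> (real (K y))\<^sup>2" if "1/2 \<le> y" for y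
    using Kpos [OF that] by (simp add: power2_eq_square)
  show ?thesis
  proof (rule that [of c ks rr])
    show "0 < c" using C3 by (simp add: c_def add_nonneg_pos)
    fix y :: real assume y: "1/2 \<le> y"
    note T0 = T0 [OF y]
    show "0 \<le> rr y" using C1 by (simp add: rr_def)
    {
      fix q assume "q \<in> set (ks y)"
      then obtain k where "snd q = a k / real (T y)" by (auto simp: ks_def)
      moreover have "\<bar>a k\<bar> \<le> real (T y)"
      proof -
        have "C * (2/3) ^ k \<le> C * 1" using C1 by (intro mult_left_mono power_le_one) auto
        then show ?thesis using aC [of k] T0 by linarith
      qed
      ultimately show "\<bar>snd q\<bar> \<le> 1" using T0 by (simp add: abs_divide)
    }
    {
      fix x :: real assume x: "0 \<le> x" "x \<le> 1"
      have s: "(\<Sum>p\<leftarrow>ks y. snd p * x ^ fst p) = (\<Sum>k<K y. a k * x ^ k)"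
        unfolding ssum using T0 by simp
      have "(\<lambda>k. a (k + K y) * x ^ (k + K y)) sums (arcsin (x / 2) - (\<Sum>k<K y. a k * x ^ k))"
        using ser [OF x] by (subst sums_iff_shift) simp
      moreover have "(\<lambda>k. C * (2/3) ^ K y * (2/3) ^ k) sums (C * (2/3) ^ K y * (1 / (1 - 2/3)))"
        by (intro sums_mult geometric_sums) simp
      moreover have "norm (a (k + K y) * x ^ (k + K y)) \<le> C * (2/3) ^ K y * (2/3) ^ k" for k
      proof -
        have "\<bar>a (k + K y)\<bar> * \<bar>x ^ (k + K y)\<bar> \<le> (C * (2/3) ^ (k + K y)) * 1"
          using aC x C1 by (intro mult_mono) (auto simp: power_le_one power_abs)
        then show ?thesis by (simp add: abs_mult power_add mult_ac)
      qed
      ultimately have "norm (arcsin (x / 2) - (\<Sum>k<K y. a k * x ^ k)) \<le> C * (2/3) ^ K y * (1 / (1 - 2/3))"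
        by (metis (no_types, lifting) norm_suminf_le sums_summable sums_unique)
      then show "\<bar>(\<Sum>p\<leftarrow>ks y. snd p * x ^ fst p) - arcsin (x / 2)\<bar> \<le> rr y"
        unfolding s rr_def by (simp add: abs_minus_commute)
    }
    have e1: "(\<Sum>p\<leftarrow>ks y. 8 * (snd p)\<^sup>2) \<le> 1 / (2 * y)"
    proof -
      have "(\<Sum>p\<leftarrow>ks y. 8 * (snd p)\<^sup>2) = (\<Sum>k<K y. 8 / real (T y) * (a k)\<^sup>2)"
        unfolding ssum using T0 by (intro sum.cong refl) (simp add: power_divide power2_eq_square)
      also have "\<dots> \<le> (\<Sum>k<K y. 8 / real (T y) * (C\<^sup>2 * (4/9) ^ k))"
      proof (intro sum_mono mult_left_mono)
        fix k
        have "(a k)\<^sup>2 \<le> (C * (2/3) ^ k)\<^sup>2" using aC [of k] by (metis abs_ge_zero power2_abs power_mono)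
        also have "\<dots> = C\<^sup>2 * ((2/3)\<^sup>2) ^ k" by (simp add: power_mult_distrib power_mult [symmetric] mult.commute)
        finally show "(a k)\<^sup>2 \<le> C\<^sup>2 * (4/9) ^ k" by (simp add: power2_eq_square)
      qed (use T0 in simp)
      also have "\<dots> = 8 / real (T y) * C\<^sup>2 * (\<Sum>k<K y. (4/9) ^ k)"
        unfolding sum_distrib_left by (intro sum.cong refl) simp
      also have "\<dots> \<le> 8 / real (T y) * C\<^sup>2 * 2"
      proof (intro mult_left_mono)
        have "(\<Sum>k<K y. (4/9::real) ^ k) = (1 - (4/9) ^ K y) * (9/5)" by (simp add: sum_gp_strict)
        also have "\<dots> \<le> 1 * (9/5)" by (intro mult_right_mono) auto
        finally show "(\<Sum>k<K y. (4/9::real) ^ k) \<le> 2" by simp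
      qed (use T0 in auto)
      also have "\<dots> \<le> 1 / (2 * y)" using T0 y Tlo [of y] by (simp add: field_simps)
      finally show ?thesis .
    qed
    have e2: "4 * rr y \<le> 1 / (2 * y)"
    proof -
      have "ln (24 * C * (2 + y)) = ln (24 * C) + ln (2 + y)" using C1 y by (intro ln_mult_pos) auto
      also have "ln (24 * C) = p * ln 2" by (simp add: p_def)
      also have "p * ln 2 \<le> p * ln (2 + y)" using p0 y by (intro mult_left_mono) auto
      finally have "ln (24 * C * (2 + y)) \<le> (1 + p) * ln (2 + y)" by (simp add: algebra_simps)
      also have "\<dots> = C3 * ln (2 + y) * ln (3/2)" using l32 by (simp add: C3_def)
      also have "\<dots> \<le> real (K y) * ln (3/2)" using Klo l32 by (intro mult_right_mono) auto
      also have "\<dots> = ln ((3/2) ^ K y)" by (simp add: ln_realpow)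
      finally have "24 * C * (2 + y) \<le> (3/2) ^ K y" using C1 y by (subst (asm) ln_le_cancel_iff) auto
      moreover have "24 * C * y \<le> 24 * C * (2 + y)" using C1 by (intro mult_left_mono) auto
      ultimately have "24 * C * y \<le> (3/2) ^ K y" by linarith
      moreover have "(2/3 :: real) ^ K y = 1 / (3/2) ^ K y" by (simp add: power_divide)
      ultimately show ?thesis using y by (simp add: rr_def field_simps)
    qed
    have "1 / (2 * y) + 1 / (2 * y) = 1 / y" using y by (simp add: field_simps)
    then show "(\<Sum>p\<leftarrow>ks y. 8 * (snd p)\<^sup>2) + 4 * rr y \<le> 1 / y" using e1 e2 by linarith
    have "real (total_samples ps) = (\<Sum>p\<leftarrow>ps. real (fst p))" for ps
      unfolding total_samples_def by (induction ps) auto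
    then have "real (total_samples (ks y)) = (\<Sum>p\<leftarrow>ks y. real (fst p))" .
    also have "\<dots> = (\<Sum>k<K y. real (T y) * real k)" unfolding ssum by simp
    also have "\<dots> \<le> (\<Sum>k<K y. real (T y) * real (K y))" by (intro sum_mono mult_left_mono) auto
    also have "\<dots> = real (T y) * (real (K y))\<^sup>2" by (simp add: power2_eq_square)
    finally show "real (total_samples (ks y)) \<le> c * y * (ln (2 + y))\<^sup>2" using TK [OF y] by linarith
    have "real (length (ks y)) = real (T y) * real (K y)" by (simp add: len)
    also have "\<dots> \<le> real (T y) * (real (K y))\<^sup>2" using KK [OF y] by (intro mult_left_mono) auto
    finally show "real (length (ks y)) \<le> c * y * (ln (2 + y))\<^sup>2" using TK [OF y] by linarith
    have "1 \<le> real (T y) * (real (K y))\<^sup>2"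
    proof -
      have "1 * 1 \<le> real (T y) * (real (K y))\<^sup>2"
        using T0 C1 Kpos [OF y] by (intro mult_mono) (auto simp: one_le_power)
      then show ?thesis by simp
    qed
    then show "1 \<le> c * y * (ln (2 + y))\<^sup>2" using TK [OF y] by linarith
  qed
qed

section \<open>The samplized channel\<close>

definition lift_mat :: "nat \<Rightarrow> cmat \<Rightarrow> cmat" where
  "lift_mat N u = (\<lambda>x l. if x div 2 ^ N = l div 2 ^ N then u (x mod 2 ^ N) (l mod 2 ^ N) else 0)"

lemma adj_lift_mat: "adj (lift_mat N u) = lift_mat N (adj u)"
  by (intro ext) (auto simp: adj_def lift_mat_def)

text \<open>Extends the matrix of the ideal run by the identity on the sample wires, so that one
  functional evaluates both channels.\<close>

lemma rep_lift:
  assumes "rep N V u"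
  shows "rep (N + K) V (lift_mat N u)"
  unfolding rep_def
proof (intro allI impI)
  fix g a and x :: nat assume x: "x < 2 ^ (N + K)"
  let ?i = "x mod 2 ^ N" and ?z = "x div 2 ^ N"
  have z: "?z < 2 ^ K" using x by (simp add: power_add less_mult_imp_div_less mult.commute)
  have "x + 2 ^ (N + K) * a = ?i + 2 ^ N * ?z + 2 ^ (N + K) * a" by simp
  also have "\<dots> = ?i + 2 ^ N * (?z + 2 ^ K * a)" by (simp only: power_add distrib_left mult.assoc add.assoc)
  finally have e: "x + 2 ^ (N + K) * a = ?i + 2 ^ N * (?z + 2 ^ K * a)" .
  have "ap V g (x + 2 ^ (N + K) * a) = (\<Sum>l<2 ^ N. u ?i l * g (l + 2 ^ N * (?z + 2 ^ K * a)))"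
    unfolding e by (rule repD [OF assms]) simp
  also have "\<dots> = (\<Sum>l<2 ^ N. \<Sum>z'<2 ^ K. if z' = ?z then u ?i l * g (l + 2 ^ N * (?z + 2 ^ K * a)) else 0)"
    using z by simp
  also have "\<dots> = (\<Sum>l<2 ^ N. \<Sum>z'<2 ^ K. lift_mat N u x (l + 2 ^ N * z') * g (l + 2 ^ N * z' + 2 ^ (N + K) * a))"
    by (intro sum.cong refl) (auto simp: lift_mat_def power_add algebra_simps)
  also have "\<dots> = (\<Sum>l<2 ^ (N + K). lift_mat N u x l * g (l + 2 ^ (N + K) * a))"
    by (rule sum_pow2_add [symmetric])
  finally show "ap V g (x + 2 ^ (N + K) * a) = (\<Sum>l<2 ^ (N + K). lift_mat N u x l * g (l + 2 ^ (N + K) * a))" .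
qed

text \<open>The zero operator is an admissible input: it makes the supremum in
  \<open>diamond_norm\<close> range over a nonempty set and provides a trivial instance of
  \<open>product_state\<close>.\<close>

lemma trnorm_zero: "trnorm d (\<lambda>i j. 0) \<le> 0"
  by (rule trnorm_le) (simp add: mtrace_def mprod_def)

lemma product_state_sample_list:
  assumes dens: "\<forall>j<k. Defs.density (2 ^ n) (\<rho> j)" and X: "trnorm (2 ^ (N + r)) Xi \<le> 1"
  shows "product_state N n (\<Sum>j<k. s j) r Xi (\<lambda>b. sample_list s \<rho> [0..<k] ! b)"
proof
  show "trnorm (2 ^ (N + r)) Xi \<le> 1" by (rule X)
  fix b assume "b < (\<Sum>j<k. s j)"
  then have "sample_list s \<rho> [0..<k] ! b \<in> set (sample_list s \<rho> [0..<k])"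
    by (intro nth_mem) (simp add: length_sample_list)
  then show "Defs.density (2 ^ n) (sample_list s \<rho> [0..<k] ! b)" using set_sample_list dens by fastforce
qed

text \<open>By duality it suffices to bound the trace of W times the output difference for a
  contraction W on input and reference. Through \<open>phi_Out\<close> this becomes a difference of
  two values of the functional with Z = \<open>emb ws0 W\<close>, which is bounded by 1 and touches
  no sample.\<close>

lemma diamond_norm_le_of_phi:
  assumes dens: "\<forall>j<k. Defs.density (2 ^ n) (\<rho> j)"
    and ss: "\<forall>s\<in>set ss. wf_step k N ow s"
    and gs: "wf_gates (N + (\<Sum>j<k. s j) * n) gs"
    and phi: "\<And>r Xi Z. product_state N n (\<Sum>j<k. s j) r Xi (\<lambda>b. sample_list s \<rho> [0..<k] ! b) \<Longrightarrow>
        op_bound (2 ^ (N + (\<Sum>j<k. s j) * n + r)) Z 1 \<Longrightarrow>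
        sampling.free (product_state.block N n) {..<(\<Sum>j<k. s j)} Z \<Longrightarrow>
        cmod (product_state.phi N n (\<Sum>j<k. s j) r Xi (\<lambda>b. sample_list s \<rho> [0..<k] ! b) (circ_lop_adj gs * Z * circ_lop gs)
          - product_state.phi N n (\<Sum>j<k. s j) r Xi (\<lambda>b. sample_list s \<rho> [0..<k] ! b) (run_lop_adj U ss * Z * run_lop U ss)) \<le> e"
  shows "diamond_norm N (\<lambda>X x y. sc_channel k N n \<lparr>s_cnt = s, anc = 0, sgates = gs\<rparr> \<rho> X x y
            - uchan (2 ^ N) (run_steps N U ss) X x y) \<le> e"
proof -
  let ?BL = "\<Sum>j<k. s j" and ?\<tau> = "\<lambda>b. sample_list s \<rho> [0..<k] ! b"
  let ?F = "sc_channel k N n \<lparr>s_cnt = s, anc = 0, sgates = gs\<rparr> \<rho>" and ?G = "uchan (2 ^ N) (run_steps N U ss)"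
  have "trnorm (2 ^ (N + r)) (ext_map N (\<lambda>X x y. ?F X x y - ?G X x y) Xi) \<le> e" if X: "trnorm (2 ^ (N + r)) Xi \<le> 1" for r Xi
  proof (rule trnorm_le)
    fix W assume W: "mat_bound (2 ^ (N + r)) W 1"
    interpret c: product_state N n ?BL r Xi ?\<tau> by (rule product_state_sample_list [OF dens X])
    let ?d = "2 ^ (N + r) :: nat" and ?Z = "emb c.ws0 W"
    have M: "c.M = N + ?BL * n" by (simp add: c.M_def)
    have wf: "wf_gates c.M gs" using gs by (simp add: M)
    have m1: "mtrace ?d (mprod ?d W (c.Out (circ c.M gs))) = c.phi (circ_lop_adj gs * ?Z * circ_lop gs)"
      by (rule c.phi_Out [symmetric]) (intro rep_circ_lop rep_circ_lop_adj wf)+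
    have m2: "mtrace ?d (mprod ?d W (c.Out (lift_mat N (run_steps N U ss)))) = c.phi (run_lop_adj U ss * ?Z * run_lop U ss)"
      unfolding M
      by (rule c.phi_Out [symmetric]) (auto simp: M adj_lift_mat intro!: rep_lift rep_run_lop [OF ss] rep_run_lop_adj [OF ss])
    have o1: "c.Out (circ c.M gs) i j = ext_map N ?F Xi i j" if "i < ?d" "j < ?d" for i j
    proof -
      have Fe: "?F = (\<lambda>Y. ptrace N c.M (uchan (2 ^ c.M) (circ c.M gs)
          (tensor N Y (tensor (?BL * n) (sample_state n s \<rho> [0..<k]) zero_state))))"
        by (simp add: fun_eq_iff sc_channel_def sc_width_def M Let_def)
      have om: "tensor (?BL * n) (sample_state n s \<rho> [0..<k]) zero_state z z' = c.sample_prod z z'"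
        if "z < 2 ^ (?BL * n)" "z' < 2 ^ (?BL * n)" for z z'
        using that by (simp add: tensor_def zero_state_def sample_state_blocks blocks_state_def length_sample_list c.sample_prod_def)
      show ?thesis unfolding Fe by (rule c.Out_samples) (use om that in auto)
    qed
    have o2: "c.Out (lift_mat N (run_steps N U ss)) i j = ext_map N ?G Xi i j" if "i < ?d" "j < ?d" for i j
      using that by (intro c.Out_unused) (auto simp: lift_mat_def)
    have sub: "mtrace ?d (mprod ?d W (ext_map N (\<lambda>X x y. ?F X x y - ?G X x y) Xi))
      = mtrace ?d (mprod ?d W (ext_map N ?F Xi)) - mtrace ?d (mprod ?d W (ext_map N ?G Xi))"
      by (simp add: mtrace_def mprod_def ext_map_def right_diff_distrib sum_subtractf)
    have mcong: "mtrace ?d (mprod ?d W A) = mtrace ?d (mprod ?d W A')" if "\<And>i j. i < ?d \<Longrightarrow> j < ?d \<Longrightarrow> A i j = A' i j" for A A'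
      using that by (simp add: mtrace_def mprod_def)
    have eq: "mtrace ?d (mprod ?d W (ext_map N (\<lambda>X x y. ?F X x y - ?G X x y) Xi))
       = c.phi (circ_lop_adj gs * ?Z * circ_lop gs) - c.phi (run_lop_adj U ss * ?Z * run_lop U ss)"
      unfolding sub m1 [symmetric] m2 [symmetric]
      by (intro arg_cong2 [where f = "(-)"] mcong o1 [symmetric] o2 [symmetric])
    have "op_bound (2 ^ (c.M + r)) ?Z 1"
      using W c.ws0_props by (intro op_bound_emb) auto
    moreover have "c.free {..<?BL} ?Z"
      unfolding c.free_def using c.block_props(5) by (auto intro!: commutes_emb)
    ultimately show "cmod (mtrace ?d (mprod ?d W (ext_map N (\<lambda>X x y. ?F X x y - ?G X x y) Xi))) \<le> e"
      unfolding eq using phi [OF c.product_state_axioms] by (simp add: M)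
  qed
  moreover have "trnorm (2 ^ (N + 0)) (\<lambda>i j. 0) \<le> 1" using trnorm_zero [of "2 ^ (N + 0)"] by simp
  ultimately show ?thesis unfolding diamond_norm_def by (intro cSup_least) blast+
qed

context
  fixes k n N :: nat and ow :: "nat \<Rightarrow> nat" and ss :: "step list" and \<rho> :: "nat \<Rightarrow> cmat"
    and B :: "nat \<Rightarrow> cmat" and l :: "nat \<Rightarrow> nat \<Rightarrow> real"
  assumes ss: "\<forall>s\<in>set ss. wf_step k N ow s" and ow: "\<forall>j<k. n + 1 \<le> ow j"
    and dens: "\<forall>j<k. Defs.density (2 ^ n) (\<rho> j)"
    and B: "\<forall>j<k. unitary (2 ^ n) (B j)"
    and \<rho>: "\<forall>j<k. eqm (2 ^ n) (\<rho> j) (fun_calc (2 ^ n) (B j) (\<lambda>m. complex_of_real (l j m)))"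
    and l: "\<forall>j<k. \<forall>m<2 ^ n. 0 \<le> l j m \<and> l j m \<le> 1"
begin

text \<open>The counters start at the partial sums of the sample numbers, which is where the samples
  of \<rho>_j begin in the register.\<close>

lemma samplized_apx:
  fixes ks :: "(nat \<times> real) list"
  defines "s \<equiv> \<lambda>j. total_samples ks * qcount j ss"
  assumes ks: "\<forall>p\<in>set ks. \<bar>snd p\<bar> \<le> 1"
    and r: "\<forall>x. 0 \<le> x \<and> x \<le> 1 \<longrightarrow> \<bar>(\<Sum>p\<leftarrow>ks. snd p * x ^ fst p) - arcsin (x / 2)\<bar> \<le> rr" "0 \<le> rr"
    and product_state: "product_state N n (\<Sum>j<k. s j) rf Xi (\<lambda>b. sample_list s \<rho> [0..<k] ! b)"
  shows "wf_gates (product_state.M N n (\<Sum>j<k. s j) + rf) (compile N n ks (\<lambda>j. \<Sum>i<j. s i) ss) \<and>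
    sampling.apx (product_state.phi N n (\<Sum>j<k. s j) rf Xi (\<lambda>b. sample_list s \<rho> [0..<k] ! b))
      (product_state.M N n (\<Sum>j<k. s j) + rf) (\<Sum>j<k. s j) (product_state.block N n)
      (\<Union>j<k. {(\<Sum>i<j. s i)..<(\<Sum>i<j. s i) + total_samples ks * qcount j ss})
      (circ_lop (compile N n ks (\<lambda>j. \<Sum>i<j. s i) ss)) (circ_lop_adj (compile N n ks (\<lambda>j. \<Sum>i<j. s i) ss))
      (run_lop (\<lambda>j. enc_unitary n (B j) (l j)) ss) (run_lop_adj (\<lambda>j. enc_unitary n (B j) (l j)) ss)
      (real (\<Sum>j<k. qcount j ss) * ((\<Sum>p\<leftarrow>ks. 8 * (snd p)\<^sup>2) + 4 * rr))"
proof -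
  let ?BL = "\<Sum>j<k. s j" and ?\<tau> = "\<lambda>b. sample_list s \<rho> [0..<k] ! b"
  interpret c: product_state N n ?BL rf Xi ?\<tau> by (rule product_state)
  have mono: "(\<Sum>i<j. s i) + s j \<le> (\<Sum>i<j'. s i)" if "j < j'" for j j'
  proof -
    have "(\<Sum>i<j. s i) + s j = (\<Sum>i<Suc j. s i)" by simp
    also have "\<dots> \<le> (\<Sum>i<j'. s i)" using that by (intro sum_mono2) auto
    finally show ?thesis .
  qed
  show ?thesis
  proof (rule c.apx_compile [OF ss ow])
    show "(\<Sum>i<j. s i) + total_samples ks * qcount j ss \<le> ?BL" if "j < k" for j
      using mono [OF that] by (simp add: s_def)
    show "?\<tau> b = \<rho> j" if "j < k" "(\<Sum>i<j. s i) \<le> b" "b < (\<Sum>i<j. s i) + total_samples ks * qcount j ss" for j b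
      using sample_list_nth [of j k "b - (\<Sum>i<j. s i)" s \<rho>] that by (simp add: s_def)
    show "{(\<Sum>i<i. s i)..<(\<Sum>i<i. s i) + total_samples ks * qcount i ss} \<inter> {(\<Sum>i<j. s i)..<(\<Sum>i<j. s i) + total_samples ks * qcount j ss} = {}"
      if ij: "i < k" "j < k" "i \<noteq> j" for i j
    proof -
      consider "i < j" | "j < i" using ij(3) by linarith
      then show ?thesis
      proof cases
        case 1
        then show ?thesis using mono [OF 1] by (auto simp: s_def)
      next
        case 2
        then show ?thesis using mono [OF 2] by (auto simp: s_def)
      qed
    qed
  qed (use B \<rho> l ks r in auto)
qed

lemma samplized_circuit:
  fixes ks :: "(nat \<times> real) list"
  defines "s \<equiv> \<lambda>j. total_samples ks * qcount j ss"
  defines "gs \<equiv> compile N n ks (\<lambda>j. \<Sum>i<j. s i) ss"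
  assumes ks: "\<forall>p\<in>set ks. \<bar>snd p\<bar> \<le> 1"
    and r: "\<forall>x. 0 \<le> x \<and> x \<le> 1 \<longrightarrow> \<bar>(\<Sum>p\<leftarrow>ks. snd p * x ^ fst p) - arcsin (x / 2)\<bar> \<le> rr" "0 \<le> rr"
  shows "wf_gates (N + (\<Sum>j<k. s j) * n) gs"
    "diamond_norm N (\<lambda>X x y. sc_channel k N n \<lparr>s_cnt = s, anc = 0, sgates = gs\<rparr> \<rho> X x y
       - uchan (2 ^ N) (run_steps N (\<lambda>j. enc_unitary n (B j) (l j)) ss) X x y)
     \<le> real (\<Sum>j<k. qcount j ss) * ((\<Sum>p\<leftarrow>ks. 8 * (snd p)\<^sup>2) + 4 * rr)"
proof -
  have z: "trnorm (2 ^ (N + 0)) (\<lambda>i j. 0) \<le> 1" using trnorm_zero [of "2 ^ (N + 0)"] by simp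
  note a = samplized_apx [OF ks r, folded s_def, folded gs_def]
  \<comment> \<open>Well-formedness of the circuit does not depend on the input, so it is read off
    the instance with zero input and no reference.\<close>
  interpret c0: product_state N n "\<Sum>j<k. s j" 0 "\<lambda>_ _. 0" "\<lambda>b. sample_list s \<rho> [0..<k] ! b"
    by (rule product_state_sample_list [OF dens z])
  note M = c0.M_def
  show wf: "wf_gates (N + (\<Sum>j<k. s j) * n) gs"
    using a [OF product_state_sample_list [OF dens z]] by (simp add: M)
  show "diamond_norm N (\<lambda>X x y. sc_channel k N n \<lparr>s_cnt = s, anc = 0, sgates = gs\<rparr> \<rho> X x y
       - uchan (2 ^ N) (run_steps N (\<lambda>j. enc_unitary n (B j) (l j)) ss) X x y)
     \<le> real (\<Sum>j<k. qcount j ss) * ((\<Sum>p\<leftarrow>ks. 8 * (snd p)\<^sup>2) + 4 * rr)"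
  proof (rule diamond_norm_le_of_phi [OF dens ss wf])
    fix rf Xi Z
    assume product_state: "product_state N n (\<Sum>j<k. s j) rf Xi (\<lambda>b. sample_list s \<rho> [0..<k] ! b)"
      and Z: "op_bound (2 ^ (N + (\<Sum>j<k. s j) * n + rf)) Z 1" "sampling.free (product_state.block N n) {..<(\<Sum>j<k. s j)} Z"
    interpret c: product_state N n "\<Sum>j<k. s j" rf Xi "\<lambda>b. sample_list s \<rho> [0..<k] ! b" by (rule product_state)
    let ?bs = "\<Union>j<k. {(\<Sum>i<j. s i)..<(\<Sum>i<j. s i) + total_samples ks * qcount j ss}"
    have sub: "?bs \<subseteq> {..<(\<Sum>j<k. s j)}"
    proof -
      have "(\<Sum>i<j. s i) + total_samples ks * qcount j ss \<le> (\<Sum>j<k. s j)" if "j < k" for j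
      proof -
        have "(\<Sum>i<j. s i) + total_samples ks * qcount j ss = (\<Sum>i<Suc j. s i)" by (simp add: s_def)
        also have "\<dots> \<le> (\<Sum>i<k. s i)" using that by (intro sum_mono2) auto
        finally show ?thesis .
      qed
      then show ?thesis by fastforce
    qed
    have Z': "c.free ?bs Z" "op_bound (2 ^ (c.M + rf)) Z 1"
      using Z c.free_mono [OF Z(2) sub] by (simp_all add: M)
    have "cmod (c.phi (1 * (circ_lop_adj gs * Z * circ_lop gs) * 1) - c.phi (1 * (run_lop_adj (\<lambda>j. enc_unitary n (B j) (l j)) ss * Z * run_lop (\<lambda>j. enc_unitary n (B j) (l j)) ss) * 1))
       \<le> real (\<Sum>j<k. qcount j ss) * ((\<Sum>p\<leftarrow>ks. 8 * (snd p)\<^sup>2) + 4 * rr)"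
      using a [OF product_state, THEN conjunct2] Z' c.free_one op_bound_one unfolding c.apx_def by blast
    then show "cmod (c.phi (circ_lop_adj gs * Z * circ_lop gs) - c.phi (run_lop_adj (\<lambda>j. enc_unitary n (B j) (l j)) ss * Z * run_lop (\<lambda>j. enc_unitary n (B j) (l j)) ss))
       \<le> real (\<Sum>j<k. qcount j ss) * ((\<Sum>p\<leftarrow>ks. 8 * (snd p)\<^sup>2) + 4 * rr)" by simp
  qed
qed

text \<open>Both functionals are bounded by 1, so they differ by at most 2. The bounds on the ideal
  run come from \<open>samplized_apx\<close> with the empty schedule.\<close>

lemma empty_circuit:
  "diamond_norm N (\<lambda>X x y. sc_channel k N n \<lparr>s_cnt = (\<lambda>_. 0), anc = 0, sgates = []\<rparr> \<rho> X x y
       - uchan (2 ^ N) (run_steps N (\<lambda>j. enc_unitary n (B j) (l j)) ss) X x y) \<le> 2"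
proof (rule diamond_norm_le_of_phi [OF dens ss])
  fix rf Xi Z
  assume product_state: "product_state N n (\<Sum>j<k. 0) rf Xi (\<lambda>b. sample_list (\<lambda>_. 0) \<rho> [0..<k] ! b)"
    and Z: "op_bound (2 ^ (N + (\<Sum>j<k. 0) * n + rf)) Z 1"
  interpret c: product_state N n "\<Sum>j<k. 0" rf Xi "\<lambda>b. sample_list (\<lambda>_. 0) \<rho> [0..<k] ! b" by (rule product_state)
  have t: "(\<lambda>j. total_samples [] * qcount j ss) = (\<lambda>_. 0)" by (simp add: total_samples_def)
  have p: "\<forall>p\<in>set []. \<bar>snd (p :: nat \<times> real)\<bar> \<le> 1" by simp
  \<comment> \<open>The empty sum approximates the arcsine within 2, because the arcsine is at most
    pi/2 < 2.\<close>
  have r: "\<forall>x. 0 \<le> x \<and> x \<le> 1 \<longrightarrow> \<bar>(\<Sum>p\<leftarrow>[]. snd p * x ^ fst p) - arcsin (x / 2)\<bar> \<le> 2"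
  proof (intro allI impI)
    fix x :: real assume "0 \<le> x \<and> x \<le> 1"
    then show "\<bar>(\<Sum>p\<leftarrow>[]. snd p * x ^ fst p) - arcsin (x / 2)\<bar> \<le> 2"
      using arcsin_bounded [of "x / 2"] pi_less_4 by (auto simp: abs_le_iff)
  qed
  have "op_bound (2 ^ (c.M + rf)) (run_lop (\<lambda>j. enc_unitary n (B j) (l j)) ss) 1" "op_bound (2 ^ (c.M + rf)) (run_lop_adj (\<lambda>j. enc_unitary n (B j) (l j)) ss) 1"
    using samplized_apx [OF p r _ product_state [folded t], unfolded t] unfolding c.apx_def by auto
  moreover have Z': "op_bound (2 ^ (c.M + rf)) Z 1" using Z by (simp only: c.M_def)
  ultimately have "cmod (c.phi (run_lop_adj (\<lambda>j. enc_unitary n (B j) (l j)) ss * Z * run_lop (\<lambda>j. enc_unitary n (B j) (l j)) ss)) \<le> 1"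
    by (intro c.phi_bound c.op_bounded_mult1)
  moreover have "cmod (c.phi (circ_lop_adj [] * Z * circ_lop [])) \<le> 1" using c.phi_bound [OF Z'] by simp
  ultimately show "cmod (c.phi (circ_lop_adj [] * Z * circ_lop []) - c.phi (run_lop_adj (\<lambda>j. enc_unitary n (B j) (l j)) ss * Z * run_lop (\<lambda>j. enc_unitary n (B j) (l j)) ss)) \<le> 2"
    by (intro order_trans [OF norm_triangle_ineq4]) simp
qed simp

end

text \<open>The case distinction at \<delta> = 2 is forced by the cost bound: for \<delta> large
  compared with the query numbers it drops below one sample. For \<delta> < 2 and at least one
  query, Q/\<delta> exceeds 1/2, so one constant absorbs all roundings of the schedule.\<close>

theorem mainTheorem2:
  fixes k :: nat
  assumes "1 \<le> k"
  shows "\<exists>S (c::real). is_samplizer k S \<and> 0 < c \<and>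
    (\<forall>\<delta> A n. 0 < \<delta> \<and> valid_alg k A \<and> 1 \<le> n \<and> (\<forall>j<k. n + 1 \<le> owid A j) \<longrightarrow>
      (let Q = real (\<Sum>j<k. query_count A j); L = (ln (2 + Q / \<delta>))\<^sup>2 in
        (\<forall>j<k. real (s_cnt (S \<delta> A n) j) \<le> c * real (query_count A j) * Q / \<delta> * L) \<and>
        real (length (sgates (S \<delta> A n))) \<le> real (gate_count A) + c * Q\<^sup>2 * real n / \<delta> * L))"
proof -
  obtain ks rr c where c0: "0 < c"
    and ks1: "\<And>y p. 1/2 \<le> y \<Longrightarrow> p \<in> set (ks y) \<Longrightarrow> \<bar>snd p\<bar> \<le> 1"
    and rr0: "\<And>y. 1/2 \<le> y \<Longrightarrow> 0 \<le> rr y"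
    and ksr: "\<And>y x. 1/2 \<le> y \<Longrightarrow> 0 \<le> x \<Longrightarrow> x \<le> 1 \<Longrightarrow> \<bar>(\<Sum>p\<leftarrow>ks y. snd p * x ^ fst p) - arcsin (x / 2)\<bar> \<le> rr y"
    and err: "\<And>y. 1/2 \<le> y \<Longrightarrow> (\<Sum>p\<leftarrow>ks y. 8 * (snd p)\<^sup>2) + 4 * rr y \<le> 1 / y"
    and tot: "\<And>y. 1/2 \<le> y \<Longrightarrow> real (total_samples (ks y)) \<le> c * y * (ln (2 + y))\<^sup>2"
    and len: "\<And>y. 1/2 \<le> y \<Longrightarrow> real (length (ks y)) \<le> c * y * (ln (2 + y))\<^sup>2"
    and one: "\<And>y. 1/2 \<le> y \<Longrightarrow> 1 \<le> c * y * (ln (2 + y))\<^sup>2"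
    by (rule schedule_exists) blast
  define Q where "Q = (\<lambda>A. real (\<Sum>j<k. query_count A j))"
  \<comment> \<open>The inverse of the error allowed per query. The maximum equals Q/\<delta> as
    soon as there is a query and \<delta> < 2; otherwise it merely keeps the argument in the range
    of the schedule.\<close>
  define y where "y = (\<lambda>\<delta> A. max (1/2) (Q A / \<delta>))"
  define S :: "real \<Rightarrow> qalg \<Rightarrow> nat \<Rightarrow> scirc" where
    "S = (\<lambda>\<delta> A n. if 2 \<le> \<delta> then \<lparr>s_cnt = (\<lambda>_. 0), anc = 0, sgates = []\<rparr>
       else let t = (\<lambda>j. total_samples (ks (y \<delta> A)) * qcount j (steps A)) in
        \<lparr>s_cnt = t, anc = 0, sgates = compile (width A) n (ks (y \<delta> A)) (\<lambda>j. \<Sum>i<j. t i) (steps A)\<rparr>)"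
  have yh: "1/2 \<le> y \<delta> A" for \<delta> A by (simp add: y_def)
  have Q0: "0 \<le> Q A" for A by (simp add: Q_def sum_nonneg)
  have yQ: "y \<delta> A = Q A / \<delta>" if "0 < \<delta>" "\<delta> < 2" "Q A \<noteq> 0" for \<delta> A
  proof -
    have "(\<Sum>j<k. query_count A j) \<noteq> 0" using that(3) unfolding Q_def by (simp del: sum_eq_0_iff of_nat_sum)
    then have "1 \<le> Q A" unfolding Q_def by linarith
    then have "1/2 \<le> Q A / \<delta>" using that by (simp add: field_simps)
    then show ?thesis by (simp add: y_def)
  qed
  have qc: "query_count A j = qcount j (steps A)" for A j by (simp add: query_count_def qcount_def)
  have wf_step: "\<forall>s\<in>set (steps A). wf_step k (width A) (owid A) s" if "valid_alg k A" for A
    using that by (simp add: valid_alg_def wf_step_def)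
  have "is_samplizer k S"
    unfolding is_samplizer_def Let_def
  proof (intro allI impI, elim conjE)
    fix \<delta> :: real and A n \<rho>
    assume \<delta>: "0 < \<delta>" and A: "valid_alg k A" and n: "1 \<le> n" and ow: "\<forall>j<k. n + 1 \<le> owid A j"
      and dens: "\<forall>j<k. Defs.density (2 ^ n) (\<rho> j)"
    let ?N = "width A"
    \<comment> \<open>Eigenbases are chosen for all states at once. They enter only the oracles U,
      not the circuit.\<close>
    have "\<forall>j\<in>{..<k}. \<exists>Bl. unitary (2 ^ n) (fst Bl) \<and> (\<forall>m<2 ^ n. 0 \<le> snd Bl m \<and> snd Bl m \<le> 1)
        \<and> eqm (2 ^ n) (\<rho> j) (fun_calc (2 ^ n) (fst Bl) (\<lambda>m. complex_of_real (snd Bl m)))"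
    proof
      fix j assume "j \<in> {..<k}"
      then have "Defs.density (2 ^ n) (\<rho> j)" using dens by simp
      then show "\<exists>Bl. unitary (2 ^ n) (fst Bl) \<and> (\<forall>m<2 ^ n. 0 \<le> snd Bl m \<and> snd Bl m \<le> 1)
        \<and> eqm (2 ^ n) (\<rho> j) (fun_calc (2 ^ n) (fst Bl) (\<lambda>m. complex_of_real (snd Bl m)))"
        by (rule density_spectral) auto
    qed
    then obtain Bl where Bl: "\<forall>j\<in>{..<k}. unitary (2 ^ n) (fst (Bl j)) \<and> (\<forall>m<2 ^ n. 0 \<le> snd (Bl j) m \<and> snd (Bl j) m \<le> 1)
        \<and> eqm (2 ^ n) (\<rho> j) (fun_calc (2 ^ n) (fst (Bl j)) (\<lambda>m. complex_of_real (snd (Bl j) m)))"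
      unfolding bchoice_iff by blast
    define B where "B = (\<lambda>j. fst (Bl j))"
    define l where "l = (\<lambda>j. snd (Bl j))"
    have B: "\<forall>j<k. unitary (2 ^ n) (B j)" and l: "\<forall>j<k. \<forall>m<2 ^ n. 0 \<le> l j m \<and> l j m \<le> 1"
      and \<rho>: "\<forall>j<k. eqm (2 ^ n) (\<rho> j) (fun_calc (2 ^ n) (B j) (\<lambda>m. complex_of_real (l j m)))"
      using Bl by (auto simp: B_def l_def)
    define U where "U = (\<lambda>j. enc_unitary n (B j) (l j))"
    have be: "\<forall>j<k. block_encoding n (owid A j - n) 1 0 (U j) (\<lambda>x y. \<rho> j x y / 2)"
      unfolding U_def using B l \<rho> ow by (auto intro!: block_encoding_enc_unitary)
    have main: "(\<forall>g\<in>set (sgates (S \<delta> A n)). is_gate (sc_width k ?N n (S \<delta> A n)) g) \<and>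
      diamond_norm ?N (\<lambda>X x y. sc_channel k ?N n (S \<delta> A n) \<rho> X x y - uchan (2 ^ ?N) (alg_unitary A U) X x y) \<le> \<delta>"
    proof (cases "2 \<le> \<delta>")
      case True
      then show ?thesis
        using empty_circuit [OF wf_step [OF A] ow dens B \<rho> l] by (simp add: S_def alg_unitary_def U_def)
    next
      case False
      let ?ks = "ks (y \<delta> A)"
      define t where "t = (\<lambda>j. total_samples ?ks * qcount j (steps A))"
      define gs where "gs = compile ?N n ?ks (\<lambda>j. \<Sum>i<j. t i) (steps A)"
      have S: "S \<delta> A n = \<lparr>s_cnt = t, anc = 0, sgates = gs\<rparr>" using False by (simp add: S_def t_def gs_def Let_def)
      have k1: "\<forall>p\<in>set ?ks. \<bar>snd p\<bar> \<le> 1" using ks1 [OF yh] by blast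
      have k2: "\<forall>x. 0 \<le> x \<and> x \<le> 1 \<longrightarrow> \<bar>(\<Sum>p\<leftarrow>?ks. snd p * x ^ fst p) - arcsin (x / 2)\<bar> \<le> rr (y \<delta> A)"
        using ksr [OF yh] by blast
      note scalar = samplized_circuit [OF wf_step [OF A] ow dens B \<rho> l k1 k2 rr0 [OF yh], folded t_def, folded gs_def U_def]
      have "Q A * ((\<Sum>p\<leftarrow>?ks. 8 * (snd p)\<^sup>2) + 4 * rr (y \<delta> A)) \<le> \<delta>"
      proof (cases "Q A = 0")
        case True
        then show ?thesis using \<delta> by simp
      next
        case QA: False
        have "Q A * ((\<Sum>p\<leftarrow>?ks. 8 * (snd p)\<^sup>2) + 4 * rr (y \<delta> A)) \<le> Q A * (1 / (Q A / \<delta>))"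
          using err [OF yh, of \<delta> A] Q0 yQ [OF \<delta> _ QA] False by (intro mult_left_mono) auto
        then show ?thesis using QA by simp
      qed
      moreover have "real (\<Sum>j<k. qcount j (steps A)) = Q A" by (simp add: Q_def qc)
      ultimately show ?thesis
        using scalar unfolding S by (simp add: wf_gates_def sc_width_def alg_unitary_def)
    qed
    then show "(\<forall>g\<in>set (sgates (S \<delta> A n)). is_gate (sc_width k ?N n (S \<delta> A n)) g) \<and>
        (\<exists>U. (\<forall>j<k. block_encoding n (owid A j - n) 1 0 (U j) (\<lambda>x y. \<rho> j x y / 2)) \<and>
             diamond_norm ?N (\<lambda>X x y. sc_channel k ?N n (S \<delta> A n) \<rho> X x y
                                     - uchan (2 ^ ?N) (alg_unitary A U) X x y) \<le> \<delta>)"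
      using be by blast
  qed
  moreover have "(\<forall>j<k. real (s_cnt (S \<delta> A n) j) \<le> 16 * c * real (query_count A j) * Q A / \<delta> * (ln (2 + Q A / \<delta>))\<^sup>2) \<and>
        real (length (sgates (S \<delta> A n))) \<le> real (gate_count A) + 16 * c * (Q A)\<^sup>2 * real n / \<delta> * (ln (2 + Q A / \<delta>))\<^sup>2"
    if h: "0 < \<delta>" "valid_alg k A" "1 \<le> n" "\<forall>j<k. n + 1 \<le> owid A j" for \<delta> A n
  proof (cases "2 \<le> \<delta>")
    case True
    then show ?thesis using h(1) c0 Q0 by (simp add: S_def)
  next
    case False
    let ?y = "y \<delta> A" and ?ks = "ks (y \<delta> A)"
    define t where "t = (\<lambda>j. total_samples ?ks * qcount j (steps A))"
    define gs where "gs = compile (width A) n ?ks (\<lambda>j. \<Sum>i<j. t i) (steps A)"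
    have S: "S \<delta> A n = \<lparr>s_cnt = t, anc = 0, sgates = gs\<rparr>" using False by (simp add: S_def t_def gs_def Let_def)
    have QA: "(\<Sum>j<k. qcount j (steps A)) = (\<Sum>j<k. query_count A j)" by (simp add: qc)
    have "length gs = gate_count A + (\<Sum>j<k. query_count A j) * (14 * n * total_samples ?ks + length ?ks + 1)"
      unfolding gs_def using length_compile [OF wf_step [OF h(2)] h(4)] by (simp add: gate_count_def QA)
    then have lg: "real (length gs) = real (gate_count A) + Q A * (14 * real n * real (total_samples ?ks) + real (length ?ks) + 1)"
      by (simp add: Q_def algebra_simps)
    show ?thesis
    proof (cases "Q A = 0")
      case True
      then have "query_count A j = 0" if "j < k" for j
        using that unfolding Q_def by (simp add: sum_eq_0_iff del: of_nat_sum)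
      then show ?thesis using lg True by (simp add: S t_def qc)
    next
      case QA0: False
      have yy: "?y = Q A / \<delta>" using yQ h(1) False QA0 by auto
      define bb where "bb = c * (Q A / \<delta>) * (ln (2 + Q A / \<delta>))\<^sup>2"
      have b: "real (total_samples ?ks) \<le> bb" "real (length ?ks) \<le> bb" "1 \<le> bb"
        using tot [OF yh, of \<delta> A] len [OF yh, of \<delta> A] one [OF yh, of \<delta> A] unfolding yy bb_def by auto
      have n1: "1 \<le> real n" using h(3) by simp
      have "real (t j) \<le> 16 * c * real (query_count A j) * Q A / \<delta> * (ln (2 + Q A / \<delta>))\<^sup>2" for j
      proof -
        have "real (t j) \<le> real (query_count A j) * bb"
          unfolding t_def qc using mult_left_mono [OF b(1), of "real (qcount j (steps A))"] by (simp add: mult.commute)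
        also have "\<dots> \<le> 16 * (real (query_count A j) * bb)" using b(3) by simp
        finally show ?thesis by (simp add: bb_def mult_ac)
      qed
      \<comment> \<open>16 = 14 + 1 + 1: controlled swaps, rotations and the final gate of a query,
        each bounded by the same \<open>bb\<close>; n \<ge> 1 absorbs the last two.\<close>
      moreover have "14 * real n * real (total_samples ?ks) + real (length ?ks) + 1 \<le> 16 * (real n * bb)"
      proof -
        have "real n * real (total_samples ?ks) \<le> real n * bb" using b(1) by (intro mult_left_mono) auto
        moreover have "1 * bb \<le> real n * bb" using b(3) n1 by (intro mult_right_mono) auto
        ultimately show ?thesis using b by linarith
      qed
      then have "Q A * (14 * real n * real (total_samples ?ks) + real (length ?ks) + 1) \<le> Q A * (16 * (real n * bb))"
        using Q0 by (rule mult_left_mono)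
      then have "real (length gs) \<le> real (gate_count A) + 16 * c * (Q A)\<^sup>2 * real n / \<delta> * (ln (2 + Q A / \<delta>))\<^sup>2"
        unfolding lg by (simp add: bb_def power2_eq_square mult_ac)
      ultimately show ?thesis by (simp add: S)
    qed
  qed
  ultimately show ?thesis
    using c0 by (intro exI [of _ S] exI [of _ "16 * c"]) (simp add: Let_def Q_def)
qed

end
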